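(* Let $m$ be a positive integer, $\lambda>m/2$ real, $\mu_0=1$, $\mu_1,\dots,\mu_m>0$, $\boldsymbol\mu=(\mu_0,\dots,\mu_m)$. The operator $M$ of multiplication by $z$, $(Mf)(z)=zf(z)$, on $\mathbf A^{(\lambda,\boldsymbol\mu)}(\mathbb D)$ is the sum of $U_+$ and of an operator in the Hilbert–Schmidt class. In particular, $M$ is bounded and its adjoint belongs to the Cowen–Douglas class of $\mathbb D$.
   Context: $\mathbb D$ is the open unit disc in $\mathbb C$. For $\alpha>0$, $A^{(\alpha)}(\mathbb D)$ is the Hilbert space of holomorphic functions on $\mathbb D$ with reproducing kernel $(1-z\bar\omega)^{-2\alpha}$. Put $2\lambda_j=2\lambda-m+2j$ for $0\le j\le m$ and $(x)_n=x(x+1)\cdots(x+n-1)$. Vectors in $\mathbb C^{m+1}$ have components indexed by $0,\dots,m$. Define $\Gamma_j:A^{(\lambda_j)}(\mathbb D)\to \mathrm{Hol}(\mathbb D,\mathbb C^{m+1})$ by $(\Gamma_jf)_\ell=\binom{\ell}{j}\frac{1}{(2\lambda_j)_{\ell-j}}f^{(\ell-j)}$ if $\ell\ge j$ and $(\Gamma_jf)_\ell=0$ if $\ell<j$. Each $\Gamma_j$ is injective and the sum of the images of $\Gamma_0,\dots,\Gamma_m$ is direct. $\mathbf A^{(\lambda,\boldsymbol\mu)}(\mathbb D)$ is this direct sum of images, with the inner product $\langle\sum_j\Gamma_jf_j,\sum_j\Gamma_jg_j\rangle=\sum_j\mu_j^{-2}\langle f_j,g_j\rangle_{A^{(\lambda_j)}}$;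 it is a Hilbert space of $\mathbb C^{m+1}$-valued holomorphic functions with reproducing kernel $\mathbf B^{(\lambda,\boldsymbol\mu)}=\sum_{j=0}^m\mu_j^2\,\mathbf B^{(\lambda_j)}$, where $\mathbf B^{(\lambda_j)}$ is the reproducing kernel of the image of $\Gamma_j$ equipped with the inner product transferred from $A^{(\lambda_j)}(\mathbb D)$. Let $e^j_n=\Gamma_j\big(\sqrt{(2\lambda_j)_n/n!}\;z^n\big)$ for $n\ge0$, $0\le j\le m$; the vectors $\mu_je^j_n$ form an orthonormal basis of $\mathbf A^{(\lambda,\boldsymbol\mu)}(\mathbb D)$. $U_+$ is the bounded operator on $\mathbf A^{(\lambda,\boldsymbol\mu)}(\mathbb D)$ determined by $U_+e^j_{n-j}=e^j_{n+1-j}$ for $0\le j\le\min(m,n)$. For a positive integer $k$, $\mathrm B_k(\mathbb D)$ is the set of bounded operators $T$ on a Hilbert space $\mathcal H$ such that for every $\omega\in\mathbb D$ the operator $T-\omega I$ is surjective with $\dim\ker(T-\omega I)=k$, and the closed linear span of $\bigcup_{\omega\in\mathbb D}\ker(T-\omega I)$ is $\mathcal H$. The Cowen–Douglas class of $\mathbb D$ is the union of the $\mathrm B_k(\mathbb D)$, $k\ge1$. *)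

theory Defs
  imports
    "HOL-Complex_Analysis.Complex_Analysis"
    "HOL-Library.Function_Algebras"
begin

subsection \<open>Complex vector spaces\<close>

class complex_vector = ab_group_add +
  fixes scaleC :: "complex \<Rightarrow> 'a \<Rightarrow> 'a"  (infixr "*\<^sub>C" 75)
  assumes scaleC_add_right: "c *\<^sub>C (x + y) = c *\<^sub>C x + c *\<^sub>C y"
    and scaleC_add_left: "(c + d) *\<^sub>C x = c *\<^sub>C x + d *\<^sub>C x"
    and scaleC_scaleC: "c *\<^sub>C d *\<^sub>C x = (c * d) *\<^sub>C x"
    and scaleC_one: "1 *\<^sub>C x = x"

global_interpretation complex_vector: vector_space "scaleC :: complex \<Rightarrow> 'a \<Rightarrow> 'a::complex_vector"
  by unfold_locales
    (simp_all add: scaleC_add_right scaleC_add_left scaleC_scaleC scaleC_one)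

instantiation complex :: complex_vector
begin
definition scaleC_complex :: "complex \<Rightarrow> complex \<Rightarrow> complex" where
  "scaleC_complex c x = c * x"
instance
  by standard (simp_all add: scaleC_complex_def algebra_simps)
end

instantiation "fun" :: (type, complex_vector) complex_vector
begin
definition scaleC_fun :: "complex \<Rightarrow> ('a \<Rightarrow> 'b) \<Rightarrow> 'a \<Rightarrow> 'b" where
  "scaleC_fun c f = (\<lambda>x. c *\<^sub>C f x)"
instance
  by standard
    (simp_all add: scaleC_fun_def fun_eq_iff scaleC_add_right scaleC_add_left
      scaleC_scaleC scaleC_one)
end


subsection \<open>Hilbert spaces as subspaces of an ambient complex vector space\<close>

record 'a hilb =
  carr :: "'a set"
  ip :: "'a \<Rightarrow> 'a \<Rightarrow> complex"

definition hnorm :: "'a hilb \<Rightarrow> 'a \<Rightarrow> real" where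
  "hnorm H x = sqrt (Re (ip H x x))"

text \<open>The inner product is linear in its first argument.\<close>

locale complex_hilbert_space =
  fixes H :: "'a::complex_vector hilb"
  assumes subspace: "complex_vector.subspace (carr H)"
    and ip_add_left: "\<lbrakk>x \<in> carr H; y \<in> carr H; z \<in> carr H\<rbrakk> \<Longrightarrow> ip H (x + y) z = ip H x z + ip H y z"
    and ip_scaleC_left: "\<lbrakk>x \<in> carr H; y \<in> carr H\<rbrakk> \<Longrightarrow> ip H (c *\<^sub>C x) y = c * ip H x y"
    and ip_commute: "\<lbrakk>x \<in> carr H; y \<in> carr H\<rbrakk> \<Longrightarrow> ip H y x = cnj (ip H x y)"
    and ip_pos: "\<lbrakk>x \<in> carr H; x \<noteq> 0\<rbrakk> \<Longrightarrow> 0 < Re (ip H x x)"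
    and complete:
      "\<lbrakk>\<And>n::nat. X n \<in> carr H;
        \<And>\<epsilon>::real. \<epsilon> > 0 \<Longrightarrow> \<exists>N. \<forall>p\<ge>N. \<forall>q\<ge>N. hnorm H (X p - X q) < \<epsilon>\<rbrakk>
       \<Longrightarrow> \<exists>x\<in>carr H. (\<lambda>n. hnorm H (X n - x)) \<longlonglongrightarrow> 0"

definition closed_span :: "'a::complex_vector hilb \<Rightarrow> 'a set \<Rightarrow> 'a set" where
  "closed_span H S =
    {x \<in> carr H. \<forall>\<epsilon>>0. \<exists>y \<in> complex_vector.span S. hnorm H (x - y) < \<epsilon>}"

definition orthonormal_basis :: "'a::complex_vector hilb \<Rightarrow> 'a set \<Rightarrow> bool" where
  "orthonormal_basis H E \<longleftrightarrow>
    E \<subseteq> carr H \<and>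
    (\<forall>x\<in>E. \<forall>y\<in>E. ip H x y = (if x = y then 1 else 0)) \<and>
    closed_span H E = carr H"

text \<open>
  Operators on \<open>H\<close> are functions on the ambient type; only their values on \<open>carr H\<close> matter.
\<close>

definition bounded_operator :: "'a::complex_vector hilb \<Rightarrow> ('a \<Rightarrow> 'a) \<Rightarrow> bool" where
  "bounded_operator H T \<longleftrightarrow>
    (\<forall>x\<in>carr H. T x \<in> carr H) \<and>
    (\<forall>x\<in>carr H. \<forall>y\<in>carr H. T (x + y) = T x + T y) \<and>
    (\<forall>c. \<forall>x\<in>carr H. T (c *\<^sub>C x) = c *\<^sub>C T x) \<and>
    (\<exists>C. \<forall>x\<in>carr H. hnorm H (T x) \<le> C * hnorm H x)"

definition hilbert_schmidt :: "'a::complex_vector hilb \<Rightarrow> ('a \<Rightarrow> 'a) \<Rightarrow> bool" where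
  "hilbert_schmidt H T \<longleftrightarrow>
    bounded_operator H T \<and>
    (\<exists>E. orthonormal_basis H E \<and> (\<lambda>e. (hnorm H (T e))\<^sup>2) summable_on E)"

definition is_adjoint :: "'a::complex_vector hilb \<Rightarrow> ('a \<Rightarrow> 'a) \<Rightarrow> ('a \<Rightarrow> 'a) \<Rightarrow> bool" where
  "is_adjoint H T T' \<longleftrightarrow>
    (\<forall>y\<in>carr H. T' y \<in> carr H) \<and>
    (\<forall>x\<in>carr H. \<forall>y\<in>carr H. ip H (T x) y = ip H x (T' y))"


subsection \<open>The Cowen--Douglas class of the unit disc\<close>

abbreviation unit_disc :: "complex set" where
  "unit_disc \<equiv> ball 0 1"

definition eigenspace :: "'a::complex_vector hilb \<Rightarrow> ('a \<Rightarrow> 'a) \<Rightarrow> complex \<Rightarrow> 'a set" where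
  "eigenspace H T \<omega> = {x \<in> carr H. T x - \<omega> *\<^sub>C x = 0}"

text \<open>
  The library's \<open>dim\<close> is \<open>0\<close> on infinite-dimensional spaces, so for positive \<open>k\<close> the
  condition \<open>dim = k\<close> includes finite-dimensionality.
\<close>

definition cowen_douglas_B :: "nat \<Rightarrow> 'a::complex_vector hilb \<Rightarrow> ('a \<Rightarrow> 'a) \<Rightarrow> bool" where
  "cowen_douglas_B k H T \<longleftrightarrow>
    complex_hilbert_space H \<and> bounded_operator H T \<and>
    (\<forall>\<omega>\<in>unit_disc.
      (\<lambda>x. T x - \<omega> *\<^sub>C x) ` carr H = carr H \<and>
      complex_vector.dim (eigenspace H T \<omega>) = k) \<and>
    closed_span H (\<Union>\<omega>\<in>unit_disc. eigenspace H T \<omega>) = carr H"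

definition cowen_douglas :: "'a::complex_vector hilb \<Rightarrow> ('a \<Rightarrow> 'a) \<Rightarrow> bool" where
  "cowen_douglas H T \<longleftrightarrow> (\<exists>k\<ge>1. cowen_douglas_B k H T)"


subsection \<open>Scalar spaces on the disc given by a reproducing kernel\<close>

text \<open>
  Functions on the disc are represented by total functions vanishing off the disc.
\<close>

definition on_disc :: "(complex \<Rightarrow> 'a::zero) \<Rightarrow> complex \<Rightarrow> 'a" where
  "on_disc f = (\<lambda>z. if z \<in> unit_disc then f z else 0)"

text \<open>
  The last clause fixes the irrelevant values of the inner product off the carrier, so that the
  kernel determines the record \<open>H\<close> uniquely.
\<close>

definition holomorphic_rkhs ::
  "(complex \<Rightarrow> complex \<Rightarrow> complex) \<Rightarrow> (complex \<Rightarrow> complex) hilb \<Rightarrow> bool" where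
  "holomorphic_rkhs K H \<longleftrightarrow>
    complex_hilbert_space H \<and>
    (\<forall>f\<in>carr H. f holomorphic_on unit_disc \<and> (\<forall>z. z \<notin> unit_disc \<longrightarrow> f z = 0)) \<and>
    (\<forall>\<omega>\<in>unit_disc.
      on_disc (\<lambda>z. K z \<omega>) \<in> carr H \<and>
      (\<forall>f\<in>carr H. ip H f (on_disc (\<lambda>z. K z \<omega>)) = f \<omega>)) \<and>
    (\<forall>f g. f \<notin> carr H \<or> g \<notin> carr H \<longrightarrow> ip H f g = 0)"

text \<open>
  For \<open>z, \<omega>\<close> in the disc, \<open>1 - z * cnj \<omega>\<close> has positive real part, so the principal branch of
  the power is the holomorphic one that is \<open>1\<close> at \<open>z = 0\<close>.
\<close>

definition weighted_bergman :: "real \<Rightarrow> (complex \<Rightarrow> complex) hilb" where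
  "weighted_bergman \<alpha> =
    (THE H. holomorphic_rkhs (\<lambda>z \<omega>. (1 - z * cnj \<omega>) powr (- complex_of_real (2 * \<alpha>))) H)"


subsection \<open>The spaces of vector-valued functions\<close>

text \<open>
  A vector in $\mathbb{C}^{m+1}$ is a function \<open>nat \<Rightarrow> complex\<close> vanishing at all indices
  greater than \<open>m\<close>.
\<close>

definition lam_idx :: "nat \<Rightarrow> real \<Rightarrow> nat \<Rightarrow> real" where
  "lam_idx m lam j = (2 * lam - real m + 2 * real j) / 2"

definition Gam ::
  "nat \<Rightarrow> real \<Rightarrow> nat \<Rightarrow> (complex \<Rightarrow> complex) \<Rightarrow> complex \<Rightarrow> nat \<Rightarrow> complex" where
  "Gam m lam j f = on_disc (\<lambda>z l.
    if j \<le> l \<and> l \<le> m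
    then of_nat (l choose j) * (1 / complex_of_real (pochhammer (2 * lam_idx m lam j) (l - j)))
      * (deriv ^^ (l - j)) f z
    else 0)"

definition components :: "nat \<Rightarrow> real \<Rightarrow> (nat \<Rightarrow> complex \<Rightarrow> complex) set" where
  "components m lam = {f. \<forall>j\<le>m. f j \<in> carr (weighted_bergman (lam_idx m lam j))}"

definition Gam_sum ::
  "nat \<Rightarrow> real \<Rightarrow> (nat \<Rightarrow> complex \<Rightarrow> complex) \<Rightarrow> complex \<Rightarrow> nat \<Rightarrow> complex" where
  "Gam_sum m lam f = (\<Sum>j\<le>m. Gam m lam j (f j))"

text \<open>
  The inner product is well defined on the carrier because each \<open>Gam m lam j\<close> is injective on
  \<open>weighted_bergman (lam_idx m lam j)\<close> and the sum of the images is direct.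
\<close>

definition A_space ::
  "nat \<Rightarrow> real \<Rightarrow> (nat \<Rightarrow> real) \<Rightarrow> (complex \<Rightarrow> nat \<Rightarrow> complex) hilb" where
  "A_space m lam mu =
    \<lparr> carr = Gam_sum m lam ` components m lam,
      ip = (\<lambda>F G. THE c. \<exists>f\<in>components m lam. \<exists>g\<in>components m lam.
        F = Gam_sum m lam f \<and> G = Gam_sum m lam g \<and>
        c = (\<Sum>j\<le>m. complex_of_real (1 / (mu j)\<^sup>2)
              * ip (weighted_bergman (lam_idx m lam j)) (f j) (g j))) \<rparr>"

definition e_vec :: "nat \<Rightarrow> real \<Rightarrow> nat \<Rightarrow> nat \<Rightarrow> complex \<Rightarrow> nat \<Rightarrow> complex" where
  "e_vec m lam j n = Gam m lam j
    (on_disc (\<lambda>z. complex_of_real (sqrt (pochhammer (2 * lam_idx m lam j) n / fact n)) * z ^ n))"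

text \<open>
  These conditions determine \<open>U\<close> on the carrier of \<open>A_space m lam mu\<close>, since the vectors
  \<open>e_vec m lam j n\<close> span a dense subspace.
\<close>

definition is_U_plus ::
  "nat \<Rightarrow> real \<Rightarrow> (nat \<Rightarrow> real) \<Rightarrow>
    ((complex \<Rightarrow> nat \<Rightarrow> complex) \<Rightarrow> (complex \<Rightarrow> nat \<Rightarrow> complex)) \<Rightarrow> bool" where
  "is_U_plus m lam mu U \<longleftrightarrow>
    bounded_operator (A_space m lam mu) U \<and>
    (\<forall>n. \<forall>j\<le>min m n. U (e_vec m lam j (n - j)) = e_vec m lam j (n + 1 - j))"

definition mult_z :: "(complex \<Rightarrow> nat \<Rightarrow> complex) \<Rightarrow> complex \<Rightarrow> nat \<Rightarrow> complex" where
  "mult_z F = (\<lambda>z. z *\<^sub>C F z)"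

end

theory Submission
  imports Defs
begin

text \<open>
  In the coordinates \<open>F = (F\<^sub>0, \<dots>, F\<^sub>m)\<close> the space \<open>A_space m lam mu\<close> is, as a set, the direct sum of
  the weighted Bergman spaces of parameters \<open>lam_idx m lam l\<close>, with an equivalent norm: the
  derivative maps the space of parameter \<open>\<alpha>\<close> boundedly to that of parameter \<open>\<alpha> + 1\<close>, so the passage
  from the summands \<open>f\<^sub>j\<close> to the components \<open>F\<^sub>l\<close> is a bounded, unitriangular, hence boundedly invertible, map.
  In these coordinates multiplication by \<open>z\<close> acts componentwise, and so does the difference quotient
  \<open>f \<mapsto> (f - f(\<omega>)) / (z - \<omega>)\<close>, a bounded left inverse of \<open>M - \<omega>\<close> whose defect is the evaluation
  at \<open>\<omega>\<close>. Taking adjoints gives the surjectivity of \<open>M\<^sup>* - \<omega>\<close>, and its kernel is spanned by the \<open>m + 1\<close>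
  vectors representing the evaluations. The Hilbert--Schmidt estimate reduces to the scalar case because
  commuting \<open>z\<close> with the \<open>i\<close>-th derivative only produces an \<open>(i-1)\<close>-st derivative, which is smaller by a
  factor of order \<open>1/n\<close> on monomials of degree \<open>n\<close>.
\<close>

subsection \<open>Hilbert spaces\<close>

text \<open>Both \<open>weighted_bergman\<close> and the inner product of \<open>A_space\<close> are
  definite descriptions, so each needs a model and a uniqueness argument before anything can be
  computed. The model is a space of square summable sequences: \<open>bfun\<close> turns sequences
  into holomorphic functions, and \<Psi> assembles \<open>m + 1\<close> of them into an element of
  \<open>A_space\<close>. Completeness, orthonormal bases and the shift are carried along these
  unitary maps. Every estimate then becomes one on Taylor coefficients with the weights
  \<open>bwt \<alpha> n\<close> = n! / (2\<alpha>)_n, the squared norms of z^n. The delicate bound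
  is that of the difference quotient. Its coefficients satisfy b_n = a_(n+1) + w b_(n+1), while the
  weights grow or decay polynomially depending on \<alpha>. The geometric decay coming from the
  recursion wins, because the ratio of two weights k steps apart is at most the k-th coefficient of
  (1 - r)^(-2\<alpha> - 1), a series that converges for every r < 1. The rate 1/n in the comparison
  with \<open>U_plus\<close> suffices because its squares are summable and the basis consists of
  only \<open>m + 1\<close> sequences.\<close>

lemmas scaleC_simps [simp] = complex_vector.scale_zero_left complex_vector.scale_zero_right
  scaleC_one complex_vector.scale_minus_left complex_vector.scale_minus_right

context complex_hilbert_space
begin

lemma zero_mem [simp]: "0 \<in> carr H"
  using subspace by (rule complex_vector.subspace_0)

lemma add_mem [simp]: "x \<in> carr H \<Longrightarrow> y \<in> carr H \<Longrightarrow> x + y \<in> carr H"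
  using subspace by (rule complex_vector.subspace_add)

lemma diff_mem [simp]: "x \<in> carr H \<Longrightarrow> y \<in> carr H \<Longrightarrow> x - y \<in> carr H"
  using subspace by (rule complex_vector.subspace_diff)

lemma uminus_mem [simp]: "x \<in> carr H \<Longrightarrow> - x \<in> carr H"
  using subspace by (rule complex_vector.subspace_neg)

lemma scaleC_mem [simp]: "x \<in> carr H \<Longrightarrow> c *\<^sub>C x \<in> carr H"
  using subspace by (rule complex_vector.subspace_scale)

lemma sum_mem: "(\<And>i. i \<in> A \<Longrightarrow> f i \<in> carr H) \<Longrightarrow> sum f A \<in> carr H"
  using subspace by (rule complex_vector.subspace_sum)

lemma span_mem: "S \<subseteq> carr H \<Longrightarrow> complex_vector.span S \<subseteq> carr H"
  using subspace by (rule complex_vector.span_minimal[rotated])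

lemma ip_add_right:
  assumes "x \<in> carr H" "y \<in> carr H" "z \<in> carr H"
  shows "ip H x (y + z) = ip H x y + ip H x z"
  using assms ip_commute[of x "y + z"] ip_commute[of x y] ip_commute[of x z]
    ip_commute[of "y + z" x] ip_add_left[of y z x]
  by (metis add_mem complex_cnj_add ip_commute)

lemma ip_scaleC_right:
  assumes "x \<in> carr H" "y \<in> carr H"
  shows "ip H x (c *\<^sub>C y) = cnj c * ip H x y"
  using assms by (metis complex_cnj_mult ip_commute ip_scaleC_left scaleC_mem)

lemma ip_zero_left [simp]: "x \<in> carr H \<Longrightarrow> ip H 0 x = 0"
  using ip_scaleC_left[of 0 x 0] by simp

lemma ip_zero_right [simp]: "x \<in> carr H \<Longrightarrow> ip H x 0 = 0"
  using ip_scaleC_right[of x 0 0] by simp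

lemma ip_minus_left: "x \<in> carr H \<Longrightarrow> y \<in> carr H \<Longrightarrow> ip H (- x) y = - ip H x y"
  using ip_scaleC_left[of x y "- 1"] by simp

lemma ip_minus_right: "x \<in> carr H \<Longrightarrow> y \<in> carr H \<Longrightarrow> ip H x (- y) = - ip H x y"
  using ip_scaleC_right[of x y "- 1"] by simp

lemma ip_diff_left:
  "x \<in> carr H \<Longrightarrow> y \<in> carr H \<Longrightarrow> z \<in> carr H \<Longrightarrow> ip H (x - y) z = ip H x z - ip H y z"
  using ip_add_left[of x "- y" z] ip_minus_left[of y z] by simp

lemma ip_diff_right:
  "x \<in> carr H \<Longrightarrow> y \<in> carr H \<Longrightarrow> z \<in> carr H \<Longrightarrow> ip H x (y - z) = ip H x y - ip H x z"
  using ip_add_right[of x y "- z"] ip_minus_right[of x z] by simp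

lemmas ip_simps = ip_add_left ip_add_right ip_diff_left ip_diff_right
  ip_scaleC_left ip_scaleC_right ip_minus_left ip_minus_right

lemma ip_sum_left:
  "(\<And>i. i \<in> A \<Longrightarrow> f i \<in> carr H) \<Longrightarrow> y \<in> carr H \<Longrightarrow> ip H (sum f A) y = (\<Sum>i\<in>A. ip H (f i) y)"
  by (induction A rule: infinite_finite_induct) (auto simp: ip_add_left sum_mem)

lemma ip_sum_right:
  "(\<And>i. i \<in> A \<Longrightarrow> f i \<in> carr H) \<Longrightarrow> x \<in> carr H \<Longrightarrow> ip H x (sum f A) = (\<Sum>i\<in>A. ip H x (f i))"
  by (induction A rule: infinite_finite_induct) (auto simp: ip_add_right sum_mem)

lemma Im_ip_self: "x \<in> carr H \<Longrightarrow> Im (ip H x x) = 0"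
  using ip_commute[of x x] by (simp add: complex_eq_iff)

lemma Re_ip_self_nonneg: "x \<in> carr H \<Longrightarrow> 0 \<le> Re (ip H x x)"
  using ip_pos[of x] by (cases "x = 0") auto

lemma hnorm_nonneg [simp]: "x \<in> carr H \<Longrightarrow> 0 \<le> hnorm H x"
  by (simp add: hnorm_def Re_ip_self_nonneg)

lemma hnorm_sq: "x \<in> carr H \<Longrightarrow> (hnorm H x)\<^sup>2 = Re (ip H x x)"
  by (simp add: hnorm_def Re_ip_self_nonneg)

lemma ip_self: "x \<in> carr H \<Longrightarrow> ip H x x = complex_of_real ((hnorm H x)\<^sup>2)"
  by (simp add: hnorm_sq complex_eq_iff Im_ip_self)

lemma hnorm_eq_0: "x \<in> carr H \<Longrightarrow> hnorm H x = 0 \<longleftrightarrow> x = 0"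
  using ip_pos[of x] by (cases "x = 0") (auto simp: hnorm_def)

lemma hnorm_zero [simp]: "hnorm H 0 = 0"
  by (simp add: hnorm_eq_0)

lemma hnorm_scaleC: "x \<in> carr H \<Longrightarrow> hnorm H (c *\<^sub>C x) = cmod c * hnorm H x"
proof -
  assume x: "x \<in> carr H"
  have "(hnorm H (c *\<^sub>C x))\<^sup>2 = Re ((c * cnj c) * ip H x x)"
    using x by (simp add: hnorm_sq ip_simps mult_ac)
  also have "\<dots> = (cmod c * hnorm H x)\<^sup>2"
    using x by (simp add: complex_mult_cnj cmod_power2 ip_self power_mult_distrib)
  finally show ?thesis
    using x by (simp add: power2_eq_iff_nonneg)
qed

lemma hnorm_minus: "x \<in> carr H \<Longrightarrow> hnorm H (- x) = hnorm H x"
  using hnorm_scaleC[of x "- 1"] by simp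

lemma hnorm_diff_commute: "x \<in> carr H \<Longrightarrow> y \<in> carr H \<Longrightarrow> hnorm H (x - y) = hnorm H (y - x)"
  using hnorm_minus[of "x - y"] by simp

lemma Cauchy_Schwarz:
  assumes x: "x \<in> carr H" and y: "y \<in> carr H"
  shows "cmod (ip H x y) \<le> hnorm H x * hnorm H y"
proof (cases "y = 0")
  case False
  define c where "c = ip H x y"
  define s where "s = (hnorm H y)\<^sup>2"
  have s: "s > 0"
    using False y by (simp add: s_def hnorm_eq_0)
  \<comment> \<open>\<open>z\<close> is the part of \<open>x\<close> orthogonal to \<open>y\<close>,
    scaled by the squared norm \<open>s\<close> of \<open>y\<close> so that no division occurs; its
    squared norm is \<open>s\<close> times the gap in the squared inequality.\<close>
  define z where "z = complex_of_real s *\<^sub>C x - c *\<^sub>C y"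
  have "ip H z z = complex_of_real s * (complex_of_real s * ip H x x)
      - complex_of_real s * (cnj c * c) - c * (complex_of_real s * cnj c) + c * cnj c * s"
    using x y by (simp add: z_def ip_simps ip_self[of y] ip_commute[of x y] s_def c_def algebra_simps)
  also have "\<dots> = complex_of_real (s * (s * (hnorm H x)\<^sup>2 - (cmod c)\<^sup>2))"
    using x by (simp add: ip_self algebra_simps flip: complex_norm_square)
  finally have "0 \<le> s * (s * (hnorm H x)\<^sup>2 - (cmod c)\<^sup>2)"
    using Re_ip_self_nonneg[of z] x y by (simp add: z_def)
  hence sq: "(cmod c)\<^sup>2 \<le> (hnorm H x * hnorm H y)\<^sup>2"
    using s by (simp add: zero_le_mult_iff s_def power_mult_distrib mult_ac)
  thus ?thesis
    using power2_le_imp_le[OF sq] x y by (simp add: c_def)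
qed (use x in simp)

lemma hnorm_triangle:
  assumes x: "x \<in> carr H" and y: "y \<in> carr H"
  shows "hnorm H (x + y) \<le> hnorm H x + hnorm H y"
proof (rule power2_le_imp_le)
  have "(hnorm H (x + y))\<^sup>2 = (hnorm H x)\<^sup>2 + (hnorm H y)\<^sup>2 + 2 * Re (ip H x y)"
    using x y by (simp add: hnorm_sq ip_simps ip_commute[of x y])
  also have "Re (ip H x y) \<le> hnorm H x * hnorm H y"
    using Cauchy_Schwarz[OF x y] complex_Re_le_cmod order_trans by blast
  finally show "(hnorm H (x + y))\<^sup>2 \<le> (hnorm H x + hnorm H y)\<^sup>2"
    by (simp add: power2_sum)
qed (use x y in simp)

lemma hnorm_triangle_diff:
  assumes x: "x \<in> carr H" and y: "y \<in> carr H" and z: "z \<in> carr H"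
  shows "hnorm H (x - z) \<le> hnorm H (x - y) + hnorm H (y - z)"
  using hnorm_triangle[of "x - y" "y - z"] x y z by simp

lemma hnorm_diff_le: "x \<in> carr H \<Longrightarrow> y \<in> carr H \<Longrightarrow> hnorm H (x - y) \<le> hnorm H x + hnorm H y"
  using hnorm_triangle[of x "- y"] hnorm_minus[of y] by simp

lemma hnorm_sum_le:
  "(\<And>i. i \<in> A \<Longrightarrow> f i \<in> carr H) \<Longrightarrow> hnorm H (sum f A) \<le> (\<Sum>i\<in>A. hnorm H (f i))"
proof (induction A rule: infinite_finite_induct)
  case (insert a A)
  then show ?case
    using hnorm_triangle[of "f a" "sum f A"] by (fastforce simp: sum_mem)
qed auto

lemma parallelogram:
  assumes x: "x \<in> carr H" and y: "y \<in> carr H"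
  shows "(hnorm H (x + y))\<^sup>2 + (hnorm H (x - y))\<^sup>2 = 2 * (hnorm H x)\<^sup>2 + 2 * (hnorm H y)\<^sup>2"
  using x y by (simp add: hnorm_sq ip_simps)

lemma tendsto_ip_left:
  assumes "\<And>n. X n \<in> carr H" "x \<in> carr H" "y \<in> carr H"
    and "(\<lambda>n. hnorm H (X n - x)) \<longlonglongrightarrow> 0"
  shows "(\<lambda>n. ip H (X n) y) \<longlonglongrightarrow> ip H x y"
proof -
  have "(\<lambda>n. hnorm H (X n - x) * hnorm H y) \<longlonglongrightarrow> 0"
    using tendsto_mult_right[OF assms(4), of "hnorm H y"] by simp
  hence "(\<lambda>n. ip H (X n) y - ip H x y) \<longlonglongrightarrow> 0"
    by (rule Lim_null_comparison[rotated])
       (use assms Cauchy_Schwarz[of "X _ - x" y] in \<open>auto simp: ip_diff_left\<close>)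
  thus ?thesis by (simp add: LIM_zero_iff)
qed

lemma tendsto_ip_right:
  assumes "\<And>n. X n \<in> carr H" "x \<in> carr H" "y \<in> carr H"
    and "(\<lambda>n. hnorm H (X n - x)) \<longlonglongrightarrow> 0"
  shows "(\<lambda>n. ip H y (X n)) \<longlonglongrightarrow> ip H y x"
  using tendsto_cnj[OF tendsto_ip_left[OF assms]] assms(1-3)
  by (simp only: ip_commute[symmetric])

lemma Cauchy_of_tendsto:
  assumes "\<And>n. X n \<in> carr H" "x \<in> carr H"
    and "(\<lambda>n. hnorm H (X n - x)) \<longlonglongrightarrow> 0" and "\<epsilon> > 0"
  shows "\<exists>N. \<forall>p\<ge>N. \<forall>q\<ge>N. hnorm H (X p - X q) < \<epsilon>"
proof -
  obtain N where N: "hnorm H (X n - x) < \<epsilon> / 2" if "n \<ge> N" for n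
    using order_tendstoD(2)[OF assms(3), of "\<epsilon> / 2"] \<open>\<epsilon> > 0\<close>
    by (auto simp: eventually_sequentially)
  have "hnorm H (X p - X q) < \<epsilon>" if "p \<ge> N" "q \<ge> N" for p q
    using N[OF that(1)] N[OF that(2)] hnorm_triangle_diff[of "X p" x "X q"]
      hnorm_diff_commute[of "X q" x] assms(1,2) by fastforce
  thus ?thesis by blast
qed

lemma ip_ext:
  assumes "x \<in> carr H" "y \<in> carr H" "\<And>z. z \<in> carr H \<Longrightarrow> ip H z x = ip H z y"
  shows "x = y"
proof -
  have "ip H (x - y) (x - y) = 0"
    using assms by (simp add: ip_diff_right)
  thus ?thesis
    using ip_pos[of "x - y"] assms by force
qed

text \<open>The representing vector minimises \<open>\<parallel>x\<parallel>\<^sup>2 - 2 Re (\<phi> x)\<close>; minimising sequences are Cauchy by the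
  parallelogram law.\<close>

theorem Riesz_representation:
  assumes add: "\<And>x y. x \<in> carr H \<Longrightarrow> y \<in> carr H \<Longrightarrow> \<phi> (x + y) = \<phi> x + \<phi> y"
    and scale: "\<And>c x. x \<in> carr H \<Longrightarrow> \<phi> (c *\<^sub>C x) = c * \<phi> x"
    and bdd: "\<And>x. x \<in> carr H \<Longrightarrow> cmod (\<phi> x) \<le> C * hnorm H x"
  shows "\<exists>y\<in>carr H. \<forall>x\<in>carr H. \<phi> x = ip H x y"
proof -
  define J where "J x = (hnorm H x)\<^sup>2 - 2 * Re (\<phi> x)" for x
  define d where "d = Inf (J ` carr H)"
  have J_lower: "- C\<^sup>2 \<le> J x" if "x \<in> carr H" for x
  proof -
    have "Re (\<phi> x) \<le> C * hnorm H x"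
      using bdd[OF that] complex_Re_le_cmod order_trans by blast
    moreover have "0 \<le> (hnorm H x - C)\<^sup>2" by simp
    ultimately show ?thesis
      by (simp add: J_def power2_diff mult_ac)
  qed
  have bdd_J: "bdd_below (J ` carr H)"
    using J_lower by (rule bdd_belowI2)
  have d_le: "d \<le> J x" if "x \<in> carr H" for x
    unfolding d_def using bdd_J that by (intro cInf_lower) auto
  have "\<exists>x\<in>carr H. J x < d + 1 / real (Suc n)" for n
    using cInf_lessD[of "J ` carr H" "d + 1 / real (Suc n)"] zero_mem
    by (fastforce simp: d_def)
  then obtain X where X: "\<And>n. X n \<in> carr H" "\<And>n. J (X n) < d + 1 / real (Suc n)"
    by metis
  have \<phi>_diff: "\<phi> (x - y) = \<phi> x - \<phi> y" if "x \<in> carr H" "y \<in> carr H" for x y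
    using add[of x "- y"] scale[of y "- 1"] that by simp
  have dist_le: "(hnorm H (x - y))\<^sup>2 \<le> 2 * (J x - d) + 2 * (J y - d)"
    if x: "x \<in> carr H" and y: "y \<in> carr H" for x y
  proof -
    \<comment> \<open>At the midpoint \<open>J\<close> is still at least \<open>d\<close>, so the
      parallelogram law turns closeness of \<open>J x\<close> and \<open>J y\<close> to
      \<open>d\<close> into closeness of \<open>x\<close> and \<open>y\<close>.\<close>
    define w where "w = (1/2) *\<^sub>C (x + y)"
    have w: "w \<in> carr H" using x y by (simp add: w_def)
    have "(hnorm H w)\<^sup>2 = (hnorm H (x + y))\<^sup>2 / 4"
      using x y by (simp add: w_def hnorm_scaleC power_divide norm_divide)
    moreover have "Re (\<phi> w) = (Re (\<phi> x) + Re (\<phi> y)) / 2"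
      using x y by (simp add: w_def scale add)
    ultimately show ?thesis
      using d_le[OF w] parallelogram[OF x y] by (simp add: J_def field_simps)
  qed
  have lim0: "(\<lambda>n. 1 / real (Suc n)) \<longlonglongrightarrow> 0"
    using LIMSEQ_Suc[OF lim_1_over_n] by simp
  have "\<exists>N. \<forall>p\<ge>N. \<forall>q\<ge>N. hnorm H (X p - X q) < \<epsilon>" if "\<epsilon> > 0" for \<epsilon>
  proof -
    have "0 < \<epsilon>\<^sup>2 / 4" using that by simp
    then obtain N where N: "\<And>n. n \<ge> N \<Longrightarrow> 1 / real (Suc n) < \<epsilon>\<^sup>2 / 4"
      using order_tendstoD(2)[OF lim0] unfolding eventually_sequentially by blast
    have J_near: "J (X n) < d + \<epsilon>\<^sup>2 / 4" if "n \<ge> N" for n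
      using X(2)[of n] add_strict_left_mono[OF N[OF that]] by (rule less_trans)
    have "(hnorm H (X p - X q))\<^sup>2 < \<epsilon>\<^sup>2" if "p \<ge> N" "q \<ge> N" for p q
      using J_near[OF that(1)] J_near[OF that(2)] dist_le[OF X(1) X(1), of p q] by argo
    thus ?thesis using that by (meson power2_less_imp_less less_imp_le)
  qed
  from complete[OF X(1) this] obtain y
    where y: "y \<in> carr H" and lim: "(\<lambda>n. hnorm H (X n - y)) \<longlonglongrightarrow> 0" by blast
  \<comment> \<open>Lower semicontinuity of the norm is enough: the squared norm of
    \<open>X n\<close> is bounded below by an expression affine in \<open>X n\<close>, whose limit
    comes from continuity of the inner product.\<close>
  have Jy: "J y \<le> d"
  proof -
    have "(\<lambda>n. C * hnorm H (X n - y)) \<longlonglongrightarrow> 0"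
      using tendsto_mult_left[OF lim, of C] by simp
    hence "(\<lambda>n. \<phi> (X n) - \<phi> y) \<longlonglongrightarrow> 0"
      by (rule Lim_null_comparison[rotated])
         (use bdd X(1) y in \<open>auto simp flip: \<phi>_diff\<close>)
    hence L1: "(\<lambda>n. \<phi> (X n)) \<longlonglongrightarrow> \<phi> y"
      by (simp add: LIM_zero_iff)
    have L2: "(\<lambda>n. 2 * Re (ip H (X n) y) - (hnorm H y)\<^sup>2) \<longlonglongrightarrow> 2 * Re (ip H y y) - (hnorm H y)\<^sup>2"
      by (intro tendsto_intros tendsto_ip_left X y lim)
    have "2 * Re (ip H (X n) y) - (hnorm H y)\<^sup>2 \<le> (hnorm H (X n))\<^sup>2" for n
    proof -
      have "0 \<le> Re (ip H (X n - y) (X n - y))"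
        using X y by (simp add: Re_ip_self_nonneg)
      thus ?thesis
        using X y by (simp add: ip_simps hnorm_sq ip_commute[of "X n" y])
    qed
    hence le: "2 * Re (ip H (X n) y) - (hnorm H y)\<^sup>2 - 2 * Re (\<phi> (X n)) \<le> d + 1 / real (Suc n)" for n
      using X(2)[of n] unfolding J_def by (smt (verit))
    have "(\<lambda>n. 2 * Re (ip H (X n) y) - (hnorm H y)\<^sup>2 - 2 * Re (\<phi> (X n)))
        \<longlonglongrightarrow> 2 * Re (ip H y y) - (hnorm H y)\<^sup>2 - 2 * Re (\<phi> y)"
      by (intro tendsto_diff L2 tendsto_mult_left tendsto_Re L1)
    hence "2 * Re (ip H y y) - (hnorm H y)\<^sup>2 - 2 * Re (\<phi> y) \<le> d + 0"
      by (rule LIMSEQ_le[OF _ tendsto_add[OF tendsto_const lim0]]) (use le in blast)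
    thus ?thesis
      using y by (simp add: J_def hnorm_sq)
  qed
  have Re_eq: "Re (\<phi> x) = Re (ip H x y)" if x: "x \<in> carr H" for x
  proof -
    define b where "b = Re (ip H x y) - Re (\<phi> x)"
    have ineq: "0 \<le> t\<^sup>2 * (hnorm H x)\<^sup>2 + 2 * t * b" for t :: real
    proof -
      have "J y \<le> J (y + complex_of_real t *\<^sub>C x)"
        using d_le[of "y + complex_of_real t *\<^sub>C x"] Jy x y by simp
      moreover have "J (y + complex_of_real t *\<^sub>C x) = J y + t\<^sup>2 * (hnorm H x)\<^sup>2 + 2 * t * b"
        unfolding J_def b_def using x y
        by (simp add: hnorm_sq ip_simps add scale ip_commute[of x y])
           (simp add: algebra_simps power2_eq_square)
      ultimately show ?thesis by simp
    qed
    \<comment> \<open>The quadratic in \<open>t\<close> has no constant term and slope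
      \<open>2 * b\<close> at 0, so it can be nonnegative for all \<open>t\<close> only if
      \<open>b = 0\<close>. The added 1 in the denominator of \<open>t\<close> covers
      \<open>x = 0\<close>.\<close>
    have "b = 0"
    proof (rule ccontr)
      assume "b \<noteq> 0"
      define t where "t = - b / ((hnorm H x)\<^sup>2 + 1)"
      have p: "(hnorm H x)\<^sup>2 + 1 > 0" by (simp add: add_nonneg_pos)
      have "t * ((hnorm H x)\<^sup>2 + 1) = - b"
        using p by (simp add: t_def)
      hence "t * (t * ((hnorm H x)\<^sup>2 + 1)) = t * - b"
        by simp
      hence "t\<^sup>2 * (hnorm H x)\<^sup>2 + 2 * t * b = t * b - t\<^sup>2"
        unfolding power2_eq_square by (simp only: distrib_left mult.assoc mult_1_right)
      moreover have "0 < b * b / ((hnorm H x)\<^sup>2 + 1)"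
        using \<open>b \<noteq> 0\<close> p by (intro divide_pos_pos) (auto simp: zero_less_mult_iff)
      hence "t * b < 0"
        by (simp add: t_def)
      ultimately show False using ineq[of t] by (smt (verit) zero_le_power2)
    qed
    thus ?thesis by (simp add: b_def)
  qed
  \<comment> \<open>The imaginary part at \<open>x\<close> is minus the real part at
    \<open>\<i> *\<^sub>C x\<close>.\<close>
  have "\<phi> x = ip H x y" if x: "x \<in> carr H" for x
    using Re_eq[OF x] Re_eq[of "\<i> *\<^sub>C x"] x y by (simp add: complex_eq_iff scale ip_scaleC_left)
  thus ?thesis using y by blast
qed

end

section \<open>Bounded operators, closed spans and adjoints\<close>

lemma bounded_operatorD:
  assumes "bounded_operator H T"
  shows bounded_operator_mem: "x \<in> carr H \<Longrightarrow> T x \<in> carr H"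
    and bounded_operator_add: "x \<in> carr H \<Longrightarrow> y \<in> carr H \<Longrightarrow> T (x + y) = T x + T y"
    and bounded_operator_scale: "x \<in> carr H \<Longrightarrow> T (c *\<^sub>C x) = c *\<^sub>C T x"
  using assms by (auto simp: bounded_operator_def)

lemma closed_spanE:
  assumes "x \<in> closed_span H S" "\<epsilon> > 0"
  obtains y where "y \<in> complex_vector.span S" "hnorm H (x - y) < \<epsilon>"
  using assms by (auto simp: closed_span_def)

context complex_hilbert_space
begin

lemma bounded_operator_bound:
  assumes "bounded_operator H T"
  obtains C where "C \<ge> 0" "\<And>x. x \<in> carr H \<Longrightarrow> hnorm H (T x) \<le> C * hnorm H x"
proof -
  obtain C where C: "\<forall>x\<in>carr H. hnorm H (T x) \<le> C * hnorm H x"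
    using assms by (auto simp: bounded_operator_def)
  have "hnorm H (T x) \<le> max C 0 * hnorm H x" if "x \<in> carr H" for x
    using C that mult_right_mono[of C "max C 0" "hnorm H x"] by fastforce
  thus ?thesis using that[of "max C 0"] by simp
qed

lemma bounded_operator_diff:
  assumes S: "bounded_operator H S" and T: "bounded_operator H T"
  shows "bounded_operator H (\<lambda>x. S x - T x)"
proof -
  obtain C where C: "\<And>x. x \<in> carr H \<Longrightarrow> hnorm H (S x) \<le> C * hnorm H x"
    using bounded_operator_bound[OF S] by metis
  obtain D where D: "\<And>x. x \<in> carr H \<Longrightarrow> hnorm H (T x) \<le> D * hnorm H x"
    using bounded_operator_bound[OF T] by metis
  have "hnorm H (S x - T x) \<le> (C + D) * hnorm H x" if "x \<in> carr H" for x
    using C[OF that] D[OF that] hnorm_diff_le[of "S x" "T x"] that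
    by (simp add: bounded_operator_mem[OF S] bounded_operator_mem[OF T] distrib_right)
  thus ?thesis
    using bounded_operatorD[OF S] bounded_operatorD[OF T]
    by (auto simp: bounded_operator_def complex_vector.scale_right_diff_distrib)
qed

lemma closed_span_subset: "closed_span H S \<subseteq> carr H"
  by (auto simp: closed_span_def)

lemma span_subset_closed_span:
  assumes "S \<subseteq> carr H"
  shows "complex_vector.span S \<subseteq> closed_span H S"
  using span_mem[OF assms] by (force simp: closed_span_def)

lemma closed_span_sequence:
  assumes "x \<in> closed_span H S" and S: "S \<subseteq> carr H"
  obtains X where "\<And>n. X n \<in> complex_vector.span S" "(\<lambda>n. hnorm H (X n - x)) \<longlonglongrightarrow> 0"
proof -
  have "\<exists>y\<in>complex_vector.span S. hnorm H (x - y) < 1 / real (Suc n)" for n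
    using assms by (auto simp: closed_span_def)
  then obtain X where X: "\<And>n. X n \<in> complex_vector.span S" "\<And>n. hnorm H (x - X n) < 1 / real (Suc n)"
    by metis
  have "(\<lambda>n. hnorm H (X n - x)) \<longlonglongrightarrow> 0"
  proof (rule tendsto_sandwich)
    have mem: "X n \<in> carr H" "x \<in> carr H" for n
      using X(1) span_mem[OF S] assms closed_span_subset by blast+
    show "\<forall>\<^sub>F n in sequentially. 0 \<le> hnorm H (X n - x)"
      using mem by simp
    show "\<forall>\<^sub>F n in sequentially. hnorm H (X n - x) \<le> 1 / real (Suc n)"
      using X(2) mem by (simp add: hnorm_diff_commute[of "X _" x] less_imp_le)
    show "(\<lambda>n. 1 / real (Suc n)) \<longlonglongrightarrow> 0"
      using LIMSEQ_Suc[OF lim_1_over_n] by simp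
  qed simp
  with X(1) show ?thesis using that by blast
qed

lemma subspace_closed_span:
  assumes S: "S \<subseteq> carr H"
  shows "complex_vector.subspace (closed_span H S)"
proof (rule complex_vector.subspaceI)
  show "0 \<in> closed_span H S"
    using span_subset_closed_span[OF S] complex_vector.span_zero by blast
  show "x + y \<in> closed_span H S" if x: "x \<in> closed_span H S" and y: "y \<in> closed_span H S" for x y
    unfolding closed_span_def
  proof (intro CollectI conjI allI impI)
    show "x + y \<in> carr H"
      using x y closed_span_subset[THEN subsetD] by simp
    fix \<epsilon> :: real assume "\<epsilon> > 0"
    then obtain a b where ab: "a \<in> complex_vector.span S" "hnorm H (x - a) < \<epsilon> / 2"
      "b \<in> complex_vector.span S" "hnorm H (y - b) < \<epsilon> / 2"
      using x y by (metis closed_spanE half_gt_zero)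
    have "hnorm H (x + y - (a + b)) \<le> hnorm H (x - a) + hnorm H (y - b)"
      using hnorm_triangle[of "x - a" "y - b"] x y ab span_mem[OF S] closed_span_subset
      by (auto simp: algebra_simps subset_iff)
    thus "\<exists>z\<in>complex_vector.span S. hnorm H (x + y - z) < \<epsilon>"
      using ab complex_vector.span_add[of a S b] by force
  qed
  show "c *\<^sub>C x \<in> closed_span H S" if x: "x \<in> closed_span H S" for c x
    unfolding closed_span_def
  proof (intro CollectI conjI allI impI)
    show "c *\<^sub>C x \<in> carr H"
      using x closed_span_subset[THEN subsetD] by simp
    fix \<epsilon> :: real assume "\<epsilon> > 0"
    hence "\<epsilon> / (cmod c + 1) > 0"
      by (simp add: add_nonneg_pos)
    then obtain a where a: "a \<in> complex_vector.span S" "hnorm H (x - a) < \<epsilon> / (cmod c + 1)"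
      using x unfolding closed_span_def by blast
    have mem: "x \<in> carr H" "a \<in> carr H"
      using x a span_mem[OF S] closed_span_subset by auto
    have "hnorm H (c *\<^sub>C x - c *\<^sub>C a) = cmod c * hnorm H (x - a)"
      using mem by (simp add: hnorm_scaleC flip: complex_vector.scale_right_diff_distrib)
    also have "\<dots> \<le> (cmod c + 1) * hnorm H (x - a)"
      using mem by (intro mult_right_mono) auto
    also have "\<dots> < \<epsilon>"
      using a(2) by (simp add: pos_less_divide_eq add_nonneg_pos mult.commute)
    finally show "\<exists>z\<in>complex_vector.span S. hnorm H (c *\<^sub>C x - z) < \<epsilon>"
      using a complex_vector.span_scale by blast
  qed
qed

text \<open>A closed subspace of a complete space is complete. Making it a Hilbert space of its own
  lets the Riesz theorem be applied inside it, which yields orthogonal projections.\<close>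

lemma hilbert_space_closed_span:
  assumes S: "S \<subseteq> carr H"
  shows "complex_hilbert_space \<lparr>carr = closed_span H S, ip = ip H\<rparr>"
proof -
  let ?K = "\<lparr>carr = closed_span H S, ip = ip H\<rparr>"
  have sub: "x \<in> carr H" if "x \<in> closed_span H S" for x
    using that closed_span_subset by blast
  have norm: "hnorm ?K = hnorm H"
    by (simp add: hnorm_def fun_eq_iff)
  show ?thesis
  proof
    fix X :: "nat \<Rightarrow> 'a"
    assume X: "\<And>n. X n \<in> carr ?K"
      and "\<And>\<epsilon>. \<epsilon> > 0 \<Longrightarrow> \<exists>N. \<forall>p\<ge>N. \<forall>q\<ge>N. hnorm ?K (X p - X q) < \<epsilon>"
    then obtain x where x: "x \<in> carr H" and lim: "(\<lambda>n. hnorm H (X n - x)) \<longlonglongrightarrow> 0"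
      using complete[of X] sub unfolding norm by fastforce
    have "\<exists>y\<in>complex_vector.span S. hnorm H (x - y) < \<epsilon>" if "\<epsilon> > 0" for \<epsilon>
    proof -
      have "0 < \<epsilon> / 2" using that by simp
      obtain n where n: "hnorm H (X n - x) < \<epsilon> / 2"
        using \<open>0 < \<epsilon> / 2\<close> order_tendstoD(2)[OF lim] unfolding eventually_sequentially by blast
      obtain y where y: "y \<in> complex_vector.span S" "hnorm H (X n - y) < \<epsilon> / 2"
        using X[of n] \<open>0 < \<epsilon> / 2\<close> by (metis closed_spanE hilb.simps(1))
      have "hnorm H (x - y) < \<epsilon>"
        using hnorm_triangle_diff[of x "X n" y] x n y hnorm_diff_commute[of x "X n"]
          sub X[of n] span_mem[OF S] by fastforce
      with y show ?thesis by blast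
    qed
    thus "\<exists>x\<in>carr ?K. (\<lambda>n. hnorm ?K (X n - x)) \<longlonglongrightarrow> 0"
      using x lim norm by (auto simp: closed_span_def)
  qed (use S in \<open>simp_all add: subspace_closed_span sub ip_simps ip_pos\<close>,
      use sub ip_commute in blast)
qed

text \<open>The functional sending \<open>z\<close> to \<open>ip H z x\<close> on the closed span is
  represented by some \<open>y\<close> in it, the projection of \<open>x\<close>; then
  \<open>x - y\<close> is orthogonal to \<open>S\<close>, hence zero.\<close>

theorem closed_span_eqI:
  assumes S: "S \<subseteq> carr H"
    and orth: "\<And>x. x \<in> carr H \<Longrightarrow> (\<And>s. s \<in> S \<Longrightarrow> ip H s x = 0) \<Longrightarrow> x = 0"
  shows "closed_span H S = carr H"
proof
  let ?K = "\<lparr>carr = closed_span H S, ip = ip H\<rparr>"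
  interpret K: complex_hilbert_space ?K
    by (rule hilbert_space_closed_span[OF S])
  have sub: "x \<in> carr H" if "x \<in> closed_span H S" for x
    using that closed_span_subset by blast
  show "carr H \<subseteq> closed_span H S"
  proof
    fix x assume x: "x \<in> carr H"
    have "\<exists>y\<in>carr ?K. \<forall>z\<in>carr ?K. ip H z x = ip ?K z y"
    proof (rule K.Riesz_representation)
      show "cmod (ip H z x) \<le> hnorm H x * hnorm ?K z" if "z \<in> carr ?K" for z
        using Cauchy_Schwarz[of z x] that x sub by (simp add: hnorm_def mult.commute)
    qed (use x sub in \<open>simp_all add: ip_simps\<close>)
    then obtain y where y: "y \<in> closed_span H S" "\<And>z. z \<in> closed_span H S \<Longrightarrow> ip H z x = ip H z y"
      by auto
    have "ip H s (x - y) = 0" if "s \<in> S" for s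
      using that y x S sub span_subset_closed_span[OF S] complex_vector.span_base[OF that]
      by (auto simp: ip_diff_right subset_iff)
    hence "x - y = 0"
      using x y sub by (intro orth) auto
    with y show "x \<in> closed_span H S" by simp
  qed
qed (rule closed_span_subset)

text \<open>The Riesz theorem represents the functional sending \<open>x\<close> to
  \<open>ip H (T x) y\<close>; the bound for \<open>T'\<close> comes from testing the adjoint
  identity at \<open>x = T' y\<close>.\<close>

theorem adjoint_exists:
  assumes T: "bounded_operator H T"
  obtains T' where "is_adjoint H T T'" "bounded_operator H T'"
proof -
  obtain C where C: "C \<ge> 0" "\<And>x. x \<in> carr H \<Longrightarrow> hnorm H (T x) \<le> C * hnorm H x"
    using bounded_operator_bound[OF T] by metis
  note [simp] = bounded_operatorD[OF T]
  have "\<exists>z\<in>carr H. \<forall>x\<in>carr H. ip H (T x) y = ip H x z" if y: "y \<in> carr H" for y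
  proof (rule Riesz_representation)
    show "cmod (ip H (T x) y) \<le> (C * hnorm H y) * hnorm H x" if x: "x \<in> carr H" for x
    proof -
      have "cmod (ip H (T x) y) \<le> hnorm H (T x) * hnorm H y"
        using x y by (intro Cauchy_Schwarz) simp_all
      also have "\<dots> \<le> (C * hnorm H x) * hnorm H y"
        using C x y by (intro mult_right_mono) auto
      finally show ?thesis by (simp add: mult_ac)
    qed
  qed (use y in \<open>simp_all add: ip_simps\<close>)
  then obtain T' where T': "\<And>y. y \<in> carr H \<Longrightarrow> T' y \<in> carr H"
    "\<And>x y. x \<in> carr H \<Longrightarrow> y \<in> carr H \<Longrightarrow> ip H (T x) y = ip H x (T' y)"
    by metis
  have "bounded_operator H T'"
    unfolding bounded_operator_def
  proof (intro conjI ballI allI exI[of _ C])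
    fix y assume y: "y \<in> carr H"
    have "(hnorm H (T' y))\<^sup>2 = cmod (ip H (T (T' y)) y)"
      using y T' by (simp add: ip_self norm_power)
    also have "\<dots> \<le> hnorm H (T (T' y)) * hnorm H y"
      using y T' by (intro Cauchy_Schwarz) simp_all
    also have "\<dots> \<le> (C * hnorm H (T' y)) * hnorm H y"
      using y T' C by (intro mult_right_mono) auto
    finally have "hnorm H (T' y) * hnorm H (T' y) \<le> hnorm H (T' y) * (C * hnorm H y)"
      by (simp add: power2_eq_square mult_ac)
    thus "hnorm H (T' y) \<le> C * hnorm H y"
      using T'(1)[OF y] C(1) y by (cases "hnorm H (T' y) = 0") (simp_all add: order.strict_iff_order)
  next
    fix x y assume "x \<in> carr H" "y \<in> carr H"
    thus "T' (x + y) = T' x + T' y"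
      by (intro ip_ext) (simp_all add: T' ip_simps flip: T'(2))
  next
    fix c x assume "x \<in> carr H"
    thus "T' (c *\<^sub>C x) = c *\<^sub>C T' x"
      by (intro ip_ext) (simp_all add: T' ip_simps flip: T'(2))
  qed (use T' in auto)
  moreover have "is_adjoint H T T'"
    using T' by (simp add: is_adjoint_def)
  ultimately show ?thesis
    using that by blast
qed

end

subsection \<open>A criterion for membership in the Cowen--Douglas class\<close>

context complex_hilbert_space
begin

lemma subspace_eigenspace:
  assumes "bounded_operator H T"
  shows "complex_vector.subspace (eigenspace H T w)"
proof (rule complex_vector.subspaceI)
  have "T 0 = 0"
    using bounded_operator_scale[OF assms, of 0 0] by simp
  thus "0 \<in> eigenspace H T w"
    by (simp add: eigenspace_def)
qed (use bounded_operatorD[OF assms] in \<open>auto simp: eigenspace_def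
    complex_vector.scale_right_distrib complex_vector.scale_left_commute\<close>)

text \<open>The adjoint of \<open>M - w\<close> is \<open>T - cnj w\<close>, which is why the
  eigenvalues of \<open>T\<close> appear as \<open>cnj w\<close> below.\<close>

lemma adjoint_shift:
  assumes "bounded_operator H M" "is_adjoint H M T" "x \<in> carr H" "y \<in> carr H"
  shows "ip H (M x - w *\<^sub>C x) y = ip H x (T y - cnj w *\<^sub>C y)"
  using assms bounded_operator_mem[OF assms(1)] by (auto simp: is_adjoint_def ip_simps)

text \<open>The \<open>v l\<close> are dual to the vectors \<open>u w l\<close> representing the
  evaluations at \<open>w\<close>. Duality makes the \<open>u w l\<close> independent. By the second
  identity for \<open>D\<close>, the range of \<open>M - w\<close> and the \<open>v l\<close>
  together fill the space, so the kernel of \<open>T - cnj w\<close> contains nothing beyond the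
  span of the \<open>u w l\<close>. The first identity for \<open>D\<close> gives surjectivity, and
  \<open>sep\<close> the density of the eigenvectors.\<close>

theorem cowen_douglas_adjointI:
  fixes ev :: "complex \<Rightarrow> nat \<Rightarrow> 'a \<Rightarrow> complex" and v :: "nat \<Rightarrow> 'a"
  assumes M: "bounded_operator H M" and adj: "is_adjoint H M T" and T: "bounded_operator H T"
    and v: "\<And>l. l < k \<Longrightarrow> v l \<in> carr H"
    and ev_add: "\<And>w l x y. w \<in> unit_disc \<Longrightarrow> l < k \<Longrightarrow> x \<in> carr H \<Longrightarrow> y \<in> carr H \<Longrightarrow>
      ev w l (x + y) = ev w l x + ev w l y"
    and ev_scale: "\<And>w l c x. w \<in> unit_disc \<Longrightarrow> l < k \<Longrightarrow> x \<in> carr H \<Longrightarrow>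
      ev w l (c *\<^sub>C x) = c * ev w l x"
    and ev_bdd: "\<And>w l. w \<in> unit_disc \<Longrightarrow> l < k \<Longrightarrow>
      \<exists>C. \<forall>x\<in>carr H. cmod (ev w l x) \<le> C * hnorm H x"
    and ev_M: "\<And>w l x. w \<in> unit_disc \<Longrightarrow> l < k \<Longrightarrow> x \<in> carr H \<Longrightarrow> ev w l (M x) = w * ev w l x"
    and ev_v: "\<And>w l i. w \<in> unit_disc \<Longrightarrow> l < k \<Longrightarrow> i < k \<Longrightarrow> ev w l (v i) = (if i = l then 1 else 0)"
    and sep: "\<And>x. x \<in> carr H \<Longrightarrow> (\<And>w l. w \<in> unit_disc \<Longrightarrow> l < k \<Longrightarrow> ev w l x = 0) \<Longrightarrow> x = 0"
    and D: "\<And>w. w \<in> unit_disc \<Longrightarrow> \<exists>D. bounded_operator H D \<and>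
      (\<forall>x\<in>carr H. D (M x - w *\<^sub>C x) = x \<and>
        M (D x) - w *\<^sub>C D x = x - (\<Sum>l<k. ev w l x *\<^sub>C v l))"
  shows "cowen_douglas_B k H T"
proof -
  have "\<exists>u\<in>carr H. \<forall>x\<in>carr H. ev w l x = ip H x u" if "w \<in> unit_disc" "l < k" for w l
    using ev_bdd[OF that] ev_add ev_scale that by (auto intro!: Riesz_representation)
  then obtain u where u: "\<And>w l. w \<in> unit_disc \<Longrightarrow> l < k \<Longrightarrow> u w l \<in> carr H"
    "\<And>w l x. w \<in> unit_disc \<Longrightarrow> l < k \<Longrightarrow> x \<in> carr H \<Longrightarrow> ev w l x = ip H x (u w l)"
    by metis
  note [simp] = bounded_operator_mem[OF M] bounded_operator_mem[OF T] v
  have u_mem [simp]: "u w l \<in> carr H" if "cmod w < 1" "l < k" for w l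
    using u(1)[of w l] that by simp
  have vu: "ip H (v i) (u w l) = (if i = l then 1 else 0)" if "cmod w < 1" "i < k" "l < k" for w i l
    using that ev_v[of w l i] u(2)[of w l "v i"] by simp
  have T_ip: "ip H x (T y) = ip H (M x) y" if "x \<in> carr H" "y \<in> carr H" for x y
    using adj that by (simp add: is_adjoint_def)
  have u_eig: "u w l \<in> eigenspace H T (cnj w)" if w: "w \<in> unit_disc" "l < k" for w l
  proof -
    have "T (u w l) = cnj w *\<^sub>C u w l"
      by (rule ip_ext) (use w in \<open>simp_all add: T_ip ip_scaleC_right ev_M flip: u(2)\<close>)
    thus ?thesis using u w by (simp add: eigenspace_def)
  qed
  have eig: "eigenspace H T (cnj w) = complex_vector.span (u w ` {..<k})" if w: "w \<in> unit_disc" for w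
  proof
    show "complex_vector.span (u w ` {..<k}) \<subseteq> eigenspace H T (cnj w)"
      using u_eig w by (intro complex_vector.span_minimal subspace_eigenspace T) auto
    show "eigenspace H T (cnj w) \<subseteq> complex_vector.span (u w ` {..<k})"
    proof
      fix x assume x: "x \<in> eigenspace H T (cnj w)"
      \<comment> \<open>Pairing \<open>x\<close> with the dual vectors \<open>v i\<close> reads off
        the only possible coefficients.\<close>
      define s where "s = (\<Sum>i<k. ip H x (v i) *\<^sub>C u w i)"
      have xm: "x \<in> carr H" using x by (simp add: eigenspace_def)
      have sm: "s \<in> carr H" unfolding s_def using w u by (intro sum_mem) auto
      obtain D where D: "bounded_operator H D" "\<And>x. x \<in> carr H \<Longrightarrow>
          M (D x) - w *\<^sub>C D x = x - (\<Sum>l<k. ev w l x *\<^sub>C v l)"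
        using D[OF w] by blast
      have "s \<in> eigenspace H T (cnj w)"
        unfolding s_def using w u_eig
        by (intro complex_vector.subspace_sum subspace_eigenspace T complex_vector.subspace_scale) auto
      hence eig_y: "T (x - s) - cnj w *\<^sub>C (x - s) = 0"
        using x complex_vector.subspace_diff[OF subspace_eigenspace[OF T]]
        by (simp add: eigenspace_def)
      have v_y: "ip H (v l) (x - s) = 0" if l: "l < k" for l
      proof -
        have "ip H (v l) s = (\<Sum>i<k. ip H (v l) (ip H x (v i) *\<^sub>C u w i))"
          unfolding s_def by (rule ip_sum_right) (use w l in auto)
        also have "\<dots> = (\<Sum>i<k. cnj (ip H x (v i)) * (if l = i then 1 else 0))"
          by (intro sum.cong refl) (use w l in \<open>simp add: ip_scaleC_right vu\<close>)
        also have "\<dots> = (\<Sum>i<k. if i = l then cnj (ip H x (v i)) else 0)"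
          by (intro sum.cong) auto
        also have "\<dots> = ip H (v l) x"
          using l xm ip_commute[of x "v l"] by simp
        finally show ?thesis using l xm sm by (simp add: ip_simps)
      qed
      have "x - s = 0"
      proof (rule ip_ext)
        fix z assume z: "z \<in> carr H"
        have Dz: "D z \<in> carr H" using D(1) z by (rule bounded_operator_mem)
        have sum_mem': "(\<Sum>l<k. ev w l z *\<^sub>C v l) \<in> carr H"
          by (intro sum_mem) simp
        \<comment> \<open>The splitting of \<open>z\<close> provided by \<open>D\<close>: the first
          part is orthogonal to \<open>x - s\<close> because \<open>x - s\<close> lies in the kernel
          of \<open>T - cnj w\<close>, the second because \<open>x - s\<close> is orthogonal to all
          \<open>v l\<close>.\<close>
        have "z = (M (D z) - w *\<^sub>C D z) + (\<Sum>l<k. ev w l z *\<^sub>C v l)"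
          using D(2)[OF z] by simp
        also have "ip H \<dots> (x - s) = ip H (M (D z) - w *\<^sub>C D z) (x - s) + ip H (\<Sum>l<k. ev w l z *\<^sub>C v l) (x - s)"
          using z Dz xm sm sum_mem' by (intro ip_add_left) simp_all
        also have "ip H (M (D z) - w *\<^sub>C D z) (x - s) = 0"
          using Dz xm sm eig_y by (simp only: adjoint_shift[OF M adj] diff_mem ip_zero_right)
        also have "ip H (\<Sum>l<k. ev w l z *\<^sub>C v l) (x - s) = 0"
          using xm sm v_y by (subst ip_sum_left) (simp_all add: ip_scaleC_left)
        finally show "ip H z (x - s) = ip H z 0"
          using z by simp
      qed (use xm sm in simp_all)
      moreover have "s \<in> complex_vector.span (u w ` {..<k})"
        unfolding s_def
        by (intro complex_vector.span_sum complex_vector.span_scale complex_vector.span_base) auto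
      ultimately show "x \<in> complex_vector.span (u w ` {..<k})" by simp
    qed
  qed
  have dim: "complex_vector.dim (eigenspace H T (cnj w)) = k" if w: "w \<in> unit_disc" for w
  proof -
    have w': "cmod w < 1" using w by simp
    \<comment> \<open>Independence concerns the set of representing vectors; injectivity makes its
      cardinality \<open>k\<close>.\<close>
    have inj: "inj_on (u w) {..<k}"
      by (rule inj_onI) (metis vu[OF w'] lessThan_iff zero_neq_one)
    have "\<not> complex_vector.dependent (u w ` {..<k})"
    proof (rule complex_vector.independent_if_scalars_zero)
      fix f x assume sum0: "(\<Sum>x\<in>u w ` {..<k}. f x *\<^sub>C x) = 0" and "x \<in> u w ` {..<k}"
      then obtain l where l: "l < k" "x = u w l" by auto
      have "0 = ip H (v l) (\<Sum>i<k. f (u w i) *\<^sub>C u w i)"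
        using sum0 l by (simp add: sum.reindex[OF inj])
      also have "\<dots> = (\<Sum>i<k. ip H (v l) (f (u w i) *\<^sub>C u w i))"
        by (rule ip_sum_right) (use w l in auto)
      also have "\<dots> = (\<Sum>i<k. cnj (f (u w i)) * (if l = i then 1 else 0))"
        by (intro sum.cong refl) (use w l in \<open>simp add: ip_scaleC_right vu\<close>)
      also have "\<dots> = (\<Sum>i<k. if i = l then cnj (f (u w i)) else 0)"
        by (intro sum.cong) auto
      also have "\<dots> = cnj (f x)" using l by simp
      finally show "f x = 0" by simp
    qed simp
    thus ?thesis
      by (simp add: eig[OF w] complex_vector.dim_eq_card_independent card_image[OF inj])
  qed
  have surj: "(\<lambda>x. T x - cnj w *\<^sub>C x) ` carr H = carr H" if w: "w \<in> unit_disc" for w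
  proof
    show "carr H \<subseteq> (\<lambda>x. T x - cnj w *\<^sub>C x) ` carr H"
    proof
      fix y assume y: "y \<in> carr H"
      obtain D where D: "bounded_operator H D" "\<And>x. x \<in> carr H \<Longrightarrow> D (M x - w *\<^sub>C x) = x"
        using D[OF w] by blast
      \<comment> \<open>Taking adjoints in \<open>D (M - w) = 1\<close> exhibits \<open>D' y\<close>
        as a preimage of \<open>y\<close>.\<close>
      obtain D' where D': "is_adjoint H D D'"
        using adjoint_exists[OF D(1)] by blast
      have D'y: "D' y \<in> carr H" using D' y by (simp add: is_adjoint_def)
      have "T (D' y) - cnj w *\<^sub>C D' y = y"
      proof (rule ip_ext)
        fix z assume z: "z \<in> carr H"
        have "ip H z (T (D' y) - cnj w *\<^sub>C D' y) = ip H (M z - w *\<^sub>C z) (D' y)"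
          using z D'y by (simp only: adjoint_shift[OF M adj])
        also have "\<dots> = ip H (D (M z - w *\<^sub>C z)) y"
          using D' z y by (simp add: is_adjoint_def)
        finally show "ip H z (T (D' y) - cnj w *\<^sub>C D' y) = ip H z y"
          using D(2)[OF z] by simp
      qed (use D'y y in simp_all)
      with D'y show "y \<in> (\<lambda>x. T x - cnj w *\<^sub>C x) ` carr H" by force
    qed
  qed auto
  have "closed_span H (\<Union>w\<in>unit_disc. eigenspace H T w) = carr H"
  proof (rule closed_span_eqI)
    fix x assume x: "x \<in> carr H"
      and orth: "\<And>s. s \<in> (\<Union>w\<in>unit_disc. eigenspace H T w) \<Longrightarrow> ip H s x = 0"
    show "x = 0"
    proof (rule sep[OF x])
      fix w l assume w: "w \<in> unit_disc" "l < k"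
      have "u w l \<in> (\<Union>w\<in>unit_disc. eigenspace H T w)"
        using u_eig[OF w] w(1) by (intro UN_I[of "cnj w"]) auto
      hence "ip H (u w l) x = 0" by (rule orth)
      thus "ev w l x = 0"
        using u w x ip_commute[of "u w l" x] by simp
    qed
  qed (auto simp: eigenspace_def)
  moreover have "(\<lambda>x. T x - w *\<^sub>C x) ` carr H = carr H" "complex_vector.dim (eigenspace H T w) = k"
    if "w \<in> unit_disc" for w
    \<comment> \<open>Both facts were shown with eigenvalue \<open>cnj w\<close>; conjugation maps
      the disc onto itself.\<close>
    using surj[of "cnj w"] dim[of "cnj w"] that by simp_all
  ultimately show ?thesis
    using T complex_hilbert_space_axioms by (simp add: cowen_douglas_B_def)
qed

end

subsection \<open>Square summable families and unitary maps\<close>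

text \<open>Families live on the whole index type and vanish off \<open>I\<close>, so that all sums
  can run over \<open>UNIV\<close> and the carrier is a subspace of a function type.\<close>

definition ell2 :: "'i set \<Rightarrow> ('i \<Rightarrow> complex) hilb" where
  "ell2 I = \<lparr>carr = {a. (\<forall>i. i \<notin> I \<longrightarrow> a i = 0) \<and> (\<lambda>i. (cmod (a i))\<^sup>2) summable_on UNIV},
    ip = (\<lambda>a b. \<Sum>\<^sub>\<infinity>i. a i * cnj (b i))\<rparr>"

lemma ell2_mem_iff:
  "a \<in> carr (ell2 I) \<longleftrightarrow> (\<forall>i. i \<notin> I \<longrightarrow> a i = 0) \<and> (\<lambda>i. (cmod (a i))\<^sup>2) summable_on UNIV"
  by (simp add: ell2_def)

lemma ell2_ip: "ip (ell2 I) a b = (\<Sum>\<^sub>\<infinity>i. a i * cnj (b i))"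
  by (simp add: ell2_def)

lemma ell2_summable:
  "a \<in> carr (ell2 I) \<Longrightarrow> (\<lambda>i. (cmod (a i))\<^sup>2) summable_on UNIV"
  by (simp add: ell2_mem_iff)

lemma ell2_abs_summable:
  assumes a: "a \<in> carr (ell2 I)" and b: "b \<in> carr (ell2 J)"
  shows "(\<lambda>i. norm (a i * cnj (b i))) summable_on UNIV"
proof (rule summable_on_comparison_test)
  show "(\<lambda>i. (cmod (a i))\<^sup>2 + (cmod (b i))\<^sup>2) summable_on UNIV"
    using a b by (intro summable_on_add ell2_summable)
  show "norm (a i * cnj (b i)) \<le> (cmod (a i))\<^sup>2 + (cmod (b i))\<^sup>2" for i
  proof -
    have "2 * (cmod (a i) * cmod (b i)) \<le> (cmod (a i))\<^sup>2 + (cmod (b i))\<^sup>2"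
      using sum_squares_bound[of "cmod (a i)" "cmod (b i)"] by (simp add: mult_ac)
    moreover have "0 \<le> cmod (a i) * cmod (b i)" by simp
    ultimately show ?thesis unfolding norm_mult complex_mod_cnj by linarith
  qed
qed simp

lemma ell2_summable_prod:
  "a \<in> carr (ell2 I) \<Longrightarrow> b \<in> carr (ell2 J) \<Longrightarrow> (\<lambda>i. a i * cnj (b i)) summable_on UNIV"
  by (rule abs_summable_summable[OF ell2_abs_summable])

lemma ell2_ip_self:
  "a \<in> carr (ell2 I) \<Longrightarrow> ip (ell2 I) a a = complex_of_real (\<Sum>\<^sub>\<infinity>i. (cmod (a i))\<^sup>2)"
  unfolding ell2_ip complex_norm_square[symmetric]
  by (rule infsumI[OF has_sum_of_real[OF has_sum_infsum]]) (rule ell2_summable)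

lemma ell2_hnorm_sq:
  assumes "a \<in> carr (ell2 I)"
  shows "(hnorm (ell2 I) a)\<^sup>2 = (\<Sum>\<^sub>\<infinity>i. (cmod (a i))\<^sup>2)"
  using assms by (simp add: hnorm_def ell2_ip_self infsum_nonneg)

lemma ell2_memI:
  assumes "\<And>i. i \<notin> I \<Longrightarrow> a i = 0" and "\<And>F. finite F \<Longrightarrow> (\<Sum>i\<in>F. (cmod (a i))\<^sup>2) \<le> C"
  shows "a \<in> carr (ell2 I)" "(\<Sum>\<^sub>\<infinity>i. (cmod (a i))\<^sup>2) \<le> C"
proof -
  have s: "(\<lambda>i. (cmod (a i))\<^sup>2) summable_on UNIV"
    using assms(2) by (intro nonneg_bdd_above_summable_on bdd_aboveI2) auto
  thus "a \<in> carr (ell2 I)"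
    using assms(1) by (simp add: ell2_mem_iff)
  show "(\<Sum>\<^sub>\<infinity>i. (cmod (a i))\<^sup>2) \<le> C"
    using s assms(2) by (intro infsum_le_finite_sums) auto
qed

lemma ell2_sum_le:
  assumes "a \<in> carr (ell2 I)" "finite F"
  shows "(\<Sum>i\<in>F. (cmod (a i))\<^sup>2) \<le> (hnorm (ell2 I) a)\<^sup>2"
  unfolding ell2_hnorm_sq[OF assms(1)]
  using assms by (intro finite_sum_le_infsum ell2_summable) auto

lemma ell2_subspace: "complex_vector.subspace (carr (ell2 I))"
proof (rule complex_vector.subspaceI)
  show "x + y \<in> carr (ell2 I)" if x: "x \<in> carr (ell2 I)" and y: "y \<in> carr (ell2 I)" for x y
  proof -
    have "(\<lambda>i. (cmod ((x + y) i))\<^sup>2) summable_on UNIV"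
    proof (rule summable_on_comparison_test)
      show "(\<lambda>i. 2 * (cmod (x i))\<^sup>2 + 2 * (cmod (y i))\<^sup>2) summable_on UNIV"
        using x y by (intro summable_on_add summable_on_cmult_right ell2_summable)
      show "(cmod ((x + y) i))\<^sup>2 \<le> 2 * (cmod (x i))\<^sup>2 + 2 * (cmod (y i))\<^sup>2" for i
      proof -
        have "(cmod (x i + y i))\<^sup>2 \<le> (cmod (x i) + cmod (y i))\<^sup>2"
          by (intro power_mono norm_triangle_ineq) simp
        also have "\<dots> \<le> 2 * (cmod (x i))\<^sup>2 + 2 * (cmod (y i))\<^sup>2"
          using sum_squares_bound[of "cmod (x i)" "cmod (y i)"] by (simp add: power2_sum)
        finally show ?thesis by simp
      qed
    qed simp
    thus ?thesis using x y by (simp add: ell2_mem_iff)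
  qed
  show "c *\<^sub>C x \<in> carr (ell2 I)" if "x \<in> carr (ell2 I)" for c x
    using that by (auto simp: ell2_mem_iff scaleC_fun_def scaleC_complex_def norm_mult
        power_mult_distrib intro: summable_on_cmult_right)
qed (simp add: ell2_mem_iff)

text \<open>Coordinatewise limits exist, and the Cauchy bound on each finite set of indices survives
  the passage to the limit, hence bounds the whole sum.\<close>

lemma ell2_complete:
  assumes X: "\<And>n::nat. X n \<in> carr (ell2 I)"
    and Cauchy: "\<And>\<epsilon>::real. \<epsilon> > 0 \<Longrightarrow> \<exists>N. \<forall>p\<ge>N. \<forall>q\<ge>N. hnorm (ell2 I) (X p - X q) < \<epsilon>"
  shows "\<exists>x\<in>carr (ell2 I). (\<lambda>n. hnorm (ell2 I) (X n - x)) \<longlonglongrightarrow> 0"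
proof -
  note diff = complex_vector.subspace_diff[OF ell2_subspace]
  have hnn: "0 \<le> hnorm (ell2 I) x" if "x \<in> carr (ell2 I)" for x :: "'a \<Rightarrow> complex"
    using that by (simp add: hnorm_def ell2_ip_self infsum_nonneg)
  have coord: "cmod (x i) \<le> hnorm (ell2 I) x" if "x \<in> carr (ell2 I)" for x and i :: 'a
    using ell2_sum_le[OF that, of "{i}"] by (simp add: power2_le_imp_le[OF _ hnn[OF that]])
  have "convergent (\<lambda>n. X n i)" for i
  proof (rule Cauchy_convergent, rule CauchyI)
    fix e :: real assume "0 < e"
    then obtain N where N: "\<And>p q. p \<ge> N \<Longrightarrow> q \<ge> N \<Longrightarrow> hnorm (ell2 I) (X p - X q) < e"
      using Cauchy by blast
    show "\<exists>M. \<forall>m\<ge>M. \<forall>n\<ge>M. norm (X m i - X n i) < e"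
    proof (intro exI[of _ N] allI impI)
      fix p q assume "p \<ge> N" "q \<ge> N"
      thus "norm (X p i - X q i) < e"
        using coord[OF diff[OF X[of p] X[of q]], of i] N[of p q] by simp
    qed
  qed
  then obtain x where x: "\<And>i. (\<lambda>n. X n i) \<longlonglongrightarrow> x i"
    unfolding convergent_def by metis
  have close: "\<exists>N. \<forall>n\<ge>N. X n - x \<in> carr (ell2 I) \<and> hnorm (ell2 I) (X n - x) \<le> \<epsilon>"
    if \<epsilon>: "\<epsilon> > 0" for \<epsilon>
  proof -
    obtain N where N: "\<And>p q. p \<ge> N \<Longrightarrow> q \<ge> N \<Longrightarrow> hnorm (ell2 I) (X p - X q) < \<epsilon>"
      using Cauchy[OF \<epsilon>] by blast
    have "X n - x \<in> carr (ell2 I) \<and> hnorm (ell2 I) (X n - x) \<le> \<epsilon>" if n: "n \<ge> N" for n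
    proof -
      have *: "(\<Sum>i\<in>F. (cmod ((X n - x) i))\<^sup>2) \<le> \<epsilon>\<^sup>2" if F: "finite F" for F
      proof (rule LIMSEQ_le_const2)
        show "(\<lambda>q. \<Sum>i\<in>F. (cmod ((X n - X q) i))\<^sup>2) \<longlonglongrightarrow> (\<Sum>i\<in>F. (cmod ((X n - x) i))\<^sup>2)"
          unfolding fun_diff_def by (intro tendsto_intros x)
        show "\<exists>M. \<forall>q\<ge>M. (\<Sum>i\<in>F. (cmod ((X n - X q) i))\<^sup>2) \<le> \<epsilon>\<^sup>2"
        proof (intro exI[of _ N] allI impI)
          fix q assume "q \<ge> N"
          have "(\<Sum>i\<in>F. (cmod ((X n - X q) i))\<^sup>2) \<le> (hnorm (ell2 I) (X n - X q))\<^sup>2"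
            by (intro ell2_sum_le diff X F)
          also have "\<dots> \<le> \<epsilon>\<^sup>2"
            using N[OF n \<open>q \<ge> N\<close>] by (intro power_mono hnn diff X) simp
          finally show "(\<Sum>i\<in>F. (cmod ((X n - X q) i))\<^sup>2) \<le> \<epsilon>\<^sup>2" .
        qed
      qed
      have zero: "(X n - x) i = 0" if "i \<notin> I" for i
      proof -
        have "X q i = 0" for q using X[of q] that by (simp add: ell2_mem_iff)
        thus ?thesis using x[of i] LIMSEQ_unique[OF _ tendsto_const] by fastforce
      qed
      have mem: "X n - x \<in> carr (ell2 I)"
        by (rule ell2_memI(1)[OF zero *])
      have "(hnorm (ell2 I) (X n - x))\<^sup>2 \<le> \<epsilon>\<^sup>2"
        unfolding ell2_hnorm_sq[OF mem] by (rule ell2_memI(2)[OF zero *])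
      with mem show ?thesis
        using \<epsilon> power2_le_imp_le[of "hnorm (ell2 I) (X n - x)" \<epsilon>] by simp
    qed
    thus ?thesis by blast
  qed
  \<comment> \<open>So far only differences \<open>X n - x\<close> are known to be square summable;
    \<open>x\<close> is recovered as \<open>X N - (X N - x)\<close>.\<close>
  obtain N where "X N - x \<in> carr (ell2 I)"
    using close[of 1] by auto
  hence "x \<in> carr (ell2 I)"
    using diff[OF X[of N], of "X N - x"] by simp
  moreover have "(\<lambda>n. hnorm (ell2 I) (X n - x)) \<longlonglongrightarrow> 0"
  proof (rule LIMSEQ_I)
    fix r :: real assume "0 < r"
    then obtain M where M: "\<And>n. n \<ge> M \<Longrightarrow> hnorm (ell2 I) (X n - x) \<le> r / 2"
      using close[of "r / 2"] by auto
    show "\<exists>no. \<forall>n\<ge>no. norm (hnorm (ell2 I) (X n - x) - 0) < r"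
      using M \<open>0 < r\<close> hnn[OF diff[OF X calculation]] by (intro exI[of _ M]) fastforce
  qed
  ultimately show ?thesis by blast
qed

theorem ell2_hilbert_space: "complex_hilbert_space (ell2 I)"
proof
  fix x y z :: "'a \<Rightarrow> complex" and c :: complex
  assume x: "x \<in> carr (ell2 I)"
  {
    assume y: "y \<in> carr (ell2 I)" and z: "z \<in> carr (ell2 I)"
    show "ip (ell2 I) (x + y) z = ip (ell2 I) x z + ip (ell2 I) y z"
      using infsum_add[OF ell2_summable_prod[OF x z] ell2_summable_prod[OF y z]]
      by (simp add: ell2_ip algebra_simps)
  next
    assume y: "y \<in> carr (ell2 I)"
    show "ip (ell2 I) (c *\<^sub>C x) y = c * ip (ell2 I) x y"
      by (simp add: ell2_ip scaleC_fun_def scaleC_complex_def mult.assoc infsum_cmult_right')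
    show "ip (ell2 I) y x = cnj (ip (ell2 I) x y)"
      by (simp add: ell2_ip mult.commute flip: infsum_cnj)
  next
    assume "x \<noteq> 0"
    then obtain i where i: "x i \<noteq> 0" by (auto simp: fun_eq_iff)
    have "0 < (cmod (x i))\<^sup>2" using i by simp
    also have "\<dots> \<le> (hnorm (ell2 I) x)\<^sup>2"
      using ell2_sum_le[OF x, of "{i}"] by simp
    finally show "0 < Re (ip (ell2 I) x x)"
      using x by (simp add: ell2_hnorm_sq ell2_ip_self)
  }
qed (use ell2_subspace ell2_complete in blast)+

definition ell2_unit :: "'i \<Rightarrow> 'i \<Rightarrow> complex" where
  "ell2_unit i = (\<lambda>k. if k = i then 1 else 0)"

lemma ell2_unit_mem [simp]: "i \<in> I \<Longrightarrow> ell2_unit i \<in> carr (ell2 I)"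
proof (rule ell2_memI(1)[where C = 1])
  fix F :: "'a set" assume "finite F"
  have "(\<Sum>k\<in>F. (cmod (ell2_unit i k))\<^sup>2) = (\<Sum>k\<in>F. if k = i then 1 else 0)"
    by (intro sum.cong) (auto simp: ell2_unit_def)
  thus "(\<Sum>k\<in>F. (cmod (ell2_unit i k))\<^sup>2) \<le> 1"
    using \<open>finite F\<close> by simp
qed (auto simp: ell2_unit_def)

lemma ell2_ip_unit: "ip (ell2 I) a (ell2_unit i) = a i"
proof -
  have "(\<Sum>\<^sub>\<infinity>k. a k * cnj (ell2_unit i k)) = (\<Sum>\<^sub>\<infinity>k\<in>{i}. a k * cnj (ell2_unit i k))"
    by (rule infsum_cong_neutral) (auto simp: ell2_unit_def)
  thus ?thesis by (simp add: ell2_ip ell2_unit_def)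
qed

theorem ell2_unit_basis: "orthonormal_basis (ell2 I) (ell2_unit ` I)"
proof -
  interpret complex_hilbert_space "ell2 I" by (rule ell2_hilbert_space)
  have inj: "ell2_unit i = ell2_unit j \<longleftrightarrow> i = j" for i j :: 'a
    by (metis ell2_unit_def zero_neq_one)
  have "closed_span (ell2 I) (ell2_unit ` I) = carr (ell2 I)"
  proof (rule closed_span_eqI)
    fix x assume x: "x \<in> carr (ell2 I)"
      and orth: "\<And>s. s \<in> ell2_unit ` I \<Longrightarrow> ip (ell2 I) s x = 0"
    have "x i = 0" for i
    proof (cases "i \<in> I")
      case True
      hence "ip (ell2 I) x (ell2_unit i) = 0"
        using orth[of "ell2_unit i"] ip_commute[of "ell2_unit i" x] x by simp
      thus ?thesis by (simp add: ell2_ip_unit)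
    qed (use x in \<open>simp add: ell2_mem_iff\<close>)
    thus "x = 0" by auto
  qed auto
  moreover have "ip (ell2 I) (ell2_unit i) (ell2_unit j) = (if ell2_unit i = ell2_unit j then 1 else 0)"
    for i j
    unfolding inj ell2_ip_unit by (simp add: ell2_unit_def)
  moreover have "ell2_unit ` I \<subseteq> carr (ell2 I)"
    by auto
  ultimately show ?thesis
    unfolding orthonormal_basis_def by blast
qed

text \<open>\<open>K\<close> is not presupposed to be a Hilbert space, and its carrier is given as
  an image. A space defined by formulas thus inherits its whole structure from
  \<open>H\<close>.\<close>

definition unitary :: "'a::complex_vector hilb \<Rightarrow> 'b::complex_vector hilb \<Rightarrow> ('a \<Rightarrow> 'b) \<Rightarrow> bool" where
  "unitary H K \<Phi> \<longleftrightarrow>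
    carr K = \<Phi> ` carr H \<and>
    (\<forall>x\<in>carr H. \<forall>y\<in>carr H. \<Phi> (x + y) = \<Phi> x + \<Phi> y) \<and>
    (\<forall>c. \<forall>x\<in>carr H. \<Phi> (c *\<^sub>C x) = c *\<^sub>C \<Phi> x) \<and>
    (\<forall>x\<in>carr H. \<forall>y\<in>carr H. ip K (\<Phi> x) (\<Phi> y) = ip H x y)"

context complex_hilbert_space
begin

context
  fixes K :: "'b::complex_vector hilb" and \<Phi>
  assumes \<Phi>: "unitary H K \<Phi>"
begin

lemma unitary_carr: "carr K = \<Phi> ` carr H"
  and unitary_add: "x \<in> carr H \<Longrightarrow> y \<in> carr H \<Longrightarrow> \<Phi> (x + y) = \<Phi> x + \<Phi> y"
  and unitary_scale: "x \<in> carr H \<Longrightarrow> \<Phi> (c *\<^sub>C x) = c *\<^sub>C \<Phi> x"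
  and unitary_ip: "x \<in> carr H \<Longrightarrow> y \<in> carr H \<Longrightarrow> ip K (\<Phi> x) (\<Phi> y) = ip H x y"
  using \<Phi> by (auto simp: unitary_def)

lemma unitary_zero: "\<Phi> 0 = 0"
  using unitary_scale[of 0 0] by simp

lemma unitary_diff: "x \<in> carr H \<Longrightarrow> y \<in> carr H \<Longrightarrow> \<Phi> (x - y) = \<Phi> x - \<Phi> y"
  using unitary_add[of x "- y"] unitary_scale[of y "- 1"] by simp

lemma unitary_hnorm: "x \<in> carr H \<Longrightarrow> hnorm K (\<Phi> x) = hnorm H x"
  by (simp add: hnorm_def unitary_ip)

theorem unitary_hilbert_space: "complex_hilbert_space K"
proof
  show "complex_vector.subspace (carr K)"
  proof (rule complex_vector.subspaceI)
    show "0 \<in> carr K"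
      using unitary_zero unitary_carr by (metis imageI zero_mem)
    show "x + y \<in> carr K" if "x \<in> carr K" "y \<in> carr K" for x y
      using that unfolding unitary_carr by (auto simp flip: unitary_add)
    show "c *\<^sub>C x \<in> carr K" if "x \<in> carr K" for c x
      using that unfolding unitary_carr by (auto simp flip: unitary_scale)
  qed
  fix X :: "nat \<Rightarrow> 'b"
  assume "\<And>n. X n \<in> carr K"
    and Cauchy: "\<And>\<epsilon>. \<epsilon> > 0 \<Longrightarrow> \<exists>N. \<forall>p\<ge>N. \<forall>q\<ge>N. hnorm K (X p - X q) < \<epsilon>"
  then obtain Y where Y: "\<And>n. Y n \<in> carr H" "\<And>n. X n = \<Phi> (Y n)"
    unfolding unitary_carr image_iff by metis
  have "hnorm K (X p - X q) = hnorm H (Y p - Y q)" for p q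
    by (simp add: Y unitary_hnorm flip: unitary_diff)
  with Cauchy complete[of Y] Y obtain y where
    y: "y \<in> carr H" "(\<lambda>n. hnorm H (Y n - y)) \<longlonglongrightarrow> 0" by auto
  have "hnorm K (X n - \<Phi> y) = hnorm H (Y n - y)" for n
    by (simp add: Y y unitary_hnorm flip: unitary_diff)
  with y show "\<exists>x\<in>carr K. (\<lambda>n. hnorm K (X n - x)) \<longlonglongrightarrow> 0"
    by (intro bexI[of _ "\<Phi> y"]) (simp_all add: unitary_carr)
next
  fix x assume "x \<in> carr K" "x \<noteq> 0"
  then obtain x' where "x' \<in> carr H" "x = \<Phi> x'" "x' \<noteq> 0"
    using unitary_zero by (auto simp: unitary_carr)
  thus "0 < Re (ip K x x)"
    by (simp add: unitary_ip ip_pos)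
next
  fix x y assume "x \<in> carr K" "y \<in> carr K"
  then obtain x' y' where "x' \<in> carr H" "x = \<Phi> x'" "y' \<in> carr H" "y = \<Phi> y'"
    by (auto simp: unitary_carr)
  thus "ip K y x = cnj (ip K x y)"
    by (simp add: unitary_ip ip_commute[of x' y'])
qed (auto simp: unitary_carr unitary_ip ip_simps simp flip: unitary_add unitary_scale)

lemma unitary_span:
  assumes S: "S \<subseteq> carr H" and x: "x \<in> complex_vector.span S"
  shows "\<Phi> x \<in> complex_vector.span (\<Phi> ` S)"
proof -
  let ?P = "\<lambda>x. x \<in> carr H \<and> \<Phi> x \<in> complex_vector.span (\<Phi> ` S)"
  have "complex_vector.subspace (Collect ?P)"
    by (rule complex_vector.subspaceI)
       (auto simp: unitary_zero unitary_add unitary_scale complex_vector.span_zero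
          complex_vector.span_add complex_vector.span_scale)
  moreover have "S \<subseteq> Collect ?P"
    using S complex_vector.span_superset[of "\<Phi> ` S"] by auto
  ultimately have "complex_vector.span S \<subseteq> Collect ?P"
    by (rule complex_vector.span_minimal[rotated])
  thus ?thesis using x by auto
qed

theorem unitary_orthonormal_basis:
  assumes E: "orthonormal_basis H E"
  shows "orthonormal_basis K (\<Phi> ` E)"
proof -
  have EH: "E \<subseteq> carr H" and ip_E: "\<And>x y. x \<in> E \<Longrightarrow> y \<in> E \<Longrightarrow> ip H x y = (if x = y then 1 else 0)"
    and span: "closed_span H E = carr H"
    using E by (auto simp: orthonormal_basis_def)
  have "ip K (\<Phi> x) (\<Phi> y) = (if \<Phi> x = \<Phi> y then 1 else 0)" if "x \<in> E" "y \<in> E" for x y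
  proof (cases "x = y")
    case False
    hence "ip H x y = 0" "ip H x x = 1"
      using ip_E that by auto
    \<comment> \<open>\<open>orthonormal_basis\<close> compares elements of the image set, so
      distinct basis vectors need distinct images.\<close>
    hence "\<Phi> x \<noteq> \<Phi> y"
      using unitary_ip[of x x] unitary_ip[of x y] that EH by force
    thus ?thesis using \<open>ip H x y = 0\<close> that EH by (simp add: unitary_ip subset_iff)
  qed (use ip_E that EH in \<open>auto simp: unitary_ip\<close>)
  moreover have "\<Phi> x \<in> closed_span K (\<Phi> ` E)" if x: "x \<in> carr H" for x
    unfolding closed_span_def
  proof (intro CollectI conjI allI impI)
    fix \<epsilon> :: real assume "\<epsilon> > 0"
    then obtain y where y: "y \<in> complex_vector.span E" "hnorm H (x - y) < \<epsilon>"
      using closed_spanE[of x H E \<epsilon>] x span by blast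
    have "y \<in> carr H" using y span_mem[OF EH] by blast
    hence "hnorm K (\<Phi> x - \<Phi> y) < \<epsilon>"
      using x y by (simp add: unitary_hnorm flip: unitary_diff)
    thus "\<exists>y\<in>complex_vector.span (\<Phi> ` E). hnorm K (\<Phi> x - y) < \<epsilon>"
      using unitary_span[OF EH y(1)] by blast
  qed (use x in \<open>simp add: unitary_carr\<close>)
  hence "closed_span K (\<Phi> ` E) = carr K"
    by (auto simp: unitary_carr) (auto simp: closed_span_def unitary_carr)
  ultimately show ?thesis
    using EH by (auto simp: orthonormal_basis_def unitary_carr)
qed

end

end

subsection \<open>Weighted Bergman spaces\<close>

text \<open>The kernel sections span a dense subspace of \<open>H\<close>, and the reproducing
  property fixes all inner products with elements of that span. Hence a sequence in the span tending
  to \<open>f\<close> in \<open>H\<close> is Cauchy in \<open>G\<close>, and its limit there is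
  \<open>f\<close> because evaluations are continuous in both spaces. The sequence is kept for the
  comparison of inner products.\<close>

lemma holomorphic_rkhs_approx:
  assumes H: "holomorphic_rkhs K H" and G: "holomorphic_rkhs K G" and f: "f \<in> carr H"
  defines "S \<equiv> (\<lambda>w. on_disc (\<lambda>z. K z w)) ` unit_disc"
  shows "f \<in> carr G" "\<exists>X. (\<forall>n. X n \<in> carr H \<and> X n \<in> carr G) \<and>
      (\<forall>n. \<forall>g. g \<in> carr H \<longrightarrow> g \<in> carr G \<longrightarrow> ip H g (X n) = ip G g (X n)) \<and>
      (\<lambda>n. hnorm H (X n - f)) \<longlonglongrightarrow> 0 \<and> (\<lambda>n. hnorm G (X n - f)) \<longlonglongrightarrow> 0"
proof -
  interpret H: complex_hilbert_space H using H by (simp add: holomorphic_rkhs_def)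
  interpret G: complex_hilbert_space G using G by (simp add: holomorphic_rkhs_def)
  have kerH: "on_disc (\<lambda>z. K z w) \<in> carr H" "g \<in> carr H \<Longrightarrow> ip H g (on_disc (\<lambda>z. K z w)) = g w"
    and kerG: "on_disc (\<lambda>z. K z w) \<in> carr G" "h \<in> carr G \<Longrightarrow> ip G h (on_disc (\<lambda>z. K z w)) = h w"
    if "w \<in> unit_disc" for w g h
    using H G that by (auto simp: holomorphic_rkhs_def)
  have off: "z \<notin> unit_disc \<Longrightarrow> g z = 0" if "g \<in> carr H \<or> g \<in> carr G" for g z
    using H G that by (auto simp: holomorphic_rkhs_def)
  have SH: "S \<subseteq> carr H" and SG: "S \<subseteq> carr G"
    using kerH kerG by (auto simp: S_def)
  note spanH = H.span_mem[OF SH, THEN subsetD] and spanG = G.span_mem[OF SG, THEN subsetD]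
  have ip_span: "ip H g y = ip G g y"
    if g: "g \<in> carr H" "g \<in> carr G" and y: "y \<in> complex_vector.span S" for g y
  proof -
    let ?P = "\<lambda>y. y \<in> carr H \<and> y \<in> carr G \<and> ip H g y = ip G g y"
    have "complex_vector.subspace (Collect ?P)"
      using g by (intro complex_vector.subspaceI) (auto simp: H.ip_simps G.ip_simps)
    moreover have "S \<subseteq> Collect ?P"
      using g SH SG kerH(2) kerG(2) by (auto simp: S_def)
    ultimately have "complex_vector.span S \<subseteq> Collect ?P"
      by (rule complex_vector.span_minimal[rotated])
    thus ?thesis using y by auto
  qed
  have "closed_span H S = carr H"
  proof (rule H.closed_span_eqI[OF SH])
    fix x assume x: "x \<in> carr H" and orth: "\<And>s. s \<in> S \<Longrightarrow> ip H s x = 0"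
    have "x w = 0" for w
    proof (cases "w \<in> unit_disc")
      case True
      have "ip H (on_disc (\<lambda>z. K z w)) x = 0"
        using True by (intro orth) (simp add: S_def)
      hence "ip H x (on_disc (\<lambda>z. K z w)) = 0"
        using H.ip_commute[OF kerH(1)[OF True] x] by simp
      thus ?thesis using kerH(2)[OF True x] by simp
    qed (use off x in blast)
    thus "x = 0" by auto
  qed
  then obtain X where X: "\<And>n. X n \<in> complex_vector.span S" and limH: "(\<lambda>n. hnorm H (X n - f)) \<longlonglongrightarrow> 0"
    using H.closed_span_sequence[of f S] f SH by metis
  have norm_eq: "hnorm H y = hnorm G y" if "y \<in> complex_vector.span S" for y
    using ip_span[OF spanH[OF that] spanG[OF that] that] by (simp add: hnorm_def)
  have "\<exists>g\<in>carr G. (\<lambda>n. hnorm G (X n - g)) \<longlonglongrightarrow> 0"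
  proof (rule G.complete)
    show "\<exists>N. \<forall>p\<ge>N. \<forall>q\<ge>N. hnorm G (X p - X q) < \<epsilon>" if "\<epsilon> > 0" for \<epsilon>
      using H.Cauchy_of_tendsto[OF spanH[OF X] f limH that]
      by (simp add: norm_eq[OF complex_vector.span_diff[OF X X]])
  qed (use X spanG in blast)
  then obtain g where g: "g \<in> carr G" and limG: "(\<lambda>n. hnorm G (X n - g)) \<longlonglongrightarrow> 0" by blast
  have "f w = g w" for w
  proof (cases "w \<in> unit_disc")
    case True
    have "(\<lambda>n. X n w) \<longlonglongrightarrow> f w"
      using H.tendsto_ip_left[OF spanH[OF X] f kerH(1)[OF True] limH]
      by (simp add: kerH(2)[OF True] spanH[OF X] f)
    moreover have "(\<lambda>n. X n w) \<longlonglongrightarrow> g w"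
      using G.tendsto_ip_left[OF spanG[OF X] g kerG(1)[OF True] limG]
      by (simp add: kerG(2)[OF True] spanG[OF X] g)
    ultimately show ?thesis by (rule LIMSEQ_unique)
  qed (use off[of f w] off[of g w] f g in simp)
  hence "f = g" by auto
  with g show "f \<in> carr G" by simp
  show "\<exists>X. (\<forall>n. X n \<in> carr H \<and> X n \<in> carr G) \<and>
      (\<forall>n. \<forall>g. g \<in> carr H \<longrightarrow> g \<in> carr G \<longrightarrow> ip H g (X n) = ip G g (X n)) \<and>
      (\<lambda>n. hnorm H (X n - f)) \<longlonglongrightarrow> 0 \<and> (\<lambda>n. hnorm G (X n - f)) \<longlonglongrightarrow> 0"
    using X limH limG \<open>f = g\<close> spanH spanG ip_span by (intro exI[of _ X]) auto
qed

text \<open>Equality of records, as the definite description in \<open>weighted_bergman\<close>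
  demands: inner products on the carrier agree by approximation, those off the carrier by the
  normalisation in \<open>holomorphic_rkhs\<close>.\<close>

theorem holomorphic_rkhs_unique:
  assumes H: "holomorphic_rkhs K H" and G: "holomorphic_rkhs K G"
  shows "H = G"
proof -
  interpret H: complex_hilbert_space H using H by (simp add: holomorphic_rkhs_def)
  interpret G: complex_hilbert_space G using G by (simp add: holomorphic_rkhs_def)
  have carr: "carr H = carr G"
    using holomorphic_rkhs_approx(1)[OF H G] holomorphic_rkhs_approx(1)[OF G H] by blast
  have "ip H f g = ip G f g" for f g
  proof (cases "f \<in> carr H \<and> g \<in> carr H")
    case True
    hence f: "f \<in> carr H" "f \<in> carr G" and g: "g \<in> carr H" "g \<in> carr G"
      using carr by auto
    obtain X where X: "\<And>n. X n \<in> carr H" "\<And>n. X n \<in> carr G" "\<And>n. ip H f (X n) = ip G f (X n)"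
      "(\<lambda>n. hnorm H (X n - g)) \<longlonglongrightarrow> 0" "(\<lambda>n. hnorm G (X n - g)) \<longlonglongrightarrow> 0"
      using holomorphic_rkhs_approx(2)[OF H G g(1)] f by blast
    have "(\<lambda>n. ip H f (X n)) \<longlonglongrightarrow> ip H f g" "(\<lambda>n. ip G f (X n)) \<longlonglongrightarrow> ip G f g"
      by (intro H.tendsto_ip_right G.tendsto_ip_right X f g)+
    thus ?thesis
      unfolding X(3) by (rule LIMSEQ_unique)
  qed (use H G carr in \<open>auto simp: holomorphic_rkhs_def\<close>)
  hence "ip H = ip G"
    by (intro ext)
  with carr show ?thesis
    by (intro hilb.equality) auto
qed

section \<open>Taylor coefficients of functions on the disc\<close>

definition tcoeff :: "(complex \<Rightarrow> complex) \<Rightarrow> nat \<Rightarrow> complex" where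
  "tcoeff f n = (deriv ^^ n) f 0 / fact n"

text \<open>Vanishing off the disc makes the Taylor coefficients determine the total function, so
  identities between functions can be checked coefficientwise.\<close>

definition disc_fun :: "(complex \<Rightarrow> complex) \<Rightarrow> bool" where
  "disc_fun f \<longleftrightarrow> f holomorphic_on unit_disc \<and> (\<forall>z. z \<notin> unit_disc \<longrightarrow> f z = 0)"

lemma tcoeff_sums:
  assumes "f holomorphic_on unit_disc" "cmod z < 1"
  shows "(\<lambda>n. tcoeff f n * z ^ n) sums f z"
  using holomorphic_power_series[OF assms(1), of z] assms(2) by (simp add: tcoeff_def)

text \<open>Uniqueness of power series: an expansion convergent on the disc is the Taylor expansion.
  Most coefficient formulas below are obtained by exhibiting such an expansion.\<close>

lemma
  assumes a: "\<And>z. cmod z < 1 \<Longrightarrow> (\<lambda>n. a n * z ^ n) sums f z"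
  shows powser_holomorphic: "f holomorphic_on unit_disc" and tcoeff_eqI: "tcoeff f = a"
proof -
  show hol: "f holomorphic_on unit_disc"
    using a by (intro power_series_holomorphic[of 0 1 a]) auto
  define F where "F = Abs_fps a"
  have "fps_conv_radius F \<ge> 1"
    unfolding fps_conv_radius_def
  proof (rule conv_radius_geI_ex')
    fix r :: real assume "0 < r" "ereal r < 1"
    thus "summable (\<lambda>n. fps_nth F n * of_real r ^ n)"
      using a[of "of_real r"] by (auto simp: F_def sums_iff)
  qed
  hence rad: "fps_conv_radius F > 0"
    by (rule less_le_trans[rotated]) simp
  have "eval_fps F z = f z" if "z \<in> unit_disc" for z
    using a[of z] that by (simp add: eval_fps_def F_def sums_iff)
  moreover have "eventually (\<lambda>z. z \<in> unit_disc) (nhds (0::complex))"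
    by (rule eventually_nhds_in_open) auto
  ultimately have "eventually (\<lambda>z. eval_fps F z = f z) (nhds 0)"
    by (rule eventually_mono[rotated])
  hence "f has_fps_expansion F"
    using rad by (simp add: has_fps_expansion_def)
  from fps_nth_fps_expansion[OF this] show "tcoeff f = a"
    by (simp add: tcoeff_def F_def fun_eq_iff)
qed

lemma disc_fun_eqI:
  assumes "disc_fun f" "disc_fun g" "\<And>n. tcoeff f n = tcoeff g n"
  shows "f = g"
proof
  fix z
  show "f z = g z"
  proof (cases "cmod z < 1")
    case True
    thus ?thesis
      using tcoeff_sums[of f z] tcoeff_sums[of g z] assms sums_unique2
      by (fastforce simp: disc_fun_def)
  qed (use assms in \<open>simp add: disc_fun_def\<close>)
qed

text \<open>The squared norm of z^n in the space of parameter \<alpha>. Its reciprocal is the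
  coefficient of x^n in (1 - x)^(-2\<alpha>), hence in the kernel.\<close>

definition bwt :: "real \<Rightarrow> nat \<Rightarrow> real" where
  "bwt \<alpha> n = fact n / pochhammer (2 * \<alpha>) n"

lemma bwt_pos: "\<alpha> > 0 \<Longrightarrow> bwt \<alpha> n > 0"
  by (simp add: bwt_def pochhammer_pos)

lemma bwt_nonneg: "\<alpha> > 0 \<Longrightarrow> 0 \<le> bwt \<alpha> n"
  using bwt_pos[of \<alpha> n] by simp

lemma bwt_0 [simp]: "bwt \<alpha> 0 = 1"
  by (simp add: bwt_def)

text \<open>The binomial series gives the expansion of the kernel. At real arguments it also
  supplies the convergent majorants, including the one for the difference quotient.\<close>

lemma binomial_sums:
  assumes "cmod z < 1"
  shows "(\<lambda>n. complex_of_real (1 / bwt \<alpha> n) * z ^ n) sums (1 - z) powr (- complex_of_real (2 * \<alpha>))"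
proof -
  have "(- complex_of_real (2 * \<alpha>) gchoose n) * (- z) ^ n = complex_of_real (1 / bwt \<alpha> n) * z ^ n" for n
  proof -
    have "(- complex_of_real (2 * \<alpha>) gchoose n) * (- z) ^ n
        = ((- 1) ^ n * (- z) ^ n) * (pochhammer (complex_of_real (2 * \<alpha>)) n / fact n)"
      by (simp add: gbinomial_pochhammer)
    also have "(- 1) ^ n * (- z) ^ n = z ^ n"
      by (simp flip: power_mult_distrib)
    finally show ?thesis
      by (simp only: pochhammer_of_real bwt_def) simp
  qed
  thus ?thesis
    using gen_binomial_complex[of "- z" "- complex_of_real (2 * \<alpha>)"] assms by simp
qed

lemma summable_binomial:
  assumes "0 \<le> r" "r < 1"
  shows "summable (\<lambda>n. (1 / bwt \<alpha> n) * r ^ n)"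
proof -
  have "summable (\<lambda>n. complex_of_real (1 / bwt \<alpha> n) * complex_of_real r ^ n)"
    using binomial_sums[of "complex_of_real r" \<alpha>] assms by (auto simp: sums_iff)
  from summable_Re[OF this] show ?thesis
    by (simp flip: of_real_power of_real_mult of_real_divide)
qed

text \<open>Removes the square root in the normalising constants, so that the binomial series can
  serve as a majorant.\<close>

lemma sqrt_le_one_plus: "sqrt b \<le> 1 + b" if "0 \<le> b"
proof (rule real_le_lsqrt)
  show "b \<le> (1 + b)\<^sup>2"
    using that zero_le_power2[of b] unfolding power2_sum by simp
qed (use that in simp)

text \<open>The function whose coordinates with respect to the normalised monomials are
  \<open>a n\<close>.\<close>

definition bfun :: "real \<Rightarrow> (nat \<Rightarrow> complex) \<Rightarrow> complex \<Rightarrow> complex" where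
  "bfun \<alpha> a = on_disc (\<lambda>z. \<Sum>n. a n * complex_of_real (sqrt (1 / bwt \<alpha> n)) * z ^ n)"

lemma bfun_sums:
  assumes \<alpha>: "\<alpha> > 0" and a: "a \<in> carr (ell2 UNIV)" and z: "cmod z < 1"
  shows "(\<lambda>n. a n * complex_of_real (sqrt (1 / bwt \<alpha> n)) * z ^ n) sums bfun \<alpha> a z"
proof -
  interpret complex_hilbert_space "ell2 UNIV" by (rule ell2_hilbert_space)
  define A where "A = hnorm (ell2 UNIV) a"
  have "cmod (a n) \<le> A" for n
    using ell2_sum_le[OF a, of "{n}"] a by (simp add: A_def power2_le_imp_le[OF _ hnorm_nonneg])
  have "summable (\<lambda>n. a n * complex_of_real (sqrt (1 / bwt \<alpha> n)) * z ^ n)"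
  proof (rule summable_comparison_test', rule summable_mult)
    \<comment> \<open>The coordinates are bounded by the norm of \<open>a\<close>, and the square
      root by one plus its argument; this leaves a geometric and a binomial series.\<close>
    show "summable (\<lambda>n. cmod z ^ n + (1 / bwt \<alpha> n) * cmod z ^ n)"
      using z by (intro summable_add summable_geometric summable_binomial) auto
    fix n :: nat
    let ?b = "1 / bwt \<alpha> n"
    have b: "?b \<ge> 0" using bwt_pos[OF \<alpha>, of n] by simp
    have sq: "sqrt ?b \<le> 1 + ?b"
      using b by (rule sqrt_le_one_plus)
    have "norm (a n * complex_of_real (sqrt ?b) * z ^ n) = cmod (a n) * (sqrt ?b * cmod z ^ n)"
      using b by (simp add: norm_mult norm_power)
    also have "\<dots> \<le> A * ((1 + ?b) * cmod z ^ n)"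
      using \<open>cmod (a n) \<le> A\<close> sq b order_trans[OF norm_ge_zero] by (intro mult_mono) auto
    finally show "norm (a n * complex_of_real (sqrt ?b) * z ^ n) \<le> A * (cmod z ^ n + ?b * cmod z ^ n)"
      by (simp add: algebra_simps)
  qed
  thus ?thesis
    using z by (simp add: bfun_def on_disc_def summable_sums)
qed

lemma disc_fun_bfun:
  assumes "\<alpha> > 0" "a \<in> carr (ell2 UNIV)"
  shows "disc_fun (bfun \<alpha> a)"
  using powser_holomorphic[OF bfun_sums[OF assms]] by (auto simp: disc_fun_def bfun_def on_disc_def)

lemma tcoeff_bfun:
  assumes "\<alpha> > 0" "a \<in> carr (ell2 UNIV)"
  shows "tcoeff (bfun \<alpha> a) n = a n * complex_of_real (sqrt (1 / bwt \<alpha> n))"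
  using tcoeff_eqI[OF bfun_sums[OF assms]] by simp

lemma bfun_coeff_sq:
  assumes \<alpha>: "\<alpha> > 0" and a: "a \<in> carr (ell2 UNIV)"
  shows "bwt \<alpha> n * (cmod (tcoeff (bfun \<alpha> a) n))\<^sup>2 = (cmod (a n))\<^sup>2"
proof -
  define b where "b = bwt \<alpha> n"
  have "b > 0" using bwt_pos[OF \<alpha>] by (simp add: b_def)
  hence "b * (cmod (a n) * sqrt (1 / b))\<^sup>2 = (cmod (a n))\<^sup>2"
    by (simp add: power_mult_distrib)
  thus ?thesis
    using \<open>b > 0\<close> by (simp add: tcoeff_bfun[OF assms] norm_mult norm_divide flip: b_def)
qed

text \<open>The model of the weighted Bergman space. The carrier is an image, so \<open>bfun\<close>
  is onto by definition; the case distinction provides the value 0 off the carrier that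
  \<open>holomorphic_rkhs\<close> prescribes.\<close>

definition bergman :: "real \<Rightarrow> (complex \<Rightarrow> complex) hilb" where
  "bergman \<alpha> = \<lparr>carr = bfun \<alpha> ` carr (ell2 UNIV),
    ip = (\<lambda>f g. if f \<in> bfun \<alpha> ` carr (ell2 UNIV) \<and> g \<in> bfun \<alpha> ` carr (ell2 UNIV)
      then \<Sum>\<^sub>\<infinity>n. complex_of_real (bwt \<alpha> n) * (tcoeff f n * cnj (tcoeff g n)) else 0)\<rparr>"

lemma unitary_bfun:
  assumes \<alpha>: "\<alpha> > 0"
  shows "unitary (ell2 UNIV) (bergman \<alpha>) (bfun \<alpha>)"
  unfolding unitary_def
proof (intro conjI ballI allI)
  interpret complex_hilbert_space "ell2 UNIV" by (rule ell2_hilbert_space)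
  fix a b :: "nat \<Rightarrow> complex" and c
  assume a: "a \<in> carr (ell2 UNIV)"
  {
    assume b: "b \<in> carr (ell2 UNIV)"
    show "bfun \<alpha> (a + b) = bfun \<alpha> a + bfun \<alpha> b"
    proof (rule ext)
      fix z show "bfun \<alpha> (a + b) z = (bfun \<alpha> a + bfun \<alpha> b) z"
      proof (cases "cmod z < 1")
        case True
        show ?thesis
          using sums_add[OF bfun_sums[OF \<alpha> a True] bfun_sums[OF \<alpha> b True]]
            bfun_sums[OF \<alpha> add_mem[OF a b] True] sums_unique2
          by (fastforce simp: distrib_right)
      qed (simp add: bfun_def on_disc_def)
    qed
    have "ip (bergman \<alpha>) (bfun \<alpha> a) (bfun \<alpha> b)
        = (\<Sum>\<^sub>\<infinity>n. complex_of_real (bwt \<alpha> n) * (tcoeff (bfun \<alpha> a) n * cnj (tcoeff (bfun \<alpha> b) n)))"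
      using a b by (simp add: bergman_def)
    also have "\<dots> = ip (ell2 UNIV) a b"
      unfolding ell2_ip
    proof (rule infsum_cong)
      fix n
      have "complex_of_real (bwt \<alpha> n) * complex_of_real (sqrt (1 / bwt \<alpha> n)) * complex_of_real (sqrt (1 / bwt \<alpha> n)) = 1"
        using bwt_pos[OF \<alpha>, of n] unfolding of_real_mult[symmetric] mult.assoc by simp
      hence "a n * cnj (b n) * (complex_of_real (bwt \<alpha> n) * complex_of_real (sqrt (1 / bwt \<alpha> n)) * complex_of_real (sqrt (1 / bwt \<alpha> n)))
         = a n * cnj (b n)" by simp
      thus "complex_of_real (bwt \<alpha> n) * (tcoeff (bfun \<alpha> a) n * cnj (tcoeff (bfun \<alpha> b) n)) = a n * cnj (b n)"
        by (simp add: tcoeff_bfun[OF \<alpha> a] tcoeff_bfun[OF \<alpha> b] mult_ac)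
    qed
    finally show "ip (bergman \<alpha>) (bfun \<alpha> a) (bfun \<alpha> b) = ip (ell2 UNIV) a b" .
  }
  show "bfun \<alpha> (c *\<^sub>C a) = c *\<^sub>C bfun \<alpha> a"
  proof (rule ext)
    fix z show "bfun \<alpha> (c *\<^sub>C a) z = (c *\<^sub>C bfun \<alpha> a) z"
    proof (cases "cmod z < 1")
      case True
      show ?thesis
        using sums_mult[OF bfun_sums[OF \<alpha> a True], of c]
          bfun_sums[OF \<alpha> scaleC_mem[OF a] True, of c] sums_unique2
        by (fastforce simp: scaleC_fun_def scaleC_complex_def mult.assoc)
    qed (simp add: bfun_def on_disc_def scaleC_fun_def)
  qed
qed (simp add: bergman_def)

lemma bergman_hilbert_space: "\<alpha> > 0 \<Longrightarrow> complex_hilbert_space (bergman \<alpha>)"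
  using complex_hilbert_space.unitary_hilbert_space[OF ell2_hilbert_space unitary_bfun] .

lemma holomorphic_rkhs_bergman:
  assumes \<alpha>: "\<alpha> > 0"
  shows "holomorphic_rkhs (\<lambda>z \<omega>. (1 - z * cnj \<omega>) powr (- complex_of_real (2 * \<alpha>))) (bergman \<alpha>)"
  unfolding holomorphic_rkhs_def
proof (intro conjI ballI allI impI)
  show "complex_hilbert_space (bergman \<alpha>)"
    using \<alpha> by (rule bergman_hilbert_space)
  fix f assume "f \<in> carr (bergman \<alpha>)"
  then obtain a where "a \<in> carr (ell2 UNIV)" "f = bfun \<alpha> a"
    by (auto simp: bergman_def)
  thus "f holomorphic_on unit_disc" "z \<notin> unit_disc \<Longrightarrow> f z = 0" for z
    using disc_fun_bfun[OF \<alpha>] by (auto simp: disc_fun_def)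
next
  fix w :: complex assume "w \<in> unit_disc"
  hence w: "cmod w < 1" by simp
  let ?c = "\<lambda>n. complex_of_real (sqrt (1 / bwt \<alpha> n))"
  have c2: "?c n * ?c n = complex_of_real (1 / bwt \<alpha> n)" for n
    using bwt_pos[OF \<alpha>, of n] by (simp flip: of_real_mult)
  \<comment> \<open>The coordinates of the kernel section at \<open>w\<close>: conjugates of the
    values at \<open>w\<close> of the normalised monomials, so that pairing with \<open>k\<close>
    sums the expansion at \<open>w\<close>.\<close>
  define k where "k n = ?c n * cnj w ^ n" for n
  have k_mem: "k \<in> carr (ell2 UNIV)"
  proof -
    have "summable (\<lambda>n. 1 / bwt \<alpha> n * ((cmod w)\<^sup>2) ^ n)"
      using w by (intro summable_binomial) (auto simp: abs_square_less_1)
    moreover have "(cmod (k n))\<^sup>2 = 1 / bwt \<alpha> n * ((cmod w)\<^sup>2) ^ n" for n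
      using bwt_pos[OF \<alpha>, of n]
      by (simp add: k_def norm_mult norm_divide norm_power power_mult_distrib real_sqrt_divide power_divide
          less_imp_le power_mult[symmetric] mult.commute)
    ultimately have "(\<lambda>n. (cmod (k n))\<^sup>2) summable_on UNIV"
      by (subst summable_on_UNIV_nonneg_real_iff) (auto simp: bwt_nonneg[OF \<alpha>])
    thus ?thesis by (simp add: ell2_mem_iff)
  qed
  have ker: "on_disc (\<lambda>z. (1 - z * cnj w) powr (- complex_of_real (2 * \<alpha>))) = bfun \<alpha> k"
  proof
    fix z
    show "on_disc (\<lambda>z. (1 - z * cnj w) powr (- complex_of_real (2 * \<alpha>))) z = bfun \<alpha> k z"
    proof (cases "cmod z < 1")
      case True
      have "cmod (z * cnj w) < 1"
        using mult_strict_mono'[OF True w] by (simp add: norm_mult)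
      from binomial_sums[OF this, of \<alpha>]
      have "(\<lambda>n. k n * ?c n * z ^ n) sums (1 - z * cnj w) powr (- complex_of_real (2 * \<alpha>))"
        unfolding c2[symmetric] by (simp add: k_def power_mult_distrib mult_ac)
      thus ?thesis
        using bfun_sums[OF \<alpha> k_mem True] True sums_unique2 by (fastforce simp: on_disc_def)
    qed (simp add: bfun_def on_disc_def)
  qed
  show "on_disc (\<lambda>z. (1 - z * cnj w) powr (- complex_of_real (2 * \<alpha>))) \<in> carr (bergman \<alpha>)"
    using k_mem unfolding ker by (simp add: bergman_def)
  fix f assume "f \<in> carr (bergman \<alpha>)"
  then obtain a where a: "a \<in> carr (ell2 UNIV)" "f = bfun \<alpha> a"
    by (auto simp: bergman_def)
  have "ip (bergman \<alpha>) f (bfun \<alpha> k) = (\<Sum>\<^sub>\<infinity>n. a n * cnj (k n))"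
    using complex_hilbert_space.unitary_ip[OF ell2_hilbert_space unitary_bfun[OF \<alpha>] a(1) k_mem] a
    by (simp add: ell2_ip)
  also have "\<dots> = (\<Sum>n. a n * cnj (k n))"
    by (rule sums_unique[OF has_sum_imp_sums[OF has_sum_infsum]]) (rule ell2_summable_prod[OF a(1) k_mem])
  also have "\<dots> = (\<Sum>n. a n * ?c n * w ^ n)"
    by (simp add: k_def mult.assoc)
  also have "\<dots> = f w"
    using bfun_sums[OF \<alpha> a(1) w] a by (simp add: sums_iff)
  finally show "ip (bergman \<alpha>) f (on_disc (\<lambda>z. (1 - z * cnj w) powr (- complex_of_real (2 * \<alpha>)))) = f w"
    by (simp only: ker)
qed (auto simp: bergman_def)

text \<open>Uniqueness discharges the definite description; from here on only the explicit model is
  used.\<close>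

theorem weighted_bergman_eq: "\<alpha> > 0 \<Longrightarrow> weighted_bergman \<alpha> = bergman \<alpha>"
  unfolding weighted_bergman_def
  using holomorphic_rkhs_bergman holomorphic_rkhs_unique by (blast intro: the_equality)

lemma bergman_mem_iff:
  assumes \<alpha>: "\<alpha> > 0"
  shows "f \<in> carr (bergman \<alpha>) \<longleftrightarrow> disc_fun f \<and> summable (\<lambda>n. bwt \<alpha> n * (cmod (tcoeff f n))\<^sup>2)"
proof
  assume "f \<in> carr (bergman \<alpha>)"
  then obtain a where a: "a \<in> carr (ell2 UNIV)" "f = bfun \<alpha> a"
    by (auto simp: bergman_def)
  have "(\<lambda>n. (cmod (a n))\<^sup>2) = (\<lambda>n. bwt \<alpha> n * (cmod (tcoeff f n))\<^sup>2)"
    by (simp add: a bfun_coeff_sq[OF \<alpha> a(1)])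
  moreover have "summable (\<lambda>n. (cmod (a n))\<^sup>2)"
    using ell2_summable[OF a(1)] by (rule summable_on_imp_summable)
  ultimately show "disc_fun f \<and> summable (\<lambda>n. bwt \<alpha> n * (cmod (tcoeff f n))\<^sup>2)"
    using disc_fun_bfun[OF \<alpha> a(1)] a(2) by simp
next
  assume f: "disc_fun f \<and> summable (\<lambda>n. bwt \<alpha> n * (cmod (tcoeff f n))\<^sup>2)"
  \<comment> \<open>Inverts \<open>bfun\<close>: the coordinates relative to the normalised
    monomials.\<close>
  define a where "a n = complex_of_real (sqrt (bwt \<alpha> n)) * tcoeff f n" for n
  have "(cmod (a n))\<^sup>2 = bwt \<alpha> n * (cmod (tcoeff f n))\<^sup>2" for n
    using bwt_pos[OF \<alpha>, of n] by (simp add: a_def norm_mult power_mult_distrib)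
  hence "(\<lambda>n. (cmod (a n))\<^sup>2) summable_on UNIV"
    using f by (subst summable_on_UNIV_nonneg_real_iff) (auto simp: bwt_nonneg[OF \<alpha>])
  hence a_mem: "a \<in> carr (ell2 UNIV)"
    by (simp add: ell2_mem_iff)
  have "f = bfun \<alpha> a"
  proof (rule disc_fun_eqI)
    fix n
    have "complex_of_real (sqrt (bwt \<alpha> n)) * complex_of_real (sqrt (1 / bwt \<alpha> n)) = 1"
      using bwt_pos[OF \<alpha>, of n] by (simp add: real_sqrt_divide flip: of_real_mult)
    thus "tcoeff f n = tcoeff (bfun \<alpha> a) n"
      by (simp add: tcoeff_bfun[OF \<alpha> a_mem] a_def mult_ac)
  qed (use f disc_fun_bfun[OF \<alpha> a_mem] in auto)
  thus "f \<in> carr (bergman \<alpha>)"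
    using a_mem by (simp add: bergman_def)
qed

lemma bergman_hnorm_sums:
  assumes \<alpha>: "\<alpha> > 0" and f: "f \<in> carr (bergman \<alpha>)"
  shows "(\<lambda>n. bwt \<alpha> n * (cmod (tcoeff f n))\<^sup>2) sums (hnorm (bergman \<alpha>) f)\<^sup>2"
proof -
  obtain a where a: "a \<in> carr (ell2 UNIV)" "f = bfun \<alpha> a"
    using f by (auto simp: bergman_def)
  have "(\<lambda>n. (cmod (a n))\<^sup>2) = (\<lambda>n. bwt \<alpha> n * (cmod (tcoeff f n))\<^sup>2)"
    by (simp add: a bfun_coeff_sq[OF \<alpha> a(1)])
  moreover have "(\<lambda>n. (cmod (a n))\<^sup>2) sums (hnorm (ell2 UNIV) a)\<^sup>2"
    unfolding ell2_hnorm_sq[OF a(1)]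
    by (rule has_sum_imp_sums[OF has_sum_infsum]) (rule ell2_summable[OF a(1)])
  ultimately show ?thesis
    using complex_hilbert_space.unitary_hnorm[OF ell2_hilbert_space unitary_bfun[OF \<alpha>] a(1)] a(2) by simp
qed

text \<open>Partial sums suffice for both membership and norm, which is the form in which the
  operator bounds below are obtained.\<close>

lemma bergman_memI:
  assumes \<alpha>: "\<alpha> > 0" and f: "disc_fun f"
    and C: "\<And>N. (\<Sum>n<N. bwt \<alpha> n * (cmod (tcoeff f n))\<^sup>2) \<le> C\<^sup>2" "C \<ge> 0"
  shows "f \<in> carr (bergman \<alpha>)" "hnorm (bergman \<alpha>) f \<le> C"
proof -
  have nn: "0 \<le> bwt \<alpha> n * (cmod (tcoeff f n))\<^sup>2" for n
    using bwt_pos[OF \<alpha>, of n] by simp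
  have s: "summable (\<lambda>n. bwt \<alpha> n * (cmod (tcoeff f n))\<^sup>2)"
    using C(1) nn by (intro summableI_nonneg_bounded) auto
  thus mem: "f \<in> carr (bergman \<alpha>)"
    using f by (simp add: bergman_mem_iff[OF \<alpha>])
  have "(hnorm (bergman \<alpha>) f)\<^sup>2 \<le> C\<^sup>2"
    unfolding sums_unique[OF bergman_hnorm_sums[OF \<alpha> mem]]
    by (rule suminf_le_const[OF s C(1)])
  thus "hnorm (bergman \<alpha>) f \<le> C"
    using C(2) by (rule power2_le_imp_le)
qed

lemma bergman_sum_le:
  assumes \<alpha>: "\<alpha> > 0" and f: "f \<in> carr (bergman \<alpha>)" and A: "finite A"
  shows "(\<Sum>n\<in>A. bwt \<alpha> n * (cmod (tcoeff f n))\<^sup>2) \<le> (hnorm (bergman \<alpha>) f)\<^sup>2"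
  unfolding sums_unique[OF bergman_hnorm_sums[OF \<alpha> f]]
  using sums_summable[OF bergman_hnorm_sums[OF \<alpha> f]] A
  by (intro sum_le_suminf) (auto simp: bwt_nonneg[OF \<alpha>])

subsection \<open>Operators on weighted Bergman spaces\<close>

lemma scaleC_fun_apply [simp]: "(c *\<^sub>C f) x = c *\<^sub>C f x"
  by (simp add: scaleC_fun_def)

lemma scaleC_complex [simp]: "c *\<^sub>C x = c * (x::complex)"
  by (simp add: scaleC_complex_def)

section \<open>Taylor coefficients of sums, monomials, products with \<open>z\<close> and
  derivatives\<close>

lemma disc_fun_add: "disc_fun f \<Longrightarrow> disc_fun g \<Longrightarrow> disc_fun (f + g)"
  by (auto simp: disc_fun_def plus_fun_def intro!: holomorphic_intros)

lemma disc_fun_diff: "disc_fun f \<Longrightarrow> disc_fun g \<Longrightarrow> disc_fun (f - g)"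
  by (auto simp: disc_fun_def fun_diff_def intro!: holomorphic_intros)

lemma disc_fun_scaleC: "disc_fun f \<Longrightarrow> disc_fun (c *\<^sub>C f)"
  by (auto simp: disc_fun_def scaleC_fun_def intro!: holomorphic_intros)

lemma disc_fun_on_disc: "f holomorphic_on unit_disc \<Longrightarrow> disc_fun (on_disc f)"
  by (auto simp: disc_fun_def on_disc_def intro: holomorphic_transform)

lemma disc_fun_sums: "disc_fun f \<Longrightarrow> cmod z < 1 \<Longrightarrow> (\<lambda>n. tcoeff f n * z ^ n) sums f z"
  by (rule tcoeff_sums) (simp_all add: disc_fun_def)

lemma disc_fun_differentiable: "disc_fun f \<Longrightarrow> cmod z < 1 \<Longrightarrow> f field_differentiable at z"
  by (rule holomorphic_on_imp_differentiable_at[of _ unit_disc]) (auto simp: disc_fun_def)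

lemma tcoeff_add: "disc_fun f \<Longrightarrow> disc_fun g \<Longrightarrow> tcoeff (f + g) n = tcoeff f n + tcoeff g n"
  by (rule fun_cong[OF tcoeff_eqI])
     (use sums_add[OF disc_fun_sums disc_fun_sums] in \<open>simp add: distrib_right\<close>)

lemma tcoeff_diff: "disc_fun f \<Longrightarrow> disc_fun g \<Longrightarrow> tcoeff (f - g) n = tcoeff f n - tcoeff g n"
  by (rule fun_cong[OF tcoeff_eqI])
     (use sums_diff[OF disc_fun_sums disc_fun_sums] in \<open>simp add: left_diff_distrib\<close>)

lemma tcoeff_scaleC: "disc_fun f \<Longrightarrow> tcoeff (c *\<^sub>C f) n = c * tcoeff f n"
  by (rule fun_cong[OF tcoeff_eqI])
     (use sums_mult[OF disc_fun_sums] in \<open>simp add: mult.assoc\<close>)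

definition mon :: "nat \<Rightarrow> complex \<Rightarrow> complex" where
  "mon n = on_disc (\<lambda>z. z ^ n)"

lemma disc_fun_mon: "disc_fun (mon n)"
  unfolding mon_def by (intro disc_fun_on_disc holomorphic_intros)

lemma tcoeff_mon: "tcoeff (mon n) k = (if k = n then 1 else 0)"
proof (rule fun_cong[OF tcoeff_eqI])
  fix z :: complex assume "cmod z < 1"
  have "(\<lambda>k. if k = n then z ^ k else 0) sums z ^ n"
    by (rule sums_single)
  thus "(\<lambda>k. (if k = n then 1 else 0) * z ^ k) sums mon n z"
    using \<open>cmod z < 1\<close> by (simp add: mon_def on_disc_def if_distrib[of "\<lambda>x. x * _"] cong: if_cong)
qed

definition zmul :: "(complex \<Rightarrow> complex) \<Rightarrow> complex \<Rightarrow> complex" where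
  "zmul f = (\<lambda>z. z * f z)"

lemma disc_fun_zmul: "disc_fun f \<Longrightarrow> disc_fun (zmul f)"
  by (auto simp: disc_fun_def zmul_def intro!: holomorphic_intros)

lemma tcoeff_zmul:
  assumes "disc_fun f"
  shows "tcoeff (zmul f) 0 = 0" "tcoeff (zmul f) (Suc n) = tcoeff f n"
proof -
  have "tcoeff (zmul f) = (\<lambda>n. case n of 0 \<Rightarrow> 0 | Suc k \<Rightarrow> tcoeff f k)"
  proof (rule tcoeff_eqI)
    fix z :: complex assume "cmod z < 1"
    from sums_mult[OF disc_fun_sums[OF assms this], of z]
    have "(\<lambda>n. (case Suc n of 0 \<Rightarrow> 0 | Suc k \<Rightarrow> tcoeff f k) * z ^ Suc n) sums (zmul f z - 0)"
      by (simp add: zmul_def mult_ac)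
    thus "(\<lambda>n. (case n of 0 \<Rightarrow> 0 | Suc k \<Rightarrow> tcoeff f k) * z ^ n) sums zmul f z"
      by (subst (asm) sums_Suc_iff) simp
  qed
  thus "tcoeff (zmul f) 0 = 0" "tcoeff (zmul f) (Suc n) = tcoeff f n"
    by simp_all
qed

text \<open>Truncated after each derivative, so that iterates remain in \<open>disc_fun\<close>;
  since the disc is open, the values inside agree with those of the iterated
  \<open>deriv\<close>.\<close>

definition Dz :: "(complex \<Rightarrow> complex) \<Rightarrow> complex \<Rightarrow> complex" where
  "Dz f = on_disc (deriv f)"

lemma disc_fun_Dz: "disc_fun f \<Longrightarrow> disc_fun (Dz f)"
  unfolding Dz_def by (intro disc_fun_on_disc holomorphic_deriv) (auto simp: disc_fun_def)

lemma disc_fun_Dz_funpow: "disc_fun f \<Longrightarrow> disc_fun ((Dz ^^ k) f)"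
  by (induction k) (auto intro: disc_fun_Dz)

lemma Dz_funpow_eq: "z \<in> unit_disc \<Longrightarrow> (Dz ^^ k) f z = (deriv ^^ k) f z"
proof (induction k arbitrary: z)
  case (Suc k)
  have "eventually (\<lambda>x. x \<in> unit_disc) (nhds z)"
    using Suc.prems by (intro eventually_nhds_in_open) auto
  hence "eventually (\<lambda>x. (Dz ^^ k) f x = (deriv ^^ k) f x) (nhds z)"
    by (rule eventually_mono) (rule Suc.IH)
  hence "deriv ((Dz ^^ k) f) z = deriv ((deriv ^^ k) f) z"
    by (rule deriv_cong_ev) simp
  moreover have "Dz g z = deriv g z" for g
    using Suc.prems by (simp add: Dz_def on_disc_def)
  ultimately show ?case by simp
qed simp

lemma tcoeff_Dz: "tcoeff (Dz f) n = of_nat (Suc n) * tcoeff f (Suc n)"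
proof -
  have "(deriv ^^ n) (Dz f) 0 = (Dz ^^ Suc n) f 0"
    using Dz_funpow_eq[of 0 n "Dz f"] by (simp add: funpow_swap1)
  also have "\<dots> = (deriv ^^ Suc n) f 0"
    by (rule Dz_funpow_eq) simp
  finally show ?thesis
    by (simp add: tcoeff_def fact_Suc del: funpow.simps of_nat_Suc)
qed

lemma Dz_add: "disc_fun f \<Longrightarrow> disc_fun g \<Longrightarrow> Dz (f + g) = Dz f + Dz g"
  by (rule disc_fun_eqI)
     (simp_all add: disc_fun_add disc_fun_Dz tcoeff_add tcoeff_Dz distrib_left)

lemma Dz_diff: "disc_fun f \<Longrightarrow> disc_fun g \<Longrightarrow> Dz (f - g) = Dz f - Dz g"
  by (rule disc_fun_eqI)
     (simp_all add: disc_fun_diff disc_fun_Dz tcoeff_diff tcoeff_Dz right_diff_distrib)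

lemma Dz_scaleC: "disc_fun f \<Longrightarrow> Dz (c *\<^sub>C f) = c *\<^sub>C Dz f"
  by (rule disc_fun_eqI)
     (simp_all add: disc_fun_scaleC disc_fun_Dz tcoeff_scaleC tcoeff_Dz)

lemma Dz_funpow_add: "disc_fun f \<Longrightarrow> disc_fun g \<Longrightarrow> (Dz ^^ k) (f + g) = (Dz ^^ k) f + (Dz ^^ k) g"
  by (induction k) (simp_all add: Dz_add disc_fun_Dz_funpow)

lemma Dz_funpow_diff: "disc_fun f \<Longrightarrow> disc_fun g \<Longrightarrow> (Dz ^^ k) (f - g) = (Dz ^^ k) f - (Dz ^^ k) g"
  by (induction k) (simp_all add: Dz_diff disc_fun_Dz_funpow)

lemma Dz_funpow_scaleC: "disc_fun f \<Longrightarrow> (Dz ^^ k) (c *\<^sub>C f) = c *\<^sub>C (Dz ^^ k) f"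
  by (induction k) (simp_all add: Dz_scaleC disc_fun_Dz_funpow)

lemma Dz_zmul: "disc_fun f \<Longrightarrow> Dz (zmul f) = f + zmul (Dz f)"
proof (rule disc_fun_eqI)
  fix n assume f: "disc_fun f"
  show "tcoeff (Dz (zmul f)) n = tcoeff (f + zmul (Dz f)) n"
    by (cases n) (simp_all add: f tcoeff_Dz tcoeff_add tcoeff_zmul disc_fun_zmul disc_fun_Dz algebra_simps)
qed (simp_all add: disc_fun_zmul disc_fun_Dz disc_fun_add)

text \<open>The Leibniz rule, with two terms only because the second derivative of z vanishes. The
  extra term is the whole obstruction to multiplication by z commuting with the maps
  \<open>Gam\<close>.\<close>

lemma Dz_funpow_zmul:
  assumes "disc_fun f"
  shows "(Dz ^^ Suc i) (zmul f) = zmul ((Dz ^^ Suc i) f) + of_nat (Suc i) *\<^sub>C (Dz ^^ i) f"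
proof (induction i)
  case 0
  thus ?case using assms by (simp add: Dz_zmul add.commute)
next
  case (Suc i)
  have "(Dz ^^ Suc (Suc i)) (zmul f) = Dz (zmul ((Dz ^^ Suc i) f) + of_nat (Suc i) *\<^sub>C (Dz ^^ i) f)"
    by (simp only: funpow.simps(2)[of "Suc i"] o_apply Suc)
  also have "\<dots> = (Dz ^^ Suc i) f + zmul ((Dz ^^ Suc (Suc i)) f) + of_nat (Suc i) *\<^sub>C (Dz ^^ Suc i) f"
    using assms disc_fun_Dz_funpow[OF assms] disc_fun_Dz_funpow[OF assms, of "Suc i"]
    by (simp add: Dz_add disc_fun_zmul disc_fun_scaleC Dz_scaleC Dz_zmul)
  also have "\<dots> = zmul ((Dz ^^ Suc (Suc i)) f) + of_nat (Suc (Suc i)) *\<^sub>C (Dz ^^ Suc i) f"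
    by (simp add: fun_eq_iff algebra_simps)
  finally show ?case .
qed

section \<open>Inequalities between the weights\<close>

lemma bwt_Suc: "\<alpha> > 0 \<Longrightarrow> bwt \<alpha> (Suc n) = bwt \<alpha> n * ((real n + 1) / (2 * \<alpha> + real n))"
  by (simp add: bwt_def pochhammer_Suc)

text \<open>(2\<alpha>)_(n+2) is evaluated by splitting off its first two or its last two factors.
  The weight for \<open>\<alpha> + 1\<close> is thus smaller by a factor of order n^(-2).\<close>

lemma bwt_shift:
  assumes "\<alpha> > 0"
  shows "bwt (\<alpha> + 1) n = bwt \<alpha> n * (2 * \<alpha> * (2 * \<alpha> + 1) / ((2 * \<alpha> + real n) * (2 * \<alpha> + real n + 1)))"
proof -
  have "pochhammer (2 * \<alpha>) (Suc (Suc n)) = 2 * \<alpha> * ((2 * \<alpha> + 1) * pochhammer (2 * (\<alpha> + 1)) n)"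
    by (simp only: pochhammer_rec) (simp add: algebra_simps)
  moreover have "pochhammer (2 * \<alpha>) (Suc (Suc n)) = pochhammer (2 * \<alpha>) n * ((2 * \<alpha> + real n) * (2 * \<alpha> + real n + 1))"
    by (simp add: pochhammer_Suc algebra_simps)
  ultimately have eq: "2 * \<alpha> * (2 * \<alpha> + 1) * pochhammer (2 * (\<alpha> + 1)) n
      = pochhammer (2 * \<alpha>) n * ((2 * \<alpha> + real n) * (2 * \<alpha> + real n + 1))"
    by (simp only: mult.assoc)
  have "bwt (\<alpha> + 1) n = fact n * (2 * \<alpha> * (2 * \<alpha> + 1)) / (2 * \<alpha> * (2 * \<alpha> + 1) * pochhammer (2 * (\<alpha> + 1)) n)"
    unfolding bwt_def using assms by (subst mult.commute) (simp add: mult_divide_mult_cancel_left)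
  also have "\<dots> = bwt \<alpha> n * (2 * \<alpha> * (2 * \<alpha> + 1) / ((2 * \<alpha> + real n) * (2 * \<alpha> + real n + 1)))"
    unfolding eq bwt_def by simp
  finally show ?thesis .
qed

lemma bwt_Suc_le:
  assumes "\<alpha> > 0"
  shows "bwt \<alpha> (Suc n) \<le> (1 + 1 / (2 * \<alpha>)) * bwt \<alpha> n"
proof -
  have "(real n + 1) / (2 * \<alpha> + real n) \<le> 1 + 1 / (2 * \<alpha>)"
    using assms by (simp add: field_simps)
  thus ?thesis
    using mult_left_mono[OF _ bwt_nonneg[OF assms, of n]] by (fastforce simp: bwt_Suc[OF assms] mult_ac)
qed

text \<open>The factor \<open>(real (Suc n))\<^sup>2\<close> produced by differentiation is absorbed
  by the smaller weight; the quotient left over, (n + 1) / (2\<alpha> + n + 1), is below 1.\<close>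

lemma bwt_shift_le:
  assumes "\<alpha> > 0"
  shows "bwt (\<alpha> + 1) n * (real (Suc n))\<^sup>2 \<le> 2 * \<alpha> * (2 * \<alpha> + 1) * bwt \<alpha> (Suc n)"
proof -
  have eq: "b * (A / (x * (x + 1))) * N\<^sup>2 = A * (b * (N / x)) * (N / (x + 1))" for b A x N :: real
    by (simp add: power2_eq_square mult_ac)
  have "bwt (\<alpha> + 1) n * (real (Suc n))\<^sup>2
      = (2 * \<alpha> * (2 * \<alpha> + 1) * bwt \<alpha> (Suc n)) * ((real n + 1) / (2 * \<alpha> + real n + 1))"
    unfolding bwt_shift[OF assms] bwt_Suc[OF assms] eq[symmetric] by (simp add: add.commute)
  also have "\<dots> \<le> (2 * \<alpha> * (2 * \<alpha> + 1) * bwt \<alpha> (Suc n)) * 1"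
    using assms by (intro mult_left_mono) (auto simp: bwt_nonneg)
  finally show ?thesis by simp
qed

text \<open>The ratio of the two weights is the product over i < k of (2\<alpha> + n + i) / (n + i +
  1), and each factor is at most (2\<alpha> + 1 + i) / (i + 1), whatever the sign of 2\<alpha> - 1.
  The product of these bounds is the k-th coefficient of (1 - x)^(-2\<alpha> - 1), hence summable
  against powers of any r < 1.\<close>

lemma bwt_le_add:
  assumes "\<alpha> > 0"
  shows "bwt \<alpha> n \<le> (1 / bwt (\<alpha> + 1/2) k) * bwt \<alpha> (n + k)"
proof (induction k)
  case (Suc k)
  define x where "x = real n + real k"
  have pos: "x \<ge> 0" "bwt (\<alpha> + 1/2) k > 0" "bwt \<alpha> (n + k) > 0"
    using assms by (auto simp: x_def bwt_pos)
  have "1 \<le> (2 * \<alpha> + 1 + real k) / (real k + 1) * ((x + 1) / (2 * \<alpha> + x))"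
  proof -
    \<comment> \<open>After clearing denominators the two sides differ by 2\<alpha>n + k +
      1.\<close>
    have "0 \<le> (2 * \<alpha>) * real n" using assms by simp
    hence "(real k + 1) * (2 * \<alpha> + x) \<le> (2 * \<alpha> + 1 + real k) * (x + 1)"
      by (simp add: x_def algebra_simps)
    moreover have "0 < (real k + 1) * (2 * \<alpha> + x)"
      using assms pos by (intro mult_pos_pos) auto
    ultimately show ?thesis
      unfolding times_divide_times_eq by (simp only: le_divide_eq_1_pos)
  qed
  hence "(1 / bwt (\<alpha> + 1/2) k * bwt \<alpha> (n + k)) * 1
      \<le> (1 / bwt (\<alpha> + 1/2) k * bwt \<alpha> (n + k)) * ((2 * \<alpha> + 1 + real k) / (real k + 1) * ((x + 1) / (2 * \<alpha> + x)))"
    using pos by (intro mult_left_mono) auto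
  also have "\<dots> = 1 / bwt (\<alpha> + 1/2) (Suc k) * bwt \<alpha> (n + Suc k)"
  proof -
    have "bwt (\<alpha> + 1/2) (Suc k) = bwt (\<alpha> + 1/2) k * ((real k + 1) / (2 * \<alpha> + 1 + real k))"
      using bwt_Suc[of "\<alpha> + 1/2" k] assms by simp
    moreover have "bwt \<alpha> (n + Suc k) = bwt \<alpha> (n + k) * ((x + 1) / (2 * \<alpha> + x))"
      using bwt_Suc[of \<alpha> "n + k"] assms by (simp add: x_def)
    ultimately show ?thesis by (simp add: mult_ac)
  qed
  finally show ?case using Suc by simp
qed simp

section \<open>Multiplication by \<open>z\<close>, differentiation and evaluation as bounded
  maps\<close>

lemma bergman_boundI:
  assumes \<alpha>: "\<alpha> > 0" and g: "disc_fun g" and K: "K \<ge> 0" and h: "h \<ge> 0"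
    and le: "\<And>N. (\<Sum>n<N. bwt \<alpha> n * (cmod (tcoeff g n))\<^sup>2) \<le> K * h\<^sup>2"
  shows "g \<in> carr (bergman \<alpha>)" "hnorm (bergman \<alpha>) g \<le> sqrt K * h"
  using bergman_memI[OF \<alpha> g, of "sqrt K * h"] le K h by (simp_all add: power_mult_distrib)

context
  fixes \<alpha> :: real
  assumes \<alpha>: "\<alpha> > 0"
begin

interpretation B: complex_hilbert_space "bergman \<alpha>"
  by (rule bergman_hilbert_space[OF \<alpha>])

lemma bergman_disc_fun: "f \<in> carr (bergman \<alpha>) \<Longrightarrow> disc_fun f"
  by (simp add: bergman_mem_iff[OF \<alpha>])

lemma bergman_zmul:
  assumes f: "f \<in> carr (bergman \<alpha>)"
  shows "zmul f \<in> carr (bergman \<alpha>)"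
    "hnorm (bergman \<alpha>) (zmul f) \<le> sqrt (1 + 1 / (2 * \<alpha>)) * hnorm (bergman \<alpha>) f"
proof (rule_tac [!] bergman_boundI[OF \<alpha>])
  note df = bergman_disc_fun[OF f]
  fix N
  \<comment> \<open>One more term is added so that the index shift leaves exactly the first
    \<open>N\<close> coefficients of \<open>f\<close>.\<close>
  have "(\<Sum>n<N. bwt \<alpha> n * (cmod (tcoeff (zmul f) n))\<^sup>2) \<le> (\<Sum>n<Suc N. bwt \<alpha> n * (cmod (tcoeff (zmul f) n))\<^sup>2)"
    by (simp add: bwt_nonneg[OF \<alpha>])
  also have "\<dots> = (\<Sum>n<N. bwt \<alpha> (Suc n) * (cmod (tcoeff f n))\<^sup>2)"
    by (simp only: sum.lessThan_Suc_shift) (simp add: tcoeff_zmul df)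
  also have "\<dots> \<le> (\<Sum>n<N. (1 + 1 / (2 * \<alpha>)) * bwt \<alpha> n * (cmod (tcoeff f n))\<^sup>2)"
    by (intro sum_mono mult_right_mono bwt_Suc_le \<alpha>) auto
  also have "\<dots> = (1 + 1 / (2 * \<alpha>)) * (\<Sum>n<N. bwt \<alpha> n * (cmod (tcoeff f n))\<^sup>2)"
    by (simp add: sum_distrib_left mult.assoc)
  also have "\<dots> \<le> (1 + 1 / (2 * \<alpha>)) * (hnorm (bergman \<alpha>) f)\<^sup>2"
    using \<alpha> by (intro mult_left_mono bergman_sum_le f) auto
  finally show "(\<Sum>n<N. bwt \<alpha> n * (cmod (tcoeff (zmul f) n))\<^sup>2) \<le> (1 + 1 / (2 * \<alpha>)) * (hnorm (bergman \<alpha>) f)\<^sup>2" .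
  thus "(\<Sum>n<N. bwt \<alpha> n * (cmod (tcoeff (zmul f) n))\<^sup>2) \<le> (1 + 1 / (2 * \<alpha>)) * (hnorm (bergman \<alpha>) f)\<^sup>2" .
qed (use \<alpha> f in \<open>simp_all add: disc_fun_zmul bergman_disc_fun\<close>)

lemma bergman_Dz:
  assumes f: "f \<in> carr (bergman \<alpha>)"
  shows "Dz f \<in> carr (bergman (\<alpha> + 1))"
    "hnorm (bergman (\<alpha> + 1)) (Dz f) \<le> sqrt (2 * \<alpha> * (2 * \<alpha> + 1)) * hnorm (bergman \<alpha>) f"
proof -
  have le: "(\<Sum>n<N. bwt (\<alpha> + 1) n * (cmod (tcoeff (Dz f) n))\<^sup>2) \<le> (2 * \<alpha> * (2 * \<alpha> + 1)) * (hnorm (bergman \<alpha>) f)\<^sup>2" for N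
  proof -
    have "(\<Sum>n<N. bwt (\<alpha> + 1) n * (cmod (tcoeff (Dz f) n))\<^sup>2)
        = (\<Sum>n<N. bwt (\<alpha> + 1) n * (real (Suc n))\<^sup>2 * (cmod (tcoeff f (Suc n)))\<^sup>2)"
      unfolding tcoeff_Dz norm_mult norm_of_nat power_mult_distrib by (simp only: mult.assoc)
    also have "\<dots> \<le> (\<Sum>n<N. 2 * \<alpha> * (2 * \<alpha> + 1) * bwt \<alpha> (Suc n) * (cmod (tcoeff f (Suc n)))\<^sup>2)"
      by (intro sum_mono mult_right_mono bwt_shift_le \<alpha>) auto
    also have "\<dots> = 2 * \<alpha> * (2 * \<alpha> + 1) * (\<Sum>n<N. bwt \<alpha> (Suc n) * (cmod (tcoeff f (Suc n)))\<^sup>2)"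
      by (simp add: sum_distrib_left mult.assoc)
    also have "(\<Sum>n<N. bwt \<alpha> (Suc n) * (cmod (tcoeff f (Suc n)))\<^sup>2) = (\<Sum>n\<in>Suc ` {..<N}. bwt \<alpha> n * (cmod (tcoeff f n))\<^sup>2)"
      by (simp add: sum.reindex)
    also have "2 * \<alpha> * (2 * \<alpha> + 1) * \<dots> \<le> 2 * \<alpha> * (2 * \<alpha> + 1) * (hnorm (bergman \<alpha>) f)\<^sup>2"
      using \<alpha> by (intro mult_left_mono bergman_sum_le f) auto
    finally show ?thesis .
  qed
  show "Dz f \<in> carr (bergman (\<alpha> + 1))"
    "hnorm (bergman (\<alpha> + 1)) (Dz f) \<le> sqrt (2 * \<alpha> * (2 * \<alpha> + 1)) * hnorm (bergman \<alpha>) f"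
    by (rule bergman_boundI[OF _ _ _ _ le];
        use \<alpha> f in \<open>simp add: disc_fun_Dz bergman_disc_fun\<close>)+
qed

lemma bergman_eval_bound:
  assumes "w \<in> unit_disc"
  shows "\<exists>C\<ge>0. \<forall>f\<in>carr (bergman \<alpha>). cmod (f w) \<le> C * hnorm (bergman \<alpha>) f"
proof -
  let ?k = "on_disc (\<lambda>z. (1 - z * cnj w) powr (- complex_of_real (2 * \<alpha>)))"
  have k: "?k \<in> carr (bergman \<alpha>)" "\<And>f. f \<in> carr (bergman \<alpha>) \<Longrightarrow> ip (bergman \<alpha>) f ?k = f w"
    using holomorphic_rkhs_bergman[OF \<alpha>] assms by (auto simp: holomorphic_rkhs_def)
  have "cmod (f w) \<le> hnorm (bergman \<alpha>) ?k * hnorm (bergman \<alpha>) f" if "f \<in> carr (bergman \<alpha>)" for f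
    using B.Cauchy_Schwarz[OF that k(1)] k(2)[OF that] by (simp add: mult.commute)
  thus ?thesis using k(1) by (intro exI[of _ "hnorm (bergman \<alpha>) ?k"]) auto
qed

lemma bergman_mon:
  shows "mon n \<in> carr (bergman \<alpha>)" "(hnorm (bergman \<alpha>) (mon n))\<^sup>2 = bwt \<alpha> n"
proof -
  have *: "(\<lambda>k. bwt \<alpha> k * (cmod (tcoeff (mon n) k))\<^sup>2) = (\<lambda>k. if k = n then bwt \<alpha> k else 0)"
    by (auto simp: tcoeff_mon)
  show mem: "mon n \<in> carr (bergman \<alpha>)"
    unfolding bergman_mem_iff[OF \<alpha>] * using disc_fun_mon by simp
  show "(hnorm (bergman \<alpha>) (mon n))\<^sup>2 = bwt \<alpha> n"
    using bergman_hnorm_sums[OF \<alpha> mem] unfolding * by (rule sums_unique2) (rule sums_single)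
qed

end

lemma bergman_Dz_funpow:
  assumes "\<alpha> > 0"
  shows "\<exists>C\<ge>0. \<forall>f\<in>carr (bergman \<alpha>). (Dz ^^ k) f \<in> carr (bergman (\<alpha> + real k)) \<and>
    hnorm (bergman (\<alpha> + real k)) ((Dz ^^ k) f) \<le> C * hnorm (bergman \<alpha>) f"
proof (induction k)
  case 0
  show ?case by (intro exI[of _ 1]) simp
next
  case (Suc k)
  then obtain C where C: "C \<ge> 0" "\<And>f. f \<in> carr (bergman \<alpha>) \<Longrightarrow> (Dz ^^ k) f \<in> carr (bergman (\<alpha> + real k))"
    "\<And>f. f \<in> carr (bergman \<alpha>) \<Longrightarrow> hnorm (bergman (\<alpha> + real k)) ((Dz ^^ k) f) \<le> C * hnorm (bergman \<alpha>) f"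
    by auto
  define \<beta> where "\<beta> = \<alpha> + real k"
  have \<beta>: "\<beta> > 0" "\<alpha> + real (Suc k) = \<beta> + 1" using assms by (auto simp: \<beta>_def)
  define E where "E = sqrt (2 * \<beta> * (2 * \<beta> + 1))"
  have "E \<ge> 0" using \<beta> by (simp add: E_def)
  have "(Dz ^^ Suc k) f \<in> carr (bergman (\<beta> + 1)) \<and>
      hnorm (bergman (\<beta> + 1)) ((Dz ^^ Suc k) f) \<le> (E * C) * hnorm (bergman \<alpha>) f"
    if f: "f \<in> carr (bergman \<alpha>)" for f
  proof
    note m = C(2)[OF f, folded \<beta>_def]
    show "(Dz ^^ Suc k) f \<in> carr (bergman (\<beta> + 1))"
      using bergman_Dz(1)[OF \<beta>(1) m] by simp
    have "hnorm (bergman (\<beta> + 1)) ((Dz ^^ Suc k) f) \<le> E * hnorm (bergman \<beta>) ((Dz ^^ k) f)"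
      using bergman_Dz(2)[OF \<beta>(1) m] by (simp add: E_def)
    also have "\<dots> \<le> E * (C * hnorm (bergman \<alpha>) f)"
      using C(3)[OF f] \<open>E \<ge> 0\<close> by (intro mult_left_mono) (auto simp: \<beta>_def)
    finally show "hnorm (bergman (\<beta> + 1)) ((Dz ^^ Suc k) f) \<le> (E * C) * hnorm (bergman \<alpha>) f"
      by (simp add: mult.assoc)
  qed
  thus ?case
    unfolding \<beta>(2) using C(1) \<open>E \<ge> 0\<close> by (intro exI[of _ "E * C"]) auto
qed

section \<open>The difference quotient\<close>

definition dq :: "complex \<Rightarrow> (complex \<Rightarrow> complex) \<Rightarrow> complex \<Rightarrow> complex" where
  "dq w f = on_disc (\<lambda>z. if z = w then deriv f w else (f z - f w) / (z - w))"

lemma disc_fun_dq: "disc_fun f \<Longrightarrow> disc_fun (dq w f)"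
  unfolding dq_def by (intro disc_fun_on_disc pole_lemma_open) (auto simp: disc_fun_def)

lemma dq_add:
  assumes "cmod w < 1" "disc_fun f" "disc_fun g"
  shows "dq w (f + g) = dq w f + dq w g"
proof -
  have "deriv (\<lambda>z. f z + g z) w = deriv f w + deriv g w"
    using assms by (intro deriv_add disc_fun_differentiable)
  thus ?thesis
    by (auto simp: dq_def on_disc_def fun_eq_iff plus_fun_def diff_divide_distrib add_divide_distrib)
qed

lemma dq_scaleC:
  assumes "cmod w < 1" "disc_fun f"
  shows "dq w (c *\<^sub>C f) = c *\<^sub>C dq w f"
proof -
  have "deriv (\<lambda>z. c * f z) w = c * deriv f w"
    using assms by (intro deriv_cmult disc_fun_differentiable)
  thus ?thesis
    by (auto simp: dq_def on_disc_def fun_eq_iff scaleC_fun_def right_diff_distrib diff_divide_distrib)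
qed

text \<open>Source of both the defect term in the Cowen--Douglas criterion and the recursion for the
  Taylor coefficients.\<close>

lemma zmul_dq:
  assumes "cmod w < 1" "disc_fun f"
  shows "zmul (dq w f) - w *\<^sub>C dq w f = f - f w *\<^sub>C mon 0"
proof
  fix z
  have "(z - w) * dq w f z = f z - f w" if "cmod z < 1"
    using that by (simp add: dq_def on_disc_def)
  moreover have "f z = 0" if "\<not> cmod z < 1"
    using that assms by (simp add: disc_fun_def)
  ultimately show "(zmul (dq w f) - w *\<^sub>C dq w f) z = (f - f w *\<^sub>C mon 0) z"
    by (auto simp: zmul_def mon_def on_disc_def dq_def algebra_simps)
qed

lemma dq_zmul:
  assumes w: "cmod w < 1" and f: "disc_fun f"
  shows "dq w (zmul f - w *\<^sub>C f) = f"
proof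
  fix z
  have eq: "zmul f - w *\<^sub>C f = (\<lambda>z. (z - w) * f z)"
    by (auto simp: zmul_def fun_eq_iff algebra_simps)
  \<comment> \<open>At \<open>z = w\<close> the quotient takes the derivative of (z - w) f(z) there,
    which by the product rule is f(w).\<close>
  have "(f has_field_derivative deriv f w) (at w)"
    using disc_fun_differentiable[OF f w] by (rule field_differentiable_derivI)
  hence "((\<lambda>z. (z - w) * f z) has_field_derivative f w) (at w)"
    by (auto intro!: derivative_eq_intros)
  hence "deriv (\<lambda>z. (z - w) * f z) w = f w"
    by (rule DERIV_imp_deriv)
  thus "dq w (zmul f - w *\<^sub>C f) z = f z"
    using f unfolding eq by (auto simp: dq_def on_disc_def disc_fun_def)
qed

text \<open>Comparison of the coefficients of degree n + 1 in \<open>zmul_dq\<close>, where the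
  constant \<open>f w\<close> does not contribute. The recursion expresses a coefficient by the next
  one, so it has to be iterated towards infinity.\<close>

lemma tcoeff_dq:
  assumes "cmod w < 1" "disc_fun f"
  shows "tcoeff (dq w f) n = tcoeff f (Suc n) + w * tcoeff (dq w f) (Suc n)"
proof -
  note g = disc_fun_dq[OF assms(2), of w]
  have "tcoeff (zmul (dq w f) - w *\<^sub>C dq w f) (Suc n) = tcoeff (f - f w *\<^sub>C mon 0) (Suc n)"
    by (simp only: zmul_dq[OF assms])
  thus ?thesis
    using g assms(2)
    by (simp add: tcoeff_diff tcoeff_scaleC disc_fun_zmul disc_fun_scaleC disc_fun_mon tcoeff_zmul tcoeff_mon diff_eq_eq)
qed

text \<open>Convexity of the square, with \<open>x + w * y\<close> read as a combination with
  weights \<open>1 - r\<close> and \<open>r\<close>. What matters is that the coefficient of the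
  last term is below 1, so that iteration contracts.\<close>

lemma norm_sq_convex:
  assumes r: "0 < r" "r < 1" and w: "cmod w \<le> r"
  shows "(cmod (x + w * y))\<^sup>2 \<le> (cmod x)\<^sup>2 / (1 - r) + r * (cmod y)\<^sup>2"
proof -
  define a b where "a = cmod x" and "b = cmod y"
  have "cmod (x + w * y) \<le> a + r * b"
    using norm_triangle_ineq[of x "w * y"] mult_right_mono[OF w, of b]
    by (simp add: norm_mult a_def b_def)
  hence "(cmod (x + w * y))\<^sup>2 \<le> (a + r * b)\<^sup>2"
    by (intro power_mono) auto
  also have "(a + r * b)\<^sup>2 * (1 - r) \<le> (a\<^sup>2 / (1 - r) + r * b\<^sup>2) * (1 - r)"
  proof -
    \<comment> \<open>The two sides of the inequality being shown differ by exactly this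
      expression.\<close>
    have "0 \<le> r * (a - (1 - r) * b)\<^sup>2" using r by simp
    moreover have "(a\<^sup>2 / (1 - r) + r * b\<^sup>2) * (1 - r) = a\<^sup>2 + r * b\<^sup>2 * (1 - r)"
      using r by (simp add: distrib_right)
    ultimately show ?thesis
      by (simp add: power2_eq_square algebra_simps)
  qed
  hence "(a + r * b)\<^sup>2 \<le> a\<^sup>2 / (1 - r) + r * b\<^sup>2"
    using r by simp
  finally show ?thesis by (simp add: a_def b_def)
qed

text \<open>The recursion for the Taylor coefficients of the difference quotient is iterated \<open>K\<close> times
  before \<open>K\<close> tends to infinity, so that only finite sums have to be interchanged.\<close>

lemma bergman_dq:
  assumes \<alpha>: "\<alpha> > 0" and w: "cmod w < 1"
  shows "\<exists>C\<ge>0. \<forall>f\<in>carr (bergman \<alpha>). dq w f \<in> carr (bergman \<alpha>) \<and>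
    hnorm (bergman \<alpha>) (dq w f) \<le> C * hnorm (bergman \<alpha>) f"
proof -
  interpret B: complex_hilbert_space "bergman \<alpha>"
    by (rule bergman_hilbert_space[OF \<alpha>])
  \<comment> \<open>All that is used is \<open>cmod w \<le> r\<close> and 0 < r < 1; positivity even
    for \<open>w = 0\<close> permits division by \<open>r\<close>.\<close>
  define r where "r = (1 + cmod w) / 2"
  have r: "0 < r" "r < 1" "cmod w \<le> r"
    using w by (auto simp: r_def add_pos_nonneg)
  \<comment> \<open>The constants of \<open>bwt_le_add\<close>, summable against powers of
    \<open>r\<close>.\<close>
  define B where "B k = 1 / bwt (\<alpha> + 1/2) k" for k
  have B_nonneg: "B k \<ge> 0" for k
    using \<alpha> by (simp add: B_def bwt_nonneg)
  have "summable (\<lambda>k. B (Suc k) * r ^ Suc k)"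
    using r unfolding B_def by (subst summable_Suc_iff) (intro summable_binomial, auto)
  hence "summable (\<lambda>k. (B (Suc k) * r ^ Suc k) / r)"
    by (rule summable_divide)
  hence summ: "summable (\<lambda>k. r ^ k * B (Suc k))"
    using r by (simp add: mult_ac)
  \<comment> \<open>The result of interchanging the sums over n and k: step k of the recursion
    contributes \<open>r ^ k\<close>, the comparison of weights \<open>B (Suc k)\<close>, and
    \<open>norm_sq_convex\<close> the division by \<open>1 - r\<close>.\<close>
  define C2 where "C2 = (\<Sum>k. r ^ k * B (Suc k)) / (1 - r)"
  have "C2 \<ge> 0"
    unfolding C2_def using r B_nonneg by (intro divide_nonneg_nonneg suminf_nonneg summ) auto
  have "dq w f \<in> carr (bergman \<alpha>) \<and> hnorm (bergman \<alpha>) (dq w f) \<le> sqrt C2 * hnorm (bergman \<alpha>) f"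
    if f: "f \<in> carr (bergman \<alpha>)" for f
  proof -
    have df: "disc_fun f" using f by (rule bergman_disc_fun[OF \<alpha>])
    define F where "F n = (cmod (tcoeff f n))\<^sup>2" for n
    define G where "G n = (cmod (tcoeff (dq w f) n))\<^sup>2" for n
    have step: "G n \<le> F (Suc n) / (1 - r) + r * G (Suc n)" for n
      unfolding F_def G_def by (subst tcoeff_dq[OF w df]) (rule norm_sq_convex[OF r])
    have iter: "G n \<le> (\<Sum>k<K. r ^ k * F (Suc (n + k))) / (1 - r) + r ^ K * G (n + K)" for n K
    proof (induction K)
      case (Suc K)
      have "r ^ K * G (n + K) \<le> r ^ K * (F (Suc (n + K)) / (1 - r) + r * G (Suc (n + K)))"
        using r by (intro mult_left_mono step) auto
      thus ?case
        using Suc by (simp add: add_divide_distrib distrib_left mult_ac)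
    qed simp
    have lim: "(\<lambda>K. r ^ K * G (n + K)) \<longlonglongrightarrow> 0" for n
    proof -
      \<comment> \<open>The Taylor series of the quotient converges at sqrt r, so its terms tend to
        0 there; their squares carry the factor \<open>r ^ K\<close>.\<close>
      have "cmod (complex_of_real (sqrt r)) < 1"
        using r by simp
      from disc_fun_sums[OF disc_fun_dq[OF df] this, of w]
      have "(\<lambda>K. tcoeff (dq w f) K * complex_of_real (sqrt r) ^ K) \<longlonglongrightarrow> 0"
        by (intro summable_LIMSEQ_zero) (rule sums_summable)
      hence "(\<lambda>K. tcoeff (dq w f) (K + n) * complex_of_real (sqrt r) ^ (K + n)) \<longlonglongrightarrow> 0"
        by (rule LIMSEQ_ignore_initial_segment)
      hence "(\<lambda>K. (cmod (tcoeff (dq w f) (K + n) * complex_of_real (sqrt r) ^ (K + n)))\<^sup>2 / r ^ n) \<longlonglongrightarrow> 0\<^sup>2 / r ^ n"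
        using r by (intro tendsto_intros tendsto_norm_zero) auto
      moreover have "(cmod (tcoeff (dq w f) (K + n) * complex_of_real (sqrt r) ^ (K + n)))\<^sup>2 / r ^ n = r ^ K * G (n + K)" for K
      proof -
        have "((sqrt r) ^ (K + n))\<^sup>2 = ((sqrt r)\<^sup>2) ^ (K + n)"
          by (simp only: power_mult[symmetric] mult.commute)
        also have "\<dots> = r ^ K * r ^ n"
          using r by (simp add: power_add)
        finally have "((sqrt r) ^ (K + n))\<^sup>2 = r ^ K * r ^ n" .
        thus ?thesis
          using r by (simp add: G_def norm_mult norm_power power_mult_distrib add.commute)
      qed
      ultimately show ?thesis by simp
    qed
    have le: "(\<Sum>n<N. bwt \<alpha> n * G n) \<le> C2 * (hnorm (bergman \<alpha>) f)\<^sup>2" for N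
    proof -
      let ?h = "(hnorm (bergman \<alpha>) f)\<^sup>2"
      \<comment> \<open>For fixed \<open>N\<close> the main term is bounded uniformly in
        \<open>K\<close>, and the remainder after \<open>K\<close> steps is a finite sum of null
        sequences.\<close>
      have "(\<Sum>n<N. bwt \<alpha> n * G n) \<le> C2 * ?h + (\<Sum>n<N. bwt \<alpha> n * (r ^ K * G (n + K)))" for K
      proof -
        have inner: "(\<Sum>n<N. bwt \<alpha> n * F (Suc (n + k))) \<le> B (Suc k) * ?h" for k
        proof -
          have "(\<Sum>n<N. bwt \<alpha> n * F (Suc (n + k))) \<le> (\<Sum>n<N. B (Suc k) * bwt \<alpha> (n + Suc k) * F (n + Suc k))"
            unfolding add_Suc_right[symmetric] B_def
            by (intro sum_mono mult_right_mono bwt_le_add \<alpha>) (simp add: F_def)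
          also have "\<dots> = B (Suc k) * (\<Sum>n\<in>(\<lambda>n. n + Suc k) ` {..<N}. bwt \<alpha> n * F n)"
            by (subst sum.reindex) (simp_all add: sum_distrib_left mult.assoc inj_on_def)
          also have "\<dots> \<le> B (Suc k) * ?h"
            unfolding F_def using B_nonneg by (intro mult_left_mono bergman_sum_le[OF \<alpha> f]) auto
          finally show ?thesis .
        qed
        have "(\<Sum>n<N. bwt \<alpha> n * G n)
            \<le> (\<Sum>n<N. bwt \<alpha> n * ((\<Sum>k<K. r ^ k * F (Suc (n + k))) / (1 - r) + r ^ K * G (n + K)))"
          by (intro sum_mono mult_left_mono iter bwt_nonneg \<alpha>)
        also have "\<dots> = (\<Sum>n<N. \<Sum>k<K. r ^ k * (bwt \<alpha> n * F (Suc (n + k)))) / (1 - r)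
            + (\<Sum>n<N. bwt \<alpha> n * (r ^ K * G (n + K)))"
          by (simp add: distrib_left sum.distrib sum_distrib_left sum_divide_distrib mult_ac)
        also have "(\<Sum>n<N. \<Sum>k<K. r ^ k * (bwt \<alpha> n * F (Suc (n + k))))
            = (\<Sum>k<K. r ^ k * (\<Sum>n<N. bwt \<alpha> n * F (Suc (n + k))))"
          by (subst sum.swap) (simp add: sum_distrib_left)
        also have "\<dots> \<le> (\<Sum>k<K. r ^ k * (B (Suc k) * ?h))"
          using r by (intro sum_mono mult_left_mono inner) auto
        also have "\<dots> = (\<Sum>k<K. r ^ k * B (Suc k)) * ?h"
          by (simp add: sum_distrib_right mult.assoc)
        also have "\<dots> \<le> (\<Sum>k. r ^ k * B (Suc k)) * ?h"
          using r B_nonneg by (intro mult_right_mono sum_le_suminf summ) auto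
        finally show ?thesis
          using r by (simp add: C2_def divide_right_mono)
      qed
      moreover have "(\<lambda>K. C2 * ?h + (\<Sum>n<N. bwt \<alpha> n * (r ^ K * G (n + K)))) \<longlonglongrightarrow> C2 * ?h + (\<Sum>n<N. bwt \<alpha> n * 0)"
        by (intro tendsto_intros lim)
      ultimately show ?thesis
        by (intro LIMSEQ_le_const[of "\<lambda>K. C2 * ?h + (\<Sum>n<N. bwt \<alpha> n * (r ^ K * G (n + K)))"]) auto
    qed
    show ?thesis
      using bergman_boundI[OF \<alpha> disc_fun_dq[OF df] \<open>C2 \<ge> 0\<close> B.hnorm_nonneg[OF f] le[unfolded G_def]]
      by blast
  qed
  thus ?thesis
    using \<open>C2 \<ge> 0\<close> by (intro exI[of _ "sqrt C2"]) auto
qed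

section \<open>Multiplication by \<open>z\<close> on normalised monomials\<close>

definition unit_mon :: "real \<Rightarrow> nat \<Rightarrow> complex \<Rightarrow> complex" where
  "unit_mon \<alpha> n = complex_of_real (sqrt (1 / bwt \<alpha> n)) *\<^sub>C mon n"

lemma disc_fun_unit_mon: "disc_fun (unit_mon \<alpha> n)"
  unfolding unit_mon_def by (intro disc_fun_scaleC disc_fun_mon)

lemma unit_mon_mem: "\<alpha> > 0 \<Longrightarrow> \<gamma> > 0 \<Longrightarrow> unit_mon \<alpha> n \<in> carr (bergman \<gamma>)"
  unfolding unit_mon_def
  by (intro complex_hilbert_space.scaleC_mem bergman_hilbert_space bergman_mon)

lemma hnorm_mon: "\<alpha> > 0 \<Longrightarrow> hnorm (bergman \<alpha>) (mon n) = sqrt (bwt \<alpha> n)"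
  by (simp add: complex_hilbert_space.hnorm_nonneg[OF bergman_hilbert_space bergman_mon(1)]
      flip: bergman_mon(2))

lemma hnorm_scaleC_mon:
  "\<alpha> > 0 \<Longrightarrow> hnorm (bergman \<alpha>) (c *\<^sub>C mon n) = cmod c * sqrt (bwt \<alpha> n)"
  by (simp only: complex_hilbert_space.hnorm_scaleC[OF bergman_hilbert_space bergman_mon(1)] hnorm_mon)

text \<open>Both functions are multiples of \<open>mon (Suc n)\<close>, and their difference has
  norm |sqrt q - 1| with \<open>q\<close> the ratio of consecutive weights, which differs from 1 by
  order 1/n.\<close>

lemma unit_mon_shift_bound:
  assumes \<alpha>: "\<alpha> > 0"
  shows "hnorm (bergman \<alpha>) (zmul (unit_mon \<alpha> n) - unit_mon \<alpha> (Suc n)) \<le> \<bar>1 - 2 * \<alpha>\<bar> / (2 * \<alpha> + real n)"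
proof -
  define q where "q = (real n + 1) / (2 * \<alpha> + real n)"
  have "q > 0" using \<alpha> by (simp add: q_def)
  define b where "b = bwt \<alpha> n"
  have b: "b > 0" "bwt \<alpha> (Suc n) = b * q"
    using \<alpha> by (simp_all add: b_def q_def bwt_pos bwt_Suc)
  have "zmul (unit_mon \<alpha> n) = complex_of_real (sqrt (1 / b)) *\<^sub>C mon (Suc n)"
    by (auto simp: unit_mon_def zmul_def mon_def on_disc_def b_def fun_eq_iff)
  hence "zmul (unit_mon \<alpha> n) - unit_mon \<alpha> (Suc n) = complex_of_real (sqrt (1 / b) - sqrt (1 / (b * q))) *\<^sub>C mon (Suc n)"
    by (simp only: unit_mon_def b(2) of_real_diff complex_vector.scale_left_diff_distrib)
  hence "hnorm (bergman \<alpha>) (zmul (unit_mon \<alpha> n) - unit_mon \<alpha> (Suc n)) = \<bar>sqrt (1 / b) - sqrt (1 / (b * q))\<bar> * sqrt (b * q)"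
    by (simp only: hnorm_scaleC_mon[OF \<alpha>] b(2) norm_of_real)
  also have "\<dots> = \<bar>(sqrt (1 / b) - sqrt (1 / (b * q))) * sqrt (b * q)\<bar>"
    using b \<open>q > 0\<close> by (simp add: abs_mult)
  also have "(sqrt (1 / b) - sqrt (1 / (b * q))) * sqrt (b * q) = sqrt q - 1"
    using b \<open>q > 0\<close> unfolding left_diff_distrib real_sqrt_mult[symmetric] by simp
  \<comment> \<open>Multiplication by sqrt q + 1, which is at least 1, rationalises the difference
    to q - 1.\<close>
  also have "\<bar>sqrt q - 1\<bar> \<le> \<bar>sqrt q - 1\<bar> * (sqrt q + 1)"
    using \<open>q > 0\<close> by (simp add: mult_le_cancel_left1 distrib_left)
  also have "\<dots> = \<bar>(sqrt q - 1) * (sqrt q + 1)\<bar>"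
    using \<open>q > 0\<close> by (simp add: abs_mult)
  also have "(sqrt q - 1) * (sqrt q + 1) = q - 1"
    using \<open>q > 0\<close> by (simp add: algebra_simps)
  also have "q - 1 = (1 - 2 * \<alpha>) / (2 * \<alpha> + real n)"
    using \<alpha> by (simp add: q_def field_simps)
  also have "\<bar>\<dots>\<bar> = \<bar>1 - 2 * \<alpha>\<bar> / (2 * \<alpha> + real n)"
    using \<alpha> by (simp add: abs_divide)
  finally show ?thesis .
qed

text \<open>The drop of the weight by order n^(-2) gives a factor 1/n in the norm. This controls the
  Leibniz remainder: having one derivative less, it reaches the target space from parameter
  \<open>\<alpha> + 1\<close>.\<close>

lemma unit_mon_weight_bound:
  assumes \<alpha>: "\<alpha> > 0"
  shows "hnorm (bergman (\<alpha> + 1)) (unit_mon \<alpha> n) \<le> sqrt (2 * \<alpha> * (2 * \<alpha> + 1)) / (2 * \<alpha> + real n)"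
proof -
  define x where "x = 2 * \<alpha> + real n"
  have x: "x > 0" using \<alpha> by (simp add: x_def)
  have "hnorm (bergman (\<alpha> + 1)) (unit_mon \<alpha> n) = sqrt (1 / bwt \<alpha> n) * sqrt (bwt (\<alpha> + 1) n)"
    using \<alpha> bwt_nonneg[OF \<alpha>, of n] unfolding unit_mon_def by (subst hnorm_scaleC_mon) auto
  also have "\<dots> = sqrt (2 * \<alpha> * (2 * \<alpha> + 1) / (x * (x + 1)))"
    unfolding real_sqrt_mult[symmetric] bwt_shift[OF \<alpha>] x_def using bwt_pos[OF \<alpha>, of n] by simp
  also have "\<dots> \<le> sqrt (2 * \<alpha> * (2 * \<alpha> + 1) / (x * x))"
    using \<alpha> x by (intro real_sqrt_le_mono divide_left_mono mult_left_mono) auto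
  also have "\<dots> = sqrt (2 * \<alpha> * (2 * \<alpha> + 1)) / x"
    using x by (simp add: real_sqrt_divide)
  finally show ?thesis by (simp add: x_def)
qed

text \<open>Since \<open>z f\<^bsup>(i)\<^esup> = (z f)\<^bsup>(i)\<^esup> - i f\<^bsup>(i-1)\<^esup>\<close>, the estimate for the \<open>i\<close>-th derivatives follows from
  the two estimates above by boundedness of differentiation.\<close>

theorem unit_mon_deriv_shift_bound:
  assumes \<alpha>: "\<alpha> > 0"
  shows "\<exists>C\<ge>0. \<forall>n. zmul ((Dz ^^ i) (unit_mon \<alpha> n)) - (Dz ^^ i) (unit_mon \<alpha> (Suc n)) \<in> carr (bergman (\<alpha> + real i)) \<and>
    hnorm (bergman (\<alpha> + real i)) (zmul ((Dz ^^ i) (unit_mon \<alpha> n)) - (Dz ^^ i) (unit_mon \<alpha> (Suc n)))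
      \<le> C / (2 * \<alpha> + real n)"
proof (cases i)
  case 0
  interpret B: complex_hilbert_space "bergman \<alpha>"
    by (rule bergman_hilbert_space[OF \<alpha>])
  show ?thesis
    unfolding 0 using unit_mon_shift_bound[OF \<alpha>] bergman_zmul(1)[OF \<alpha>] unit_mon_mem[OF \<alpha> \<alpha>]
    by (intro exI[of _ "\<bar>1 - 2 * \<alpha>\<bar>"]) auto
next
  case (Suc k)
  define \<beta> where "\<beta> = \<alpha> + real i"
  \<comment> \<open>The target parameter is reached from \<alpha> by \<open>i\<close> derivatives
    and from \<open>\<alpha> + 1\<close> by \<open>k = i - 1\<close>. The first route serves
    \<open>v\<close>, the second the Leibniz remainder.\<close>
  have \<beta>: "\<beta> > 0" "\<beta> = \<alpha> + 1 + real k" using \<alpha> by (auto simp: \<beta>_def Suc)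
  interpret B: complex_hilbert_space "bergman \<alpha>"
    by (rule bergman_hilbert_space[OF \<alpha>])
  interpret A: complex_hilbert_space "bergman \<beta>"
    by (rule bergman_hilbert_space[OF \<beta>(1)])
  obtain C where C: "C \<ge> 0" "\<And>f. f \<in> carr (bergman \<alpha>) \<Longrightarrow> (Dz ^^ i) f \<in> carr (bergman \<beta>)"
    "\<And>f. f \<in> carr (bergman \<alpha>) \<Longrightarrow> hnorm (bergman \<beta>) ((Dz ^^ i) f) \<le> C * hnorm (bergman \<alpha>) f"
    using bergman_Dz_funpow[OF \<alpha>, of i] unfolding \<beta>_def by blast
  have "\<alpha> + 1 > 0" using \<alpha> by simp
  from bergman_Dz_funpow[OF this, of k]
  obtain E where E: "E \<ge> 0" "\<And>f. f \<in> carr (bergman (\<alpha> + 1)) \<Longrightarrow> (Dz ^^ k) f \<in> carr (bergman \<beta>)"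
    "\<And>f. f \<in> carr (bergman (\<alpha> + 1)) \<Longrightarrow> hnorm (bergman \<beta>) ((Dz ^^ k) f) \<le> E * hnorm (bergman (\<alpha> + 1)) f"
    unfolding \<beta>(2) by blast
  define c1 where "c1 = C * \<bar>1 - 2 * \<alpha>\<bar>"
  define c2 where "c2 = real i * (E * sqrt (2 * \<alpha> * (2 * \<alpha> + 1)))"
  have "zmul ((Dz ^^ i) (unit_mon \<alpha> n)) - (Dz ^^ i) (unit_mon \<alpha> (Suc n)) \<in> carr (bergman \<beta>) \<and>
    hnorm (bergman \<beta>) (zmul ((Dz ^^ i) (unit_mon \<alpha> n)) - (Dz ^^ i) (unit_mon \<alpha> (Suc n)))
      \<le> (c1 + c2) / (2 * \<alpha> + real n)" for n
  proof -
    define u where "u = unit_mon \<alpha> n"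
    define v where "v = zmul u - unit_mon \<alpha> (Suc n)"
    have u: "u \<in> carr (bergman \<alpha>)" "u \<in> carr (bergman (\<alpha> + 1))"
      using \<alpha> by (simp_all add: u_def unit_mon_mem)
    have v: "v \<in> carr (bergman \<alpha>)"
      using u by (simp add: v_def unit_mon_mem \<alpha> bergman_zmul(1)[OF \<alpha>])
    have du: "disc_fun u" by (simp add: u_def disc_fun_unit_mon)
    have "(Dz ^^ i) v = (Dz ^^ i) (zmul u) - (Dz ^^ i) (unit_mon \<alpha> (Suc n))"
      unfolding v_def by (intro Dz_funpow_diff disc_fun_zmul du disc_fun_unit_mon)
    also have "(Dz ^^ i) (zmul u) = zmul ((Dz ^^ i) u) + of_nat i *\<^sub>C (Dz ^^ k) u"
      unfolding Suc by (rule Dz_funpow_zmul[OF du])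
    finally have split: "(Dz ^^ i) v = zmul ((Dz ^^ i) u) + of_nat i *\<^sub>C (Dz ^^ k) u - (Dz ^^ i) (unit_mon \<alpha> (Suc n))" .
    have eq: "zmul ((Dz ^^ i) u) - (Dz ^^ i) (unit_mon \<alpha> (Suc n)) = (Dz ^^ i) v - of_nat i *\<^sub>C (Dz ^^ k) u"
      unfolding split by (simp only: fun_eq_iff minus_apply plus_fun_apply) simp
    have n1: "hnorm (bergman \<beta>) ((Dz ^^ i) v - of_nat i *\<^sub>C (Dz ^^ k) u)
        \<le> hnorm (bergman \<beta>) ((Dz ^^ i) v) + hnorm (bergman \<beta>) (of_nat i *\<^sub>C (Dz ^^ k) u)"
      by (intro A.hnorm_diff_le A.scaleC_mem C(2) E(2) u v)
    have n2: "hnorm (bergman \<beta>) (of_nat i *\<^sub>C (Dz ^^ k) u) = real i * hnorm (bergman \<beta>) ((Dz ^^ k) u)"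
      by (simp add: A.hnorm_scaleC[OF E(2)[OF u(2)]])
    have "hnorm (bergman \<beta>) ((Dz ^^ k) u) \<le> E * (sqrt (2 * \<alpha> * (2 * \<alpha> + 1)) / (2 * \<alpha> + real n))"
      using E(3)[OF u(2)] mult_left_mono[OF unit_mon_weight_bound[OF \<alpha>, of n, folded u_def] E(1)] by linarith
    hence n3: "real i * hnorm (bergman \<beta>) ((Dz ^^ k) u) \<le> real i * (E * (sqrt (2 * \<alpha> * (2 * \<alpha> + 1)) / (2 * \<alpha> + real n)))"
      by (rule mult_left_mono) simp
    have n4: "hnorm (bergman \<beta>) ((Dz ^^ i) v) \<le> C * (\<bar>1 - 2 * \<alpha>\<bar> / (2 * \<alpha> + real n))"
      using C(3)[OF v] mult_left_mono[OF unit_mon_shift_bound[OF \<alpha>, of n, folded u_def, folded v_def] C(1)] by linarith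
    have "C * (\<bar>1 - 2 * \<alpha>\<bar> / (2 * \<alpha> + real n)) + real i * (E * (sqrt (2 * \<alpha> * (2 * \<alpha> + 1)) / (2 * \<alpha> + real n)))
        = (c1 + c2) / (2 * \<alpha> + real n)"
      by (simp add: c1_def c2_def add_divide_distrib)
    with n1 n2 n3 n4 have "hnorm (bergman \<beta>) ((Dz ^^ i) v - of_nat i *\<^sub>C (Dz ^^ k) u) \<le> (c1 + c2) / (2 * \<alpha> + real n)"
      by linarith
    thus ?thesis
      using A.diff_mem[OF C(2)[OF v] A.scaleC_mem[OF E(2)[OF u(2)], of "of_nat i"]]
      unfolding eq[unfolded u_def] u_def by blast
  qed
  moreover have "c1 + c2 \<ge> 0"
    using C(1) E(1) \<alpha> by (simp add: c1_def c2_def)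
  ultimately show ?thesis
    unfolding \<beta>_def by blast
qed

subsection \<open>The spaces of vector-valued functions\<close>

lemma sum_fun_apply: "(\<Sum>i\<in>A. f i) x = (\<Sum>i\<in>A. f i x)"
  by (induction A rule: infinite_finite_induct) auto

lemma disc_fun_zero: "disc_fun 0"
  by (simp add: disc_fun_def zero_fun_def)

text \<open>Pairs \<open>(j, n)\<close> with \<open>j \<le> m\<close> form finitely many disjoint
  sequences, so summation over pairs reduces to summation in \<open>n\<close>.\<close>

lemma
  fixes f :: "nat \<times> 'i \<Rightarrow> 'b::{topological_comm_monoid_add, t2_space}"
  assumes slices: "\<And>j. j \<le> m \<Longrightarrow> (\<lambda>n. f (j, n)) summable_on UNIV"
    and zero: "\<And>p. fst p > m \<Longrightarrow> f p = 0"
  shows summable_on_slices: "f summable_on UNIV"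
    and infsum_slices: "infsum f UNIV = (\<Sum>j\<le>m. \<Sum>\<^sub>\<infinity>n. f (j, n))"
proof -
  let ?B = "\<lambda>j::nat. Pair j ` (UNIV :: 'i set)"
  have inj: "inj_on (Pair j) UNIV" for j :: nat
    by (auto simp: inj_on_def)
  have slice: "f summable_on ?B j" if "j \<in> {..m}" for j
    using slices that by (subst summable_on_reindex[OF inj]) (simp add: o_def)
  have disj: "?B j \<inter> ?B j' = {}" if "j \<noteq> j'" for j j'
    using that by auto
  have union: "(\<Union>j\<in>{..m}. ?B j) = {..m} \<times> UNIV"
    by auto
  have zero': "f p = 0" if "p \<notin> {..m} \<times> UNIV" for p
    using zero[of p] that by (cases p) auto
  have "f summable_on ({..m} \<times> UNIV)"
    unfolding union[symmetric] by (rule summable_on_finite_union_disjoint) (use slice disj in auto)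
  also have "f summable_on ({..m} \<times> UNIV) \<longleftrightarrow> f summable_on UNIV"
    by (rule summable_on_cong_neutral) (use zero' in blast)+
  finally show "f summable_on UNIV" .
  have "infsum f UNIV = infsum f ({..m} \<times> UNIV)"
    by (rule infsum_cong_neutral) (use zero' in blast)+
  also have "\<dots> = (\<Sum>j\<le>m. infsum f (?B j))"
    unfolding union[symmetric] by (rule sum_infsum[symmetric]) (use slice disj in auto)
  also have "\<dots> = (\<Sum>j\<le>m. \<Sum>\<^sub>\<infinity>n. f (j, n))"
    by (intro sum.cong refl) (simp add: infsum_reindex[OF inj] o_def)
  finally show "infsum f UNIV = (\<Sum>j\<le>m. \<Sum>\<^sub>\<infinity>n. f (j, n))" .
qed

lemma ell2_slice:
  assumes "a \<in> carr (ell2 I)"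
  shows "(\<lambda>n. a (j, n)) \<in> carr (ell2 UNIV)"
proof -
  have inj: "inj_on (Pair j) UNIV" by (auto simp: inj_on_def)
  have "(\<lambda>p. (cmod (a p))\<^sup>2) summable_on (range (Pair j))"
    by (rule summable_on_subset_banach[OF ell2_summable[OF assms]]) simp
  thus ?thesis
    unfolding summable_on_reindex[OF inj] by (simp add: ell2_mem_iff o_def)
qed

text \<open>The inverse image is chosen in the carrier, where \<open>\<Phi>\<close> is injective
  because it preserves norms.\<close>

lemma unitary_conjugate:
  assumes H: "complex_hilbert_space H" and \<Phi>: "unitary H K \<Phi>" and T: "bounded_operator H T"
  defines "T' \<equiv> \<lambda>y. \<Phi> (T (inv_into (carr H) \<Phi> y))"
  shows "bounded_operator K T'" "\<And>x. x \<in> carr H \<Longrightarrow> T' (\<Phi> x) = \<Phi> (T x)"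
proof -
  interpret complex_hilbert_space H by (rule H)
  note [simp] = bounded_operator_mem[OF T] bounded_operator_add[OF T] bounded_operator_scale[OF T]
  have "inj_on \<Phi> (carr H)"
  proof (rule inj_onI)
    fix x y assume "x \<in> carr H" "y \<in> carr H" "\<Phi> x = \<Phi> y"
    hence "hnorm H (x - y) = hnorm K 0" "hnorm K 0 = 0"
      using unitary_hnorm[OF \<Phi>, of "x - y"] unitary_diff[OF \<Phi>, of x y] unitary_hnorm[OF \<Phi>, of 0]
        unitary_zero[OF \<Phi>] by simp_all
    thus "x = y"
      using \<open>x \<in> carr H\<close> \<open>y \<in> carr H\<close> hnorm_eq_0[of "x - y"] by simp
  qed
  thus *: "T' (\<Phi> x) = \<Phi> (T x)" if "x \<in> carr H" for x
    using that by (simp add: T'_def)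
  obtain C where C: "\<And>x. x \<in> carr H \<Longrightarrow> hnorm H (T x) \<le> C * hnorm H x"
    using bounded_operator_bound[OF T] by metis
  have bd: "hnorm K (T' (\<Phi> x)) \<le> C * hnorm K (\<Phi> x)" if "x \<in> carr H" for x
    using C[OF that] that by (simp add: * unitary_hnorm[OF \<Phi>])
  have add: "T' (\<Phi> x + \<Phi> y) = T' (\<Phi> x) + T' (\<Phi> y)" if "x \<in> carr H" "y \<in> carr H" for x y
    using *[of "x + y"] that by (simp add: * unitary_add[OF \<Phi>])
  have scale: "T' (c *\<^sub>C \<Phi> x) = c *\<^sub>C T' (\<Phi> x)" if "x \<in> carr H" for c x
    using *[of "c *\<^sub>C x"] that by (simp add: * unitary_scale[OF \<Phi>])
  show "bounded_operator K T'"
    unfolding bounded_operator_def unitary_carr[OF \<Phi>]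
    by (intro conjI exI[of _ C]) (use bd add scale in \<open>auto simp: *\<close>)
qed

lemma lam_idx_add: "j \<le> l \<Longrightarrow> lam_idx m lam l = lam_idx m lam j + real (l - j)"
  by (simp add: lam_idx_def field_simps of_nat_diff)

text \<open>The scalar factor in row \<open>l\<close>, column \<open>j\<close> of the triangular
  matrix of differential operators underlying \<open>Gam_sum\<close>; the derivative of order
  \<open>l - j\<close> is kept separate.\<close>

definition gcoef :: "nat \<Rightarrow> real \<Rightarrow> nat \<Rightarrow> nat \<Rightarrow> complex" where
  "gcoef m lam j l = of_nat (l choose j) * (1 / complex_of_real (pochhammer (2 * lam_idx m lam j) (l - j)))"

lemma gcoef_self [simp]: "gcoef m lam j j = 1"
  by (simp add: gcoef_def)

definition component :: "(complex \<Rightarrow> nat \<Rightarrow> complex) \<Rightarrow> nat \<Rightarrow> complex \<Rightarrow> complex" where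
  "component F l = (\<lambda>z. F z l)"

lemma component_add: "component (F + G) l = component F l + component G l"
  and component_diff: "component (F - G) l = component F l - component G l"
  and component_scaleC: "component (c *\<^sub>C F) l = c *\<^sub>C component F l"
  by (auto simp: component_def)

lemma component_eqI: "(\<And>l. component F l = component G l) \<Longrightarrow> F = G"
  by (auto simp: component_def fun_eq_iff)

lemma component_Gam:
  assumes "disc_fun f"
  shows "component (Gam m lam j f) l = (if j \<le> l \<and> l \<le> m then gcoef m lam j l *\<^sub>C (Dz ^^ (l - j)) f else 0)"
proof
  fix z
  have "disc_fun ((Dz ^^ (l - j)) f)" by (rule disc_fun_Dz_funpow[OF assms])
  thus "component (Gam m lam j f) l z = (if j \<le> l \<and> l \<le> m then gcoef m lam j l *\<^sub>C (Dz ^^ (l - j)) f else 0) z"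
    using Dz_funpow_eq[of z "l - j" f]
    by (cases "z \<in> unit_disc") (auto simp: component_def Gam_def on_disc_def gcoef_def disc_fun_def)
qed

section \<open>The space \<open>A_space\<close> and its orthonormal coordinates\<close>

locale A_setting =
  fixes m :: nat and lam :: real and mu :: "nat \<Rightarrow> real"
  assumes lam: "lam > real m / 2" and mu_pos: "\<And>j. j \<le> m \<Longrightarrow> mu j > 0"
begin

abbreviation L :: "nat \<Rightarrow> real" where "L \<equiv> lam_idx m lam"
abbreviation B :: "nat \<Rightarrow> (complex \<Rightarrow> complex) hilb" where "B l \<equiv> bergman (L l)"
abbreviation A :: "(complex \<Rightarrow> nat \<Rightarrow> complex) hilb" where "A \<equiv> A_space m lam mu"
abbreviation \<kappa> :: "nat \<Rightarrow> nat \<Rightarrow> complex" where "\<kappa> \<equiv> gcoef m lam"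

lemma L_pos: "L j > 0"
  using lam by (simp add: lam_idx_def)

sublocale B: complex_hilbert_space "B l" for l
  by (rule bergman_hilbert_space[OF L_pos])

lemma B_disc_fun: "f \<in> carr (B l) \<Longrightarrow> disc_fun f"
  by (rule bergman_disc_fun[OF L_pos])

lemma components_iff: "f \<in> components m lam \<longleftrightarrow> (\<forall>j\<le>m. f j \<in> carr (B j))"
  by (simp add: components_def weighted_bergman_eq L_pos)

lemma components_disc_fun: "f \<in> components m lam \<Longrightarrow> j \<le> m \<Longrightarrow> disc_fun (f j)"
  using B_disc_fun by (auto simp: components_iff)

lemma component_Gam_sum:
  assumes "\<And>j. j \<le> m \<Longrightarrow> disc_fun (f j)"
  shows "component (Gam_sum m lam f) l = (if l \<le> m then \<Sum>j\<le>l. \<kappa> j l *\<^sub>C (Dz ^^ (l - j)) (f j) else 0)"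
proof -
  have "component (Gam_sum m lam f) l = (\<Sum>j\<le>m. component (Gam m lam j (f j)) l)"
    by (auto simp: Gam_sum_def component_def sum_fun_apply)
  also have "\<dots> = (\<Sum>j\<le>m. if j \<le> l \<and> l \<le> m then \<kappa> j l *\<^sub>C (Dz ^^ (l - j)) (f j) else 0)"
    using assms by (intro sum.cong refl component_Gam) auto
  also have "\<dots> = (if l \<le> m then \<Sum>j\<le>l. \<kappa> j l *\<^sub>C (Dz ^^ (l - j)) (f j) else 0)"
  proof (cases "l \<le> m")
    case True
    have "(\<Sum>j\<le>m. if j \<le> l then \<kappa> j l *\<^sub>C (Dz ^^ (l - j)) (f j) else 0)
        = (\<Sum>j\<in>{j\<in>{..m}. j \<le> l}. \<kappa> j l *\<^sub>C (Dz ^^ (l - j)) (f j))"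
      by (rule sum.inter_filter[symmetric]) simp
    also have "{j\<in>{..m}. j \<le> l} = {..l}" using True by auto
    finally show ?thesis using True by (simp only: simp_thms if_True)
  qed simp
  finally show ?thesis .
qed

lemma component_Gam_sum':
  assumes "f \<in> components m lam"
  shows "component (Gam_sum m lam f) l = (if l \<le> m then \<Sum>j\<le>l. \<kappa> j l *\<^sub>C (Dz ^^ (l - j)) (f j) else 0)"
  by (rule component_Gam_sum) (rule components_disc_fun[OF assms])

lemma Gam_sum_add:
  assumes "f \<in> components m lam" "g \<in> components m lam"
  shows "Gam_sum m lam (\<lambda>j. f j + g j) = Gam_sum m lam f + Gam_sum m lam g"
proof (rule component_eqI)
  fix l
  show "component (Gam_sum m lam (\<lambda>j. f j + g j)) l = component (Gam_sum m lam f + Gam_sum m lam g) l"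
    unfolding component_add using assms
    by (simp add: component_Gam_sum components_disc_fun disc_fun_add Dz_funpow_add
        complex_vector.scale_right_distrib sum.distrib)
qed

lemma Gam_sum_scaleC:
  assumes "f \<in> components m lam"
  shows "Gam_sum m lam (\<lambda>j. c *\<^sub>C f j) = c *\<^sub>C Gam_sum m lam f"
proof (rule component_eqI)
  fix l
  have "(\<Sum>j\<le>l. \<kappa> j l *\<^sub>C (Dz ^^ (l - j)) (c *\<^sub>C f j)) = c *\<^sub>C (\<Sum>j\<le>l. \<kappa> j l *\<^sub>C (Dz ^^ (l - j)) (f j))" if "l \<le> m"
    unfolding complex_vector.scale_sum_right using assms that
    by (intro sum.cong refl)
       (simp only: Dz_funpow_scaleC[OF components_disc_fun] atMost_iff complex_vector.scale_left_commute le_trans)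
  thus "component (Gam_sum m lam (\<lambda>j. c *\<^sub>C f j)) l = component (c *\<^sub>C Gam_sum m lam f) l"
    unfolding component_scaleC using assms
    by (simp only: component_Gam_sum components_disc_fun disc_fun_scaleC) auto
qed

lemma Gam_sum_cong: "(\<And>j. j \<le> m \<Longrightarrow> f j = g j) \<Longrightarrow> Gam_sum m lam f = Gam_sum m lam g"
  by (simp add: Gam_sum_def)

text \<open>Row \<open>l\<close> of the triangular system contains \<open>f l\<close> with
  coefficient 1 and otherwise only \<open>f j\<close> with \<open>j < l\<close>, so induction
  determines \<open>f l\<close>. This makes the inner product of \<open>A_space\<close> well
  defined.\<close>

lemma Gam_sum_inj:
  assumes f: "f \<in> components m lam" and g: "g \<in> components m lam"
    and eq: "Gam_sum m lam f = Gam_sum m lam g" and "l \<le> m"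
  shows "f l = g l"
  using \<open>l \<le> m\<close>
proof (induction l rule: less_induct)
  case (less l)
  have split: "(\<Sum>j\<le>l. h j) = h l + (\<Sum>j<l. h j)" for h :: "nat \<Rightarrow> complex \<Rightarrow> complex"
    by (simp add: add.commute flip: lessThan_Suc_atMost)
  have "component (Gam_sum m lam f) l = component (Gam_sum m lam g) l"
    using eq by simp
  hence "(\<Sum>j\<le>l. \<kappa> j l *\<^sub>C (Dz ^^ (l - j)) (f j)) = (\<Sum>j\<le>l. \<kappa> j l *\<^sub>C (Dz ^^ (l - j)) (g j))"
    using less.prems f g by (simp add: component_Gam_sum components_disc_fun)
  moreover have "(\<Sum>j<l. \<kappa> j l *\<^sub>C (Dz ^^ (l - j)) (f j)) = (\<Sum>j<l. \<kappa> j l *\<^sub>C (Dz ^^ (l - j)) (g j))"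
    using less by (intro sum.cong) auto
  ultimately show "f l = g l"
    unfolding split by simp
qed

lemma A_carr: "carr A = Gam_sum m lam ` components m lam"
  by (simp add: A_space_def)

lemma A_ip:
  assumes f: "f \<in> components m lam" and g: "g \<in> components m lam"
  shows "ip A (Gam_sum m lam f) (Gam_sum m lam g)
    = (\<Sum>j\<le>m. complex_of_real (1 / (mu j)\<^sup>2) * ip (B j) (f j) (g j))"
proof -
  have wb: "weighted_bergman (L j) = B j" for j
    by (simp add: weighted_bergman_eq L_pos)
  show ?thesis
    unfolding A_space_def hilb.select_convs wb
  proof (rule the_equality)
    fix c assume "\<exists>f'\<in>components m lam. \<exists>g'\<in>components m lam.
      Gam_sum m lam f = Gam_sum m lam f' \<and> Gam_sum m lam g = Gam_sum m lam g' \<and>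
      c = (\<Sum>j\<le>m. complex_of_real (1 / (mu j)\<^sup>2) * ip (B j) (f' j) (g' j))"
    then obtain f' g' where fg: "f' \<in> components m lam" "g' \<in> components m lam"
      "Gam_sum m lam f = Gam_sum m lam f'" "Gam_sum m lam g = Gam_sum m lam g'"
      "c = (\<Sum>j\<le>m. complex_of_real (1 / (mu j)\<^sup>2) * ip (B j) (f' j) (g' j))" by blast
    show "c = (\<Sum>j\<le>m. complex_of_real (1 / (mu j)\<^sup>2) * ip (B j) (f j) (g j))"
      unfolding fg(5) using Gam_sum_inj[OF f fg(1,3)] Gam_sum_inj[OF g fg(2,4)]
      by (intro sum.cong refl) simp
  qed (use f g in blast)
qed

definition I :: "(nat \<times> nat) set" where "I = {..m} \<times> UNIV"

text \<open>The coordinate map of the basis in the statement: for \<open>j \<le> m\<close> the unit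
  family at \<open>(j, n)\<close> goes to \<open>mu j\<close> times
  \<open>e_vec m lam j n\<close>.\<close>

definition \<Psi> :: "(nat \<times> nat \<Rightarrow> complex) \<Rightarrow> complex \<Rightarrow> nat \<Rightarrow> complex" where
  "\<Psi> a = Gam_sum m lam (\<lambda>j. complex_of_real (mu j) *\<^sub>C bfun (L j) (\<lambda>n. a (j, n)))"

lemma bfun_mem: "a \<in> carr (ell2 UNIV) \<Longrightarrow> bfun (L j) a \<in> carr (B j)"
  by (simp add: bergman_def)

lemma \<Psi>_components:
  "a \<in> carr (ell2 I) \<Longrightarrow> (\<lambda>j. complex_of_real (mu j) *\<^sub>C bfun (L j) (\<lambda>n. a (j, n))) \<in> components m lam"
  by (simp add: components_iff B.scaleC_mem bfun_mem ell2_slice)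

lemma unitary_\<Psi>: "unitary (ell2 I) A \<Psi>"
  unfolding unitary_def
proof (intro conjI ballI allI)
  note E = ell2_hilbert_space
  note bf = unitary_bfun[OF L_pos]
  note bf_add = complex_hilbert_space.unitary_add[OF E bf]
    and bf_scale = complex_hilbert_space.unitary_scale[OF E bf]
    and bf_ip = complex_hilbert_space.unitary_ip[OF E bf]
  have "\<Psi> a \<in> carr A" if "a \<in> carr (ell2 I)" for a
    unfolding A_carr \<Psi>_def using \<Psi>_components[OF that] by blast
  moreover have "F \<in> \<Psi> ` carr (ell2 I)" if F: "F \<in> carr A" for F
  proof -
    obtain f where f: "f \<in> components m lam" "F = Gam_sum m lam f"
      using F unfolding A_carr by blast
    have "\<exists>b. b \<in> carr (ell2 UNIV) \<and> f j = bfun (L j) b" if "j \<le> m" for j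
      using f(1) that by (auto simp: components_iff bergman_def)
    then obtain b where b: "\<And>j. j \<le> m \<Longrightarrow> b j \<in> carr (ell2 UNIV)" "\<And>j. j \<le> m \<Longrightarrow> f j = bfun (L j) (b j)"
      by metis
    \<comment> \<open>The preimage of \<open>F\<close>; the factor \<open>mu j\<close> built into
      \<Psi> has to be divided out.\<close>
    define a where "a p = (if fst p \<le> m then complex_of_real (1 / mu (fst p)) * b (fst p) (snd p) else 0)" for p
    have slice: "(\<lambda>n. a (j, n)) = complex_of_real (1 / mu j) *\<^sub>C b j" if "j \<le> m" for j
      using that by (auto simp: a_def)
    have slice_mem: "(\<lambda>n. a (j, n)) \<in> carr (ell2 UNIV)" if "j \<le> m" for j
      unfolding slice[OF that] by (intro complex_hilbert_space.scaleC_mem[OF E] b that)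
    have "(\<lambda>p. (cmod (a p))\<^sup>2) summable_on UNIV"
    proof (rule summable_on_slices[of m])
      show "(\<lambda>n. (cmod (a (j, n)))\<^sup>2) summable_on UNIV" if "j \<le> m" for j
        by (rule ell2_summable[OF slice_mem[OF that]])
    qed (auto simp: a_def)
    hence "a \<in> carr (ell2 I)"
      by (auto simp: ell2_mem_iff I_def a_def)
    moreover have "\<Psi> a = F"
      unfolding \<Psi>_def f(2)
    proof (rule Gam_sum_cong)
      fix j assume j: "j \<le> m"
      show "complex_of_real (mu j) *\<^sub>C bfun (L j) (\<lambda>n. a (j, n)) = f j"
        unfolding slice[OF j] bf_scale[OF b(1)[OF j]] b(2)[OF j] using mu_pos[OF j]
        by (simp add: complex_vector.scale_scale flip: of_real_mult)
    qed
    ultimately show ?thesis by blast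
  qed
  ultimately show "carr A = \<Psi> ` carr (ell2 I)" by blast
  fix a b :: "nat \<times> nat \<Rightarrow> complex" and c
  assume a: "a \<in> carr (ell2 I)"
  {
    assume b: "b \<in> carr (ell2 I)"
    have "\<Psi> (a + b) = Gam_sum m lam (\<lambda>j. complex_of_real (mu j) *\<^sub>C bfun (L j) (\<lambda>n. a (j, n))
        + complex_of_real (mu j) *\<^sub>C bfun (L j) (\<lambda>n. b (j, n)))"
      unfolding \<Psi>_def
    proof (rule Gam_sum_cong)
      fix j
      have "(\<lambda>n. (a + b) (j, n)) = (\<lambda>n. a (j, n)) + (\<lambda>n. b (j, n))" by auto
      thus "complex_of_real (mu j) *\<^sub>C bfun (L j) (\<lambda>n. (a + b) (j, n))
        = complex_of_real (mu j) *\<^sub>C bfun (L j) (\<lambda>n. a (j, n)) + complex_of_real (mu j) *\<^sub>C bfun (L j) (\<lambda>n. b (j, n))"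
        by (simp only: bf_add[OF ell2_slice[OF a] ell2_slice[OF b]] complex_vector.scale_right_distrib)
    qed
    also have "\<dots> = \<Psi> a + \<Psi> b"
      unfolding \<Psi>_def by (rule Gam_sum_add[OF \<Psi>_components[OF a] \<Psi>_components[OF b]])
    finally show "\<Psi> (a + b) = \<Psi> a + \<Psi> b" .
    have "ip A (\<Psi> a) (\<Psi> b) = (\<Sum>j\<le>m. complex_of_real (1 / (mu j)\<^sup>2) *
        ip (B j) (complex_of_real (mu j) *\<^sub>C bfun (L j) (\<lambda>n. a (j, n))) (complex_of_real (mu j) *\<^sub>C bfun (L j) (\<lambda>n. b (j, n))))"
      unfolding \<Psi>_def by (rule A_ip[OF \<Psi>_components[OF a] \<Psi>_components[OF b]])
    also have "\<dots> = (\<Sum>j\<le>m. \<Sum>\<^sub>\<infinity>n. a (j, n) * cnj (b (j, n)))"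
    proof (rule sum.cong[OF refl])
      fix j assume "j \<in> {..m}"
      hence j: "complex_of_real (1 / (mu j)\<^sup>2) * (complex_of_real (mu j) * complex_of_real (mu j)) = 1"
        using mu_pos[of j] unfolding of_real_mult[symmetric] by (simp add: power2_eq_square)
      have "ip (B j) (complex_of_real (mu j) *\<^sub>C bfun (L j) (\<lambda>n. a (j, n))) (complex_of_real (mu j) *\<^sub>C bfun (L j) (\<lambda>n. b (j, n)))
          = complex_of_real (mu j) * complex_of_real (mu j) * (\<Sum>\<^sub>\<infinity>n. a (j, n) * cnj (b (j, n)))"
        by (simp add: B.ip_scaleC_left B.ip_scaleC_right B.scaleC_mem bfun_mem[OF ell2_slice[OF a]] bfun_mem[OF ell2_slice[OF b]]
            bf_ip[OF ell2_slice[OF a] ell2_slice[OF b]] ell2_ip)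
      thus "complex_of_real (1 / (mu j)\<^sup>2) *
          ip (B j) (complex_of_real (mu j) *\<^sub>C bfun (L j) (\<lambda>n. a (j, n))) (complex_of_real (mu j) *\<^sub>C bfun (L j) (\<lambda>n. b (j, n)))
        = (\<Sum>\<^sub>\<infinity>n. a (j, n) * cnj (b (j, n)))"
        using j by (simp only: mult.assoc[symmetric]) simp
    qed
    also have "\<dots> = ip (ell2 I) a b"
      unfolding ell2_ip
    proof (rule infsum_slices[symmetric])
      show "(\<lambda>n. a (j, n) * cnj (b (j, n))) summable_on UNIV" for j
        by (rule ell2_summable_prod[OF ell2_slice[OF a] ell2_slice[OF b]])
      show "a p * cnj (b p) = 0" if "fst p > m" for p
        using a that by (cases p) (auto simp: ell2_mem_iff I_def)
    qed
    finally show "ip A (\<Psi> a) (\<Psi> b) = ip (ell2 I) a b" .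
  }
  have "\<Psi> (c *\<^sub>C a) = Gam_sum m lam (\<lambda>j. c *\<^sub>C (complex_of_real (mu j) *\<^sub>C bfun (L j) (\<lambda>n. a (j, n))))"
    unfolding \<Psi>_def
  proof (rule Gam_sum_cong)
    fix j
    have "(\<lambda>n. (c *\<^sub>C a) (j, n)) = c *\<^sub>C (\<lambda>n. a (j, n))" by auto
    thus "complex_of_real (mu j) *\<^sub>C bfun (L j) (\<lambda>n. (c *\<^sub>C a) (j, n))
      = c *\<^sub>C (complex_of_real (mu j) *\<^sub>C bfun (L j) (\<lambda>n. a (j, n)))"
      by (simp only: bf_scale[OF ell2_slice[OF a]] complex_vector.scale_left_commute)
  qed
  also have "\<dots> = c *\<^sub>C \<Psi> a"
    unfolding \<Psi>_def by (rule Gam_sum_scaleC[OF \<Psi>_components[OF a]])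
  finally show "\<Psi> (c *\<^sub>C a) = c *\<^sub>C \<Psi> a" .
qed

sublocale A: complex_hilbert_space A
  by (rule complex_hilbert_space.unitary_hilbert_space[OF ell2_hilbert_space unitary_\<Psi>])

end

section \<open>Equivalence of the norm of \<open>A_space\<close> with the norms of the
  components\<close>

lemma sum_squares_le_square_sum:
  fixes x :: "'a \<Rightarrow> real"
  assumes "finite S" "\<And>i. i \<in> S \<Longrightarrow> 0 \<le> x i"
  shows "(\<Sum>i\<in>S. (x i)\<^sup>2) \<le> (\<Sum>i\<in>S. x i)\<^sup>2"
  using assms
proof (induction S rule: finite_induct)
  case (insert i S)
  have "0 \<le> 2 * x i * sum x S"
    using insert by (intro mult_nonneg_nonneg sum_nonneg) auto
  moreover have "(\<Sum>i\<in>S. (x i)\<^sup>2) \<le> (sum x S)\<^sup>2"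
    using insert by simp
  ultimately show ?case
    using insert.hyps by (simp add: power2_sum)
qed simp

context A_setting
begin

lemma A_hnorm_sq:
  assumes f: "f \<in> components m lam"
  shows "(hnorm A (Gam_sum m lam f))\<^sup>2 = (\<Sum>j\<le>m. (hnorm (B j) (f j) / mu j)\<^sup>2)"
proof -
  have "Gam_sum m lam f \<in> carr A" using f by (auto simp: A_carr)
  hence "(hnorm A (Gam_sum m lam f))\<^sup>2 = Re (\<Sum>j\<le>m. complex_of_real (1 / (mu j)\<^sup>2) * ip (B j) (f j) (f j))"
    by (simp only: A.hnorm_sq A_ip[OF f f])
  also have "\<dots> = (\<Sum>j\<le>m. (hnorm (B j) (f j) / mu j)\<^sup>2)"
    unfolding Re_sum using f
    by (intro sum.cong refl) (simp add: components_iff B.ip_self power_divide flip: of_real_mult of_real_power of_real_divide)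
  finally show ?thesis .
qed

lemma component_hnorm_le:
  assumes f: "f \<in> components m lam" and j: "j \<le> m"
  shows "hnorm (B j) (f j) \<le> mu j * hnorm A (Gam_sum m lam f)"
proof -
  have "(hnorm (B j) (f j) / mu j)\<^sup>2 \<le> (\<Sum>j\<le>m. (hnorm (B j) (f j) / mu j)\<^sup>2)"
    using j by (intro member_le_sum) auto
  hence "(hnorm (B j) (f j) / mu j)\<^sup>2 \<le> (hnorm A (Gam_sum m lam f))\<^sup>2"
    by (simp only: A_hnorm_sq[OF f])
  hence "hnorm (B j) (f j) / mu j \<le> hnorm A (Gam_sum m lam f)"
    by (rule power2_le_imp_le) (use f in \<open>auto simp: A_carr\<close>)
  thus ?thesis
    using mu_pos[OF j] by (simp add: pos_divide_le_eq mult.commute)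
qed

lemma A_hnorm_le:
  assumes f: "f \<in> components m lam"
  shows "hnorm A (Gam_sum m lam f) \<le> (\<Sum>j\<le>m. hnorm (B j) (f j) / mu j)"
proof (rule power2_le_imp_le)
  have nn: "0 \<le> hnorm (B j) (f j) / mu j" if "j \<in> {..m}" for j
    using f that mu_pos[of j] by (intro divide_nonneg_nonneg) (auto simp: components_iff)
  show "(hnorm A (Gam_sum m lam f))\<^sup>2 \<le> (\<Sum>j\<le>m. hnorm (B j) (f j) / mu j)\<^sup>2"
    unfolding A_hnorm_sq[OF f] by (rule sum_squares_le_square_sum) (use nn in auto)
  show "0 \<le> (\<Sum>j\<le>m. hnorm (B j) (f j) / mu j)"
    by (rule sum_nonneg[OF nn])
qed

text \<open>\<open>lam_idx\<close> grows by one with each index, which matches the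
  \<open>l - j\<close> derivatives in row \<open>l\<close>, column \<open>j\<close> exactly.\<close>

lemma deriv_bounds:
  obtains c where "\<And>j l. j \<le> l \<Longrightarrow> c j l \<ge> 0"
    "\<And>j l f. j \<le> l \<Longrightarrow> f \<in> carr (B j) \<Longrightarrow> \<kappa> j l *\<^sub>C (Dz ^^ (l - j)) f \<in> carr (B l)"
    "\<And>j l f. j \<le> l \<Longrightarrow> f \<in> carr (B j) \<Longrightarrow> hnorm (B l) (\<kappa> j l *\<^sub>C (Dz ^^ (l - j)) f) \<le> c j l * hnorm (B j) f"
proof -
  have "\<exists>C\<ge>0. \<forall>f\<in>carr (B j). \<kappa> j l *\<^sub>C (Dz ^^ (l - j)) f \<in> carr (B l) \<and>
      hnorm (B l) (\<kappa> j l *\<^sub>C (Dz ^^ (l - j)) f) \<le> C * hnorm (B j) f" if jl: "j \<le> l" for j l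
  proof -
    obtain C where C: "C \<ge> 0" "\<And>f. f \<in> carr (B j) \<Longrightarrow> (Dz ^^ (l - j)) f \<in> carr (B l)"
      "\<And>f. f \<in> carr (B j) \<Longrightarrow> hnorm (B l) ((Dz ^^ (l - j)) f) \<le> C * hnorm (B j) f"
      using bergman_Dz_funpow[OF L_pos[of j], where k = "l - j"] unfolding lam_idx_add[OF jl, symmetric] by blast
    have "hnorm (B l) (\<kappa> j l *\<^sub>C (Dz ^^ (l - j)) f) \<le> (cmod (\<kappa> j l) * C) * hnorm (B j) f"
      if "f \<in> carr (B j)" for f
      using mult_left_mono[OF C(3)[OF that], of "cmod (\<kappa> j l)"]
      by (simp only: B.hnorm_scaleC[OF C(2)[OF that]] mult.assoc norm_ge_zero)
    moreover have "\<kappa> j l *\<^sub>C (Dz ^^ (l - j)) f \<in> carr (B l)" if "f \<in> carr (B j)" for f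
      using C(2)[OF that] by (rule B.scaleC_mem)
    moreover have "0 \<le> cmod (\<kappa> j l) * C"
      using C(1) by simp
    ultimately show ?thesis by blast
  qed
  hence "\<forall>j l. \<exists>C. j \<le> l \<longrightarrow> C \<ge> 0 \<and> (\<forall>f\<in>carr (B j). \<kappa> j l *\<^sub>C (Dz ^^ (l - j)) f \<in> carr (B l) \<and>
      hnorm (B l) (\<kappa> j l *\<^sub>C (Dz ^^ (l - j)) f) \<le> C * hnorm (B j) f)" by blast
  then obtain c where "\<And>j l. j \<le> l \<longrightarrow> c j l \<ge> 0 \<and> (\<forall>f\<in>carr (B j). \<kappa> j l *\<^sub>C (Dz ^^ (l - j)) f \<in> carr (B l) \<and>
      hnorm (B l) (\<kappa> j l *\<^sub>C (Dz ^^ (l - j)) f) \<le> c j l * hnorm (B j) f)" by metis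
  thus ?thesis using that[of c] by blast
qed

text \<open>One half of the norm equivalence: the triangular map from summands to components is
  bounded row by row, and the row constants are added to give a single one.\<close>

lemma component_bound:
  obtains C where "C \<ge> 0" "\<And>F l. F \<in> carr A \<Longrightarrow> l \<le> m \<Longrightarrow> component F l \<in> carr (B l)"
    "\<And>F l. F \<in> carr A \<Longrightarrow> l \<le> m \<Longrightarrow> hnorm (B l) (component F l) \<le> C * hnorm A F"
proof -
  obtain c where c: "\<And>j l. j \<le> l \<Longrightarrow> c j l \<ge> 0"
    "\<And>j l f. j \<le> l \<Longrightarrow> f \<in> carr (B j) \<Longrightarrow> \<kappa> j l *\<^sub>C (Dz ^^ (l - j)) f \<in> carr (B l)"
    "\<And>j l f. j \<le> l \<Longrightarrow> f \<in> carr (B j) \<Longrightarrow> hnorm (B l) (\<kappa> j l *\<^sub>C (Dz ^^ (l - j)) f) \<le> c j l * hnorm (B j) f"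
    using deriv_bounds by metis
  define K where "K l = (\<Sum>j\<le>l. c j l * mu j)" for l
  have K: "K l \<ge> 0" if "l \<le> m" for l
    unfolding K_def using c(1) mu_pos that by (intro sum_nonneg mult_nonneg_nonneg) (auto intro: less_imp_le)
  have *: "component F l \<in> carr (B l) \<and> hnorm (B l) (component F l) \<le> K l * hnorm A F"
    if F: "F \<in> carr A" and l: "l \<le> m" for F l
  proof -
    obtain f where f: "f \<in> components m lam" "F = Gam_sum m lam f"
      using F unfolding A_carr by blast
    have fB: "f j \<in> carr (B j)" if "j \<le> l" for j
      using f(1) that l by (simp add: components_iff)
    have eq: "component F l = (\<Sum>j\<le>l. \<kappa> j l *\<^sub>C (Dz ^^ (l - j)) (f j))"
      unfolding f(2) using l by (simp only: component_Gam_sum'[OF f(1)] if_True)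
    have "hnorm (B l) (\<Sum>j\<le>l. \<kappa> j l *\<^sub>C (Dz ^^ (l - j)) (f j)) \<le> (\<Sum>j\<le>l. hnorm (B l) (\<kappa> j l *\<^sub>C (Dz ^^ (l - j)) (f j)))"
      by (intro B.hnorm_sum_le c(2) fB) simp_all
    also have "\<dots> \<le> (\<Sum>j\<le>l. c j l * (mu j * hnorm A F))"
    proof (rule sum_mono)
      fix j assume "j \<in> {..l}"
      hence j: "j \<le> l" by simp
      show "hnorm (B l) (\<kappa> j l *\<^sub>C (Dz ^^ (l - j)) (f j)) \<le> c j l * (mu j * hnorm A F)"
        using c(3)[OF j fB[OF j]] mult_left_mono[OF component_hnorm_le[OF f(1), of j] c(1)[OF j]] j l
        unfolding f(2) by force
    qed
    also have "\<dots> = K l * hnorm A F"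
      by (simp add: K_def sum_distrib_right mult.assoc)
    finally show ?thesis
      unfolding eq by (intro conjI B.sum_mem c(2) fB) simp_all
  qed
  have "hnorm (B l) (component F l) \<le> (\<Sum>l\<le>m. K l) * hnorm A F" if "F \<in> carr A" "l \<le> m" for F l
  proof -
    have "K l \<le> (\<Sum>l\<le>m. K l)"
      using that K by (intro member_le_sum) auto
    thus ?thesis
      using *[OF that] mult_right_mono[of "K l" "\<Sum>l\<le>m. K l" "hnorm A F"] A.hnorm_nonneg[OF that(1)] by linarith
  qed
  moreover have "(\<Sum>l\<le>m. K l) \<ge> 0" using K by (intro sum_nonneg) auto
  ultimately show ?thesis using that * by blast
qed

lemma component_eq_0: "F \<in> carr A \<Longrightarrow> l > m \<Longrightarrow> component F l = 0"
  unfolding A_carr by (auto simp: component_Gam_sum')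

text \<open>Forward substitution, by induction on the number \<open>k\<close> of rows solved. The
  constant is quantified before the right-hand side \<open>G\<close>; this uniformity is the
  boundedness of the inverse.\<close>

lemma triangular_solve:
  "\<exists>C\<ge>0. \<forall>G. (\<forall>l<k. G l \<in> carr (B l)) \<longrightarrow> (\<exists>f. \<forall>l<k. f l \<in> carr (B l) \<and>
    hnorm (B l) (f l) \<le> C * (\<Sum>i<k. hnorm (B i) (G i)) \<and>
    G l = (\<Sum>j\<le>l. \<kappa> j l *\<^sub>C (Dz ^^ (l - j)) (f j)))"
proof (induction k)
  case (Suc k)
  obtain c where c: "\<And>j l. j \<le> l \<Longrightarrow> c j l \<ge> 0"
    "\<And>j l f. j \<le> l \<Longrightarrow> f \<in> carr (B j) \<Longrightarrow> \<kappa> j l *\<^sub>C (Dz ^^ (l - j)) f \<in> carr (B l)"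
    "\<And>j l f. j \<le> l \<Longrightarrow> f \<in> carr (B j) \<Longrightarrow> hnorm (B l) (\<kappa> j l *\<^sub>C (Dz ^^ (l - j)) f) \<le> c j l * hnorm (B j) f"
    using deriv_bounds by metis
  from Suc obtain C where C: "C \<ge> 0" "\<forall>G. (\<forall>l<k. G l \<in> carr (B l)) \<longrightarrow> (\<exists>f. \<forall>l<k. f l \<in> carr (B l) \<and>
    hnorm (B l) (f l) \<le> C * (\<Sum>i<k. hnorm (B i) (G i)) \<and>
    G l = (\<Sum>j\<le>l. \<kappa> j l *\<^sub>C (Dz ^^ (l - j)) (f j)))"
    by (elim exE conjE) (rule that)
  \<comment> \<open>Bounds the contribution of the rows already solved to the next row.\<close>
  define E where "E = (\<Sum>j<k. c j k * C)"
  have E: "E \<ge> 0" unfolding E_def using c(1) C(1) by (intro sum_nonneg mult_nonneg_nonneg) auto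
  show ?case
  proof (intro exI[of _ "C + 1 + E"] conjI allI impI)
    show "0 \<le> C + 1 + E" using C(1) E by simp
    fix G :: "nat \<Rightarrow> complex \<Rightarrow> complex"
    assume G: "\<forall>l<Suc k. G l \<in> carr (B l)"
    define s where "s = (\<Sum>i<k. hnorm (B i) (G i))"
    have s: "s \<ge> 0" unfolding s_def using G by (intro sum_nonneg) auto
    have Gk: "G k \<in> carr (B k)" using G by simp
    have "\<forall>l<k. G l \<in> carr (B l)" using G by simp
    from C(2)[THEN spec, THEN mp, OF this, folded s_def] obtain f where f: "\<forall>l<k. f l \<in> carr (B l) \<and>
      hnorm (B l) (f l) \<le> C * s \<and> G l = (\<Sum>j\<le>l. \<kappa> j l *\<^sub>C (Dz ^^ (l - j)) (f j))" ..
    note f = f[rule_format, THEN conjunct1] f[rule_format, THEN conjunct2, THEN conjunct1]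
      f[rule_format, THEN conjunct2, THEN conjunct2]
    define t where "t = (\<Sum>j<k. \<kappa> j k *\<^sub>C (Dz ^^ (k - j)) (f j))"
    have t: "t \<in> carr (B k)"
      unfolding t_def using f(1) by (intro B.sum_mem c(2)) auto
    have "hnorm (B k) t \<le> (\<Sum>j<k. hnorm (B k) (\<kappa> j k *\<^sub>C (Dz ^^ (k - j)) (f j)))"
      unfolding t_def using f(1) by (intro B.hnorm_sum_le c(2)) auto
    also have "\<dots> \<le> (\<Sum>j<k. c j k * (C * s))"
    proof (rule sum_mono)
      fix j assume "j \<in> {..<k}"
      hence j: "j < k" by simp
      show "hnorm (B k) (\<kappa> j k *\<^sub>C (Dz ^^ (k - j)) (f j)) \<le> c j k * (C * s)"
        using c(3)[of j k, OF _ f(1)[OF j]] mult_left_mono[OF f(2)[OF j] c(1)[of j k]] j by force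
    qed
    also have "\<dots> = E * s" by (simp add: E_def sum_distrib_right mult.assoc)
    finally have t_le: "hnorm (B k) t \<le> E * s" .
    \<comment> \<open>The diagonal coefficient is 1, so the new unknown is the residual of row
      \<open>k\<close>.\<close>
    define f' where "f' = f(k := G k - t)"
    have n: "0 \<le> hnorm (B k) (G k)" using Gk by simp
    show "\<exists>f. \<forall>l<Suc k. f l \<in> carr (B l) \<and>
      hnorm (B l) (f l) \<le> (C + 1 + E) * (\<Sum>i<Suc k. hnorm (B i) (G i)) \<and>
      G l = (\<Sum>j\<le>l. \<kappa> j l *\<^sub>C (Dz ^^ (l - j)) (f j))"
    proof (intro exI[of _ f'] allI impI)
      fix l assume "l < Suc k"
      then consider "l < k" | "l = k" by linarith
      thus "f' l \<in> carr (B l) \<and> hnorm (B l) (f' l) \<le> (C + 1 + E) * (\<Sum>i<Suc k. hnorm (B i) (G i)) \<and>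
        G l = (\<Sum>j\<le>l. \<kappa> j l *\<^sub>C (Dz ^^ (l - j)) (f' j))"
      proof cases
        case 1
        have sum_eq: "(\<Sum>j\<le>l. \<kappa> j l *\<^sub>C (Dz ^^ (l - j)) (f' j)) = (\<Sum>j\<le>l. \<kappa> j l *\<^sub>C (Dz ^^ (l - j)) (f j))"
          using 1 by (intro sum.cong refl) (simp add: f'_def)
        have le: "C * s \<le> (C + 1 + E) * (\<Sum>i<Suc k. hnorm (B i) (G i))"
          using C(1) E s n by (intro mult_mono) (auto simp: s_def)
        have fl: "f' l = f l" using 1 by (simp add: f'_def)
        show ?thesis
          unfolding fl sum_eq f(3)[OF 1, symmetric]
          by (intro conjI f(1)[OF 1] order_trans[OF f(2)[OF 1] le] refl)
      next
        case 2
        have "hnorm (B k) (G k - t) \<le> hnorm (B k) (G k) + E * s"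
          using B.hnorm_diff_le[OF Gk t] t_le by linarith
        also have "\<dots> \<le> (C + 1 + E) * (s + hnorm (B k) (G k))"
        proof -
          have "0 \<le> C * (s + hnorm (B k) (G k)) + s + E * hnorm (B k) (G k)"
            using C(1) E s n by (intro add_nonneg_nonneg mult_nonneg_nonneg) auto
          thus ?thesis by (simp add: algebra_simps)
        qed
        finally have b: "hnorm (B k) (G k - t) \<le> (C + 1 + E) * (\<Sum>i<Suc k. hnorm (B i) (G i))"
          by (simp add: s_def)
        have "(\<Sum>j\<le>k. \<kappa> j k *\<^sub>C (Dz ^^ (k - j)) (f' j)) = (\<Sum>j<k. \<kappa> j k *\<^sub>C (Dz ^^ (k - j)) (f' j)) + (G k - t)"
          unfolding lessThan_Suc_atMost[symmetric] sum.lessThan_Suc by (simp add: f'_def complex_vector.scale_one)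
        also have "(\<Sum>j<k. \<kappa> j k *\<^sub>C (Dz ^^ (k - j)) (f' j)) = t"
          unfolding t_def by (intro sum.cong refl) (simp add: f'_def)
        also have "t + (G k - t) = G k" by simp
        finally have e: "G k = (\<Sum>j\<le>k. \<kappa> j k *\<^sub>C (Dz ^^ (k - j)) (f' j))" by (rule sym)
        have "f' k = G k - t" by (simp add: f'_def)
        thus ?thesis unfolding 2 using b e B.diff_mem[OF Gk t] by metis
      qed
    qed
  qed
qed (intro exI[of _ 0], simp)

text \<open>The other half of the norm equivalence, from solving the triangular system for the
  summands.\<close>

lemma A_memI:
  obtains C where "C \<ge> 0"
    "\<And>F. (\<And>l. l \<le> m \<Longrightarrow> component F l \<in> carr (B l)) \<Longrightarrow> (\<And>l. l > m \<Longrightarrow> component F l = 0) \<Longrightarrow> F \<in> carr A"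
    "\<And>F. F \<in> carr A \<Longrightarrow> hnorm A F \<le> C * (\<Sum>l\<le>m. hnorm (B l) (component F l))"
proof -
  from triangular_solve[of "Suc m"]
  obtain C where C: "C \<ge> 0" "\<forall>G. (\<forall>l<Suc m. G l \<in> carr (B l)) \<longrightarrow> (\<exists>f. \<forall>l<Suc m. f l \<in> carr (B l) \<and>
    hnorm (B l) (f l) \<le> C * (\<Sum>i<Suc m. hnorm (B i) (G i)) \<and>
    G l = (\<Sum>j\<le>l. \<kappa> j l *\<^sub>C (Dz ^^ (l - j)) (f j)))"
    by (elim exE conjE) (rule that)
  define K where "K = (\<Sum>j\<le>m. C / mu j)"
  have K: "K \<ge> 0"
    unfolding K_def using C(1) mu_pos by (intro sum_nonneg divide_nonneg_nonneg) (auto intro: less_imp_le)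
  have *: "F \<in> carr A \<and> hnorm A F \<le> K * (\<Sum>l\<le>m. hnorm (B l) (component F l))"
    if F: "\<And>l. l \<le> m \<Longrightarrow> component F l \<in> carr (B l)" "\<And>l. l > m \<Longrightarrow> component F l = 0" for F
  proof -
    define s where "s = (\<Sum>l\<le>m. hnorm (B l) (component F l))"
    have "\<forall>l<Suc m. component F l \<in> carr (B l)" using F(1) by simp
    from C(2)[THEN spec, THEN mp, OF this, unfolded less_Suc_eq_le lessThan_Suc_atMost, folded s_def]
    obtain f where f: "\<forall>l\<le>m. f l \<in> carr (B l) \<and> hnorm (B l) (f l) \<le> C * s \<and>
      component F l = (\<Sum>j\<le>l. \<kappa> j l *\<^sub>C (Dz ^^ (l - j)) (f j))" ..
    note f = f[rule_format, THEN conjunct1] f[rule_format, THEN conjunct2, THEN conjunct1]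
      f[rule_format, THEN conjunct2, THEN conjunct2]
    have fc: "f \<in> components m lam"
      using f(1) by (simp add: components_iff)
    have eq: "F = Gam_sum m lam f"
    proof (rule component_eqI)
      fix l
      show "component F l = component (Gam_sum m lam f) l"
      proof (cases "l \<le> m")
        case True
        thus ?thesis using f(3)[OF True] by (simp only: component_Gam_sum'[OF fc] if_True)
      next
        case False
        thus ?thesis using F(2)[of l] by (simp add: component_Gam_sum'[OF fc])
      qed
    qed
    have "hnorm A F \<le> (\<Sum>j\<le>m. hnorm (B j) (f j) / mu j)"
      unfolding eq by (rule A_hnorm_le[OF fc])
    also have "\<dots> \<le> (\<Sum>j\<le>m. C * s / mu j)"
      using f(2) mu_pos by (intro sum_mono divide_right_mono) (auto intro: less_imp_le)
    also have "\<dots> = K * s"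
      by (simp add: K_def sum_distrib_right)
    finally show ?thesis
      using fc unfolding eq A_carr s_def by blast
  qed
  obtain D where D: "\<And>F l. F \<in> carr A \<Longrightarrow> l \<le> m \<Longrightarrow> component F l \<in> carr (B l)"
    using component_bound by metis
  show ?thesis
    using that[OF K] * D component_eq_0 by blast
qed

lemma component_mem: "F \<in> carr A \<Longrightarrow> l \<le> m \<Longrightarrow> component F l \<in> carr (B l)"
  using component_bound by metis

lemma component_disc_fun: "F \<in> carr A \<Longrightarrow> disc_fun (component F l)"
  using component_mem[of F l] component_eq_0[of F l] B_disc_fun[of "component F l" l] disc_fun_zero
  by (cases "l \<le> m") auto

lemma A_mem: "(\<And>l. l \<le> m \<Longrightarrow> component F l \<in> carr (B l)) \<Longrightarrow> (\<And>l. l > m \<Longrightarrow> component F l = 0) \<Longrightarrow> F \<in> carr A"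
  using A_memI by metis

text \<open>The norm of \<open>A_space\<close> is expressed through the summands, not the
  components, so the bound passes through the norm equivalence in both directions. Membership uses
  \<open>t 0 = 0\<close> for the components beyond \<open>m\<close>.\<close>

lemma componentwise_operator:
  fixes t :: "(complex \<Rightarrow> complex) \<Rightarrow> complex \<Rightarrow> complex"
  assumes bdd: "\<And>l. \<exists>C\<ge>0. \<forall>f\<in>carr (B l). t f \<in> carr (B l) \<and> hnorm (B l) (t f) \<le> C * hnorm (B l) f"
    and add: "\<And>f g. disc_fun f \<Longrightarrow> disc_fun g \<Longrightarrow> t (f + g) = t f + t g"
    and scale: "\<And>c f. disc_fun f \<Longrightarrow> t (c *\<^sub>C f) = c *\<^sub>C t f"
    and T: "\<And>F l. component (T F) l = t (component F l)"
  shows "bounded_operator A T"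
proof -
  have t0: "t 0 = 0"
    using scale[OF disc_fun_zero, of 0] by simp
  obtain c where c: "\<And>l. c l \<ge> 0" "\<And>l f. f \<in> carr (B l) \<Longrightarrow> t f \<in> carr (B l)"
    "\<And>l f. f \<in> carr (B l) \<Longrightarrow> hnorm (B l) (t f) \<le> c l * hnorm (B l) f"
    using bdd by metis
  have mem: "T F \<in> carr A" if F: "F \<in> carr A" for F
    by (rule A_mem) (use F in \<open>simp_all add: T c(2) component_mem component_eq_0 t0\<close>)
  obtain C where C: "C \<ge> 0" "\<And>F. F \<in> carr A \<Longrightarrow> hnorm A F \<le> C * (\<Sum>l\<le>m. hnorm (B l) (component F l))"
    using A_memI by metis
  obtain D where D: "D \<ge> 0" "\<And>F l. F \<in> carr A \<Longrightarrow> l \<le> m \<Longrightarrow> hnorm (B l) (component F l) \<le> D * hnorm A F"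
    using component_bound by metis
  have bd: "hnorm A (T F) \<le> (C * (\<Sum>l\<le>m. c l * D)) * hnorm A F" if F: "F \<in> carr A" for F
  proof -
    have "hnorm A (T F) \<le> C * (\<Sum>l\<le>m. hnorm (B l) (t (component F l)))"
      using C(2)[OF mem[OF F]] by (simp only: T)
    also have "\<dots> \<le> C * (\<Sum>l\<le>m. c l * (D * hnorm A F))"
    proof (intro mult_left_mono sum_mono C(1))
      fix l assume "l \<in> {..m}"
      hence l: "l \<le> m" by simp
      show "hnorm (B l) (t (component F l)) \<le> c l * (D * hnorm A F)"
        using c(3)[OF component_mem[OF F l]] mult_left_mono[OF D(2)[OF F l] c(1)[of l]] by linarith
    qed
    also have "\<dots> = (C * (\<Sum>l\<le>m. c l * D)) * hnorm A F"
      by (simp add: sum_distrib_right mult.assoc)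
    finally show ?thesis .
  qed
  have "T (F + G) = T F + T G" if "F \<in> carr A" "G \<in> carr A" for F G
    by (rule component_eqI) (simp only: T component_add add[OF component_disc_fun[OF that(1)] component_disc_fun[OF that(2)]])
  moreover have "T (a *\<^sub>C F) = a *\<^sub>C T F" if "F \<in> carr A" for F a
    by (rule component_eqI) (simp only: T component_scaleC scale[OF component_disc_fun[OF that]])
  ultimately show ?thesis
    using mem bd unfolding bounded_operator_def
    by (intro conjI exI[of _ "C * (\<Sum>l\<le>m. c l * D)"]) blast+
qed

lemma component_mult_z: "component (mult_z F) l = zmul (component F l)"
  by (simp add: component_def mult_z_def zmul_def)

lemma zmul_add: "zmul (f + g) = zmul f + zmul g"
  and zmul_scaleC: "zmul (c *\<^sub>C f) = c *\<^sub>C zmul f"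
  by (auto simp: zmul_def fun_eq_iff algebra_simps)

theorem bounded_mult_z: "bounded_operator A mult_z"
proof (rule componentwise_operator[where t = zmul])
  show "\<exists>C\<ge>0. \<forall>f\<in>carr (B l). zmul f \<in> carr (B l) \<and> hnorm (B l) (zmul f) \<le> C * hnorm (B l) f" for l
    using bergman_zmul[OF L_pos] L_pos[of l]
    by (intro exI[of _ "sqrt (1 + 1 / (2 * L l))"]) auto
qed (simp_all add: zmul_add zmul_scaleC component_mult_z)

end

subsection \<open>The adjoint of multiplication and the shift\<close>

context A_setting
begin

theorem adjoint_cowen_douglas:
  "\<exists>T. is_adjoint A mult_z T \<and> cowen_douglas A T"
proof -
  obtain T where T: "is_adjoint A mult_z T" "bounded_operator A T"
    using A.adjoint_exists[OF bounded_mult_z] by blast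
  \<comment> \<open>The constant functions with value the \<open>l\<close>-th unit vector: their
    evaluations at every point of the disc are 0 or 1, as the criterion requires.\<close>
  define v :: "nat \<Rightarrow> complex \<Rightarrow> nat \<Rightarrow> complex"
    where "v l = (\<lambda>z i. if i = l then mon 0 z else 0)" for l
  have component_v: "component (v l) i = (if i = l then mon 0 else 0)" for l i
    by (auto simp: component_def v_def)
  have v_mem: "v l \<in> carr A" if "l < Suc m" for l
    by (rule A_mem) (use that in \<open>simp_all add: component_v bergman_mon(1)[OF L_pos]\<close>)
  have "cowen_douglas_B (Suc m) A T"
  proof (rule A.cowen_douglas_adjointI[where M = mult_z and v = v and ev = "\<lambda>w l F. F w l"])
    show "bounded_operator A mult_z" by (rule bounded_mult_z)
    show "is_adjoint A mult_z T" "bounded_operator A T" by (rule T)+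
    show "v l \<in> carr A" if "l < Suc m" for l using that by (rule v_mem)
  next
    fix w :: complex and l assume w: "w \<in> unit_disc" and l: "l < Suc m"
    obtain C where C: "C \<ge> 0" "\<And>f. f \<in> carr (B l) \<Longrightarrow> cmod (f w) \<le> C * hnorm (B l) f"
      using bergman_eval_bound[OF L_pos w] by blast
    obtain D where D: "D \<ge> 0" "\<And>F. F \<in> carr A \<Longrightarrow> hnorm (B l) (component F l) \<le> D * hnorm A F"
      using component_bound l by (metis less_Suc_eq_le)
    have "cmod (F w l) \<le> (C * D) * hnorm A F" if "F \<in> carr A" for F
    proof -
      have "cmod (component F l w) \<le> C * hnorm (B l) (component F l)"
        using l that by (intro C(2) component_mem) auto
      also have "\<dots> \<le> C * (D * hnorm A F)"
        by (intro mult_left_mono D(2) C(1) that)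
      finally show ?thesis by (simp add: component_def mult.assoc)
    qed
    thus "\<exists>C. \<forall>F\<in>carr A. cmod (F w l) \<le> C * hnorm A F" by blast
  next
    fix w :: complex assume w: "w \<in> unit_disc"
    hence w1: "cmod w < 1" by simp
    define D where "D F = (\<lambda>z l. dq w (component F l) z)" for F :: "complex \<Rightarrow> nat \<Rightarrow> complex"
    have component_D: "component (D F) l = dq w (component F l)" for F l
      by (simp add: component_def D_def)
    have "bounded_operator A D"
      by (rule componentwise_operator[where t = "dq w"])
         (use bergman_dq[OF L_pos w1] dq_add[OF w1] dq_scaleC[OF w1] component_D in auto)
    moreover have "D (mult_z F - w *\<^sub>C F) = F" if F: "F \<in> carr A" for F
      by (rule component_eqI)
         (simp only: component_D component_diff component_mult_z component_scaleC dq_zmul[OF w1 component_disc_fun[OF F]])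
    moreover have "mult_z (D F) - w *\<^sub>C D F = F - (\<Sum>l<Suc m. F w l *\<^sub>C v l)" if F: "F \<in> carr A" for F
    proof (rule component_eqI)
      fix l
      have "component (\<Sum>l<Suc m. F w l *\<^sub>C v l) l = F w l *\<^sub>C mon 0"
      proof
        fix z
        have "component (\<Sum>l<Suc m. F w l *\<^sub>C v l) l z = (\<Sum>i<Suc m. if i = l then F w i * mon 0 z else 0)"
          unfolding component_def sum_fun_apply by (intro sum.cong refl) (auto simp: v_def)
        also have "\<dots> = (if l < Suc m then F w l * mon 0 z else 0)"
          by (simp only: sum.delta finite_lessThan lessThan_iff)
        \<comment> \<open>For \<open>l > m\<close> both sides vanish, since that component of
          \<open>F\<close> is zero.\<close>
        also have "\<dots> = (F w l *\<^sub>C mon 0) z"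
          using component_eq_0[OF F, of l] by (auto simp: component_def fun_eq_iff)
        finally show "component (\<Sum>l<Suc m. F w l *\<^sub>C v l) l z = (F w l *\<^sub>C mon 0) z" .
      qed
      moreover have "component F l w = F w l" by (simp add: component_def)
      ultimately show "component (mult_z (D F) - w *\<^sub>C D F) l = component (F - (\<Sum>l<Suc m. F w l *\<^sub>C v l)) l"
        using zmul_dq[OF w1 component_disc_fun[OF F, of l]]
        by (simp only: component_D component_diff component_mult_z component_scaleC)
    qed
    ultimately show "\<exists>D. bounded_operator A D \<and> (\<forall>F\<in>carr A. D (mult_z F - w *\<^sub>C F) = F \<and>
        mult_z (D F) - w *\<^sub>C D F = F - (\<Sum>l<Suc m. F w l *\<^sub>C v l))"
      by blast
  next
    fix F assume F: "F \<in> carr A" and zero: "\<And>w l. w \<in> unit_disc \<Longrightarrow> l < Suc m \<Longrightarrow> F w l = 0"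
    have "F w l = 0" for w l
    proof (cases "w \<in> unit_disc \<and> l < Suc m")
      case False
      have "component F l w = 0"
        using False component_disc_fun[OF F, of l] component_eq_0[OF F, of l] by (auto simp: disc_fun_def)
      thus ?thesis by (simp add: component_def)
    qed (use zero in blast)
    thus "F = 0" by (auto simp: fun_eq_iff)
  qed (auto simp: mult_z_def v_def mon_def on_disc_def)
  thus ?thesis
    using T(1) by (auto simp: cowen_douglas_def intro!: exI[of _ "Suc m"])
qed

section \<open>The shift and the Hilbert--Schmidt property\<close>

definition shift :: "(nat \<times> nat \<Rightarrow> complex) \<Rightarrow> nat \<times> nat \<Rightarrow> complex" where
  "shift a = (\<lambda>(j, n). case n of 0 \<Rightarrow> 0 | Suc k \<Rightarrow> a (j, k))"

lemma bounded_shift: "bounded_operator (ell2 I) shift"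
proof -
  interpret E: complex_hilbert_space "ell2 I" by (rule ell2_hilbert_space)
  \<comment> \<open>The shift reindexes along this injection and extends by zero, hence is
    isometric.\<close>
  let ?s = "\<lambda>p::nat \<times> nat. (fst p, Suc (snd p))"
  have inj: "inj_on ?s UNIV" by (auto simp: inj_on_def)
  have *: "shift a \<in> carr (ell2 I)" "hnorm (ell2 I) (shift a) = hnorm (ell2 I) a" if a: "a \<in> carr (ell2 I)" for a
  proof -
    let ?f = "\<lambda>p. (cmod (shift a p))\<^sup>2"
    have eq: "?f \<circ> ?s = (\<lambda>p. (cmod (a p))\<^sup>2)"
      by (auto simp: shift_def)
    have off: "?f p = 0" if "p \<notin> range ?s" for p
      using that by (cases p; cases "snd p") (auto simp: shift_def image_iff)
    have "?f summable_on range ?s"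
      unfolding summable_on_reindex[OF inj] eq by (rule ell2_summable[OF a])
    also have "?f summable_on range ?s \<longleftrightarrow> ?f summable_on UNIV"
      by (rule summable_on_cong_neutral) (use off in auto)
    finally show mem: "shift a \<in> carr (ell2 I)"
      using a by (auto simp: ell2_mem_iff I_def shift_def split: nat.split)
    have "infsum ?f UNIV = infsum ?f (range ?s)"
      by (rule infsum_cong_neutral) (use off in auto)
    also have "\<dots> = (\<Sum>\<^sub>\<infinity>p. (cmod (a p))\<^sup>2)"
      unfolding infsum_reindex[OF inj] eq ..
    finally have "(hnorm (ell2 I) (shift a))\<^sup>2 = (hnorm (ell2 I) a)\<^sup>2"
      by (simp only: ell2_hnorm_sq[OF mem] ell2_hnorm_sq[OF a])
    thus "hnorm (ell2 I) (shift a) = hnorm (ell2 I) a"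
      using mem a by (simp add: power2_eq_iff_nonneg)
  qed
  moreover have "shift (a + b) = shift a + shift b" "shift (c *\<^sub>C a) = c *\<^sub>C shift a" for a b c
    by (auto simp: shift_def fun_eq_iff split: nat.split)
  ultimately show ?thesis
    by (auto simp: bounded_operator_def intro!: exI[of _ 1])
qed

lemma shift_unit: "shift (ell2_unit (j, n)) = ell2_unit (j, Suc n)"
  by (auto simp: shift_def ell2_unit_def fun_eq_iff split: nat.split)

lemma e_vec_eq: "e_vec m lam j n = Gam m lam j (unit_mon (L j) n)"
proof -
  have "on_disc (\<lambda>z. complex_of_real (sqrt (pochhammer (2 * L j) n / fact n)) * z ^ n) = unit_mon (L j) n"
    by (auto simp: unit_mon_def mon_def on_disc_def bwt_def fun_eq_iff)
  thus ?thesis by (simp only: e_vec_def)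
qed

lemma bfun_unit: "bfun (L j) (ell2_unit n) = unit_mon (L j) n"
proof (rule disc_fun_eqI)
  fix k
  show "tcoeff (bfun (L j) (ell2_unit n)) k = tcoeff (unit_mon (L j) n) k"
    unfolding unit_mon_def
    by (simp add: tcoeff_bfun[OF L_pos] tcoeff_scaleC disc_fun_mon tcoeff_mon) (simp add: ell2_unit_def)
qed (simp_all add: disc_fun_bfun[OF L_pos] disc_fun_unit_mon)

lemma \<Psi>_unit:
  assumes j: "j \<le> m"
  shows "\<Psi> (ell2_unit (j, n)) = complex_of_real (mu j) *\<^sub>C e_vec m lam j n"
proof (rule component_eqI)
  fix l
  define f where "f i = complex_of_real (mu i) *\<^sub>C bfun (L i) (\<lambda>k. ell2_unit (j, n) (i, k))" for i
  have f: "f i = (if i = j then complex_of_real (mu j) *\<^sub>C unit_mon (L j) n else 0)" for i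
  proof (cases "i = j")
    case True
    have "(\<lambda>k. ell2_unit (j, n) (j, k)) = (ell2_unit n :: nat \<Rightarrow> complex)"
      by (auto simp: ell2_unit_def)
    thus ?thesis by (simp add: f_def True bfun_unit)
  next
    case False
    hence "(\<lambda>k. ell2_unit (j, n) (i, k)) = (\<lambda>k. 0)"
      by (auto simp: ell2_unit_def)
    thus ?thesis using False by (simp add: f_def bfun_def on_disc_def fun_eq_iff)
  qed
  have "Gam m lam i (f i) = (if i = j then complex_of_real (mu j) *\<^sub>C e_vec m lam j n else 0)" for i
  proof (rule component_eqI)
    fix l
    have Dz0: "(Dz ^^ k) 0 = 0" for k
      using Dz_funpow_scaleC[OF disc_fun_zero, of k 0] by simp
    have "component (0 :: complex \<Rightarrow> nat \<Rightarrow> complex) l = 0" by (simp add: component_def zero_fun_def)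
    thus "component (Gam m lam i (f i)) l = component (if i = j then complex_of_real (mu j) *\<^sub>C e_vec m lam j n else 0) l"
      unfolding f
      by (cases "i = j")
         (simp_all only: component_Gam disc_fun_scaleC disc_fun_unit_mon disc_fun_zero e_vec_eq if_True if_False
           component_scaleC Dz_funpow_scaleC[OF disc_fun_unit_mon] Dz0 complex_vector.scale_zero_right
           complex_vector.scale_left_commute if_cancel split: if_split, auto)
  qed
  hence "\<Psi> (ell2_unit (j, n)) = (\<Sum>i\<le>m. if i = j then complex_of_real (mu j) *\<^sub>C e_vec m lam j n else 0)"
    by (simp only: \<Psi>_def f_def[symmetric] Gam_sum_def)
  also have "\<dots> = complex_of_real (mu j) *\<^sub>C e_vec m lam j n"
    using j by (simp only: sum.delta finite_atMost atMost_iff if_True)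
  finally show "component (\<Psi> (ell2_unit (j, n))) l = component (complex_of_real (mu j) *\<^sub>C e_vec m lam j n) l"
    by simp
qed

text \<open>The coordinate shift transported to \<open>A_space\<close>: raising \<open>n\<close> by
  one for every fixed \<open>j\<close> is how the operator has to act on the vectors
  \<open>e_vec m lam j n\<close>.\<close>

definition U_plus :: "(complex \<Rightarrow> nat \<Rightarrow> complex) \<Rightarrow> complex \<Rightarrow> nat \<Rightarrow> complex" where
  "U_plus = (\<lambda>F. \<Psi> (shift (inv_into (carr (ell2 I)) \<Psi> F)))"

lemma bounded_U_plus: "bounded_operator A U_plus"
  unfolding U_plus_def by (rule unitary_conjugate(1)[OF ell2_hilbert_space unitary_\<Psi> bounded_shift])

lemma U_plus_\<Psi>: "a \<in> carr (ell2 I) \<Longrightarrow> U_plus (\<Psi> a) = \<Psi> (shift a)"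
  unfolding U_plus_def by (rule unitary_conjugate(2)[OF ell2_hilbert_space unitary_\<Psi> bounded_shift])

lemma unit_mem_I: "j \<le> m \<Longrightarrow> ell2_unit (j, n) \<in> carr (ell2 I)"
  by (simp add: I_def)

lemma U_plus_\<Psi>_unit:
  "j \<le> m \<Longrightarrow> U_plus (\<Psi> (ell2_unit (j, n))) = complex_of_real (mu j) *\<^sub>C e_vec m lam j (Suc n)"
  by (subst U_plus_\<Psi>) (simp_all only: unit_mem_I shift_unit \<Psi>_unit)

text \<open>The factor \<open>mu j\<close> separating \<open>e_vec\<close> from the orthonormal
  basis does not depend on \<open>n\<close>, so linearity removes it from both sides.\<close>

lemma U_plus_e_vec:
  assumes j: "j \<le> m"
  shows "U_plus (e_vec m lam j n) = e_vec m lam j (Suc n)"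
proof -
  let ?c = "complex_of_real (1 / mu j)"
  have c: "?c *\<^sub>C (complex_of_real (mu j) *\<^sub>C F) = F" for F :: "complex \<Rightarrow> nat \<Rightarrow> complex"
    using mu_pos[OF j] unfolding complex_vector.scale_scale of_real_mult[symmetric] by (simp add: scaleC_one)
  have "\<Psi> (ell2_unit (j, n)) \<in> carr A"
    unfolding complex_hilbert_space.unitary_carr[OF ell2_hilbert_space unitary_\<Psi>]
    using unit_mem_I[OF j] by blast
  hence "U_plus (?c *\<^sub>C \<Psi> (ell2_unit (j, n))) = ?c *\<^sub>C U_plus (\<Psi> (ell2_unit (j, n)))"
    by (rule bounded_operator_scale[OF bounded_U_plus])
  thus ?thesis
    unfolding U_plus_\<Psi>_unit[OF j] unfolding \<Psi>_unit[OF j] c .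
qed

text \<open>\<open>is_U_plus\<close> writes the second index as \<open>n - j\<close>; for
  \<open>j \<le> n\<close>, raising \<open>n\<close> by one raises that index by one.\<close>

lemma is_U_plus_U_plus: "is_U_plus m lam mu U_plus"
  by (auto simp: is_U_plus_def bounded_U_plus U_plus_e_vec Suc_diff_le)

text \<open>In row \<open>l\<close> the difference is \<open>\<kappa> j l\<close> times the scalar
  difference for derivatives of order \<open>l - j\<close>. The scalar estimates have rate 1/n for
  every order, and the norm equivalence combines the rows.\<close>

lemma e_vec_shift_bound:
  assumes j: "j \<le> m"
  shows "\<exists>C. \<forall>n. mult_z (e_vec m lam j n) - e_vec m lam j (Suc n) \<in> carr A \<and>
    hnorm A (mult_z (e_vec m lam j n) - e_vec m lam j (Suc n)) \<le> C / (2 * L j + real n)"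
proof -
  define h where "h n l = zmul ((Dz ^^ (l - j)) (unit_mon (L j) n)) - (Dz ^^ (l - j)) (unit_mon (L j) (Suc n))" for n l
  have "\<forall>l. \<exists>C. j \<le> l \<longrightarrow> C \<ge> 0 \<and> (\<forall>n. h n l \<in> carr (B l) \<and> hnorm (B l) (h n l) \<le> C / (2 * L j + real n))"
  proof
    fix l
    show "\<exists>C. j \<le> l \<longrightarrow> C \<ge> 0 \<and> (\<forall>n. h n l \<in> carr (B l) \<and> hnorm (B l) (h n l) \<le> C / (2 * L j + real n))"
    proof (cases "j \<le> l")
      case True
      show ?thesis
        using unit_mon_deriv_shift_bound[OF L_pos[of j], where i = "l - j"]
        unfolding lam_idx_add[OF True, symmetric] h_def by blast
    qed blast
  qed
  then obtain c where c: "\<And>l. j \<le> l \<Longrightarrow> c l \<ge> 0" "\<And>l n. j \<le> l \<Longrightarrow> h n l \<in> carr (B l)"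
    "\<And>l n. j \<le> l \<Longrightarrow> hnorm (B l) (h n l) \<le> c l / (2 * L j + real n)"
    by metis
  define S where "S n = mult_z (e_vec m lam j n) - e_vec m lam j (Suc n)" for n
  have component_S: "component (S n) l = (if j \<le> l \<and> l \<le> m then \<kappa> j l *\<^sub>C h n l else 0)" for n l
  proof -
    have "zmul 0 = 0" by (auto simp: zmul_def)
    thus ?thesis
      unfolding S_def component_diff component_mult_z e_vec_eq component_Gam[OF disc_fun_unit_mon] h_def
      by (auto simp: zmul_scaleC complex_vector.scale_right_diff_distrib simp del: scaleC_fun_apply)
  qed
  have S_mem: "S n \<in> carr A" for n
    by (rule A_mem) (auto simp: component_S intro: B.scaleC_mem c(2))
  obtain C where C: "C \<ge> 0" "\<And>F. F \<in> carr A \<Longrightarrow> hnorm A F \<le> C * (\<Sum>l\<le>m. hnorm (B l) (component F l))"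
    using A_memI by metis
  \<comment> \<open>\<open>c l\<close> is known to be nonnegative only for \<open>j \<le> l\<close>;
    the absolute value keeps the bounds for the other rows nonnegative.\<close>
  define K where "K = C * (\<Sum>l\<le>m. cmod (\<kappa> j l) * \<bar>c l\<bar>)"
  have "hnorm A (S n) \<le> K / (2 * L j + real n)" for n
  proof -
    have pos: "2 * L j + real n > 0" using L_pos[of j] by (simp add: add_pos_nonneg)
    have "hnorm A (S n) \<le> C * (\<Sum>l\<le>m. hnorm (B l) (component (S n) l))"
      by (rule C(2)[OF S_mem])
    also have "\<dots> \<le> C * (\<Sum>l\<le>m. cmod (\<kappa> j l) * (\<bar>c l\<bar> / (2 * L j + real n)))"
    proof (intro mult_left_mono sum_mono C(1))
      fix l assume "l \<in> {..m}"
      show "hnorm (B l) (component (S n) l) \<le> cmod (\<kappa> j l) * (\<bar>c l\<bar> / (2 * L j + real n))"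
      proof (cases "j \<le> l")
        case True
        have "hnorm (B l) (component (S n) l) = cmod (\<kappa> j l) * hnorm (B l) (h n l)"
          using True \<open>l \<in> {..m}\<close> by (simp add: component_S B.hnorm_scaleC[OF c(2)[OF True]] del: scaleC_fun_apply)
        moreover have "hnorm (B l) (h n l) \<le> \<bar>c l\<bar> / (2 * L j + real n)"
          using c(3)[OF True, of n] c(1)[OF True] by simp
        ultimately show ?thesis by (simp only: mult_left_mono norm_ge_zero)
      next
        case False
        hence "component (S n) l = 0" by (simp add: component_S)
        thus ?thesis using pos by simp
      qed
    qed
    also have "\<dots> = K / (2 * L j + real n)"
      by (simp add: K_def flip: sum_divide_distrib)
    finally show ?thesis .
  qed
  thus ?thesis using S_mem unfolding S_def by blast
qed

text \<open>On each of the \<open>m + 1\<close> sequences of basis vectors the difference has norms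
  of order 1/n, and the squares 1/n^2 are summable.\<close>

theorem hilbert_schmidt_diff: "hilbert_schmidt A (\<lambda>F. mult_z F - U_plus F)"
  unfolding hilbert_schmidt_def
proof (intro conjI exI)
  interpret E: complex_hilbert_space "ell2 I" by (rule ell2_hilbert_space)
  let ?S = "\<lambda>F. mult_z F - U_plus F"
  show S: "bounded_operator A ?S"
    by (rule A.bounded_operator_diff[OF bounded_mult_z bounded_U_plus])
  let ?e = "\<lambda>p. \<Psi> (ell2_unit p)"
  show "orthonormal_basis A (\<Psi> ` ell2_unit ` I)"
    by (rule E.unitary_orthonormal_basis[OF unitary_\<Psi> ell2_unit_basis])
  \<comment> \<open>\<open>hilbert_schmidt\<close> sums over the set of basis vectors; injectivity
    turns this into a sum over indices.\<close>
  have inj: "inj_on ?e I"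
  proof (rule inj_onI)
    fix p q assume "p \<in> I" "q \<in> I" "?e p = ?e q"
    hence "ip (ell2 I) (ell2_unit p) (ell2_unit p) = ip (ell2 I) (ell2_unit q) (ell2_unit p)"
      using E.unitary_ip[OF unitary_\<Psi>, of "ell2_unit p" "ell2_unit p"]
        E.unitary_ip[OF unitary_\<Psi>, of "ell2_unit q" "ell2_unit p"] by simp
    hence "(ell2_unit p p :: complex) = ell2_unit q p"
      unfolding ell2_ip_unit .
    thus "p = q"
      by (simp add: ell2_unit_def split: if_splits)
  qed
  \<comment> \<open>Extended by zero to all pairs, as \<open>summable_on_slices\<close>
    requires.\<close>
  let ?g = "\<lambda>p. if p \<in> I then (hnorm A (?S (?e p)))\<^sup>2 else 0"
  have "?g summable_on UNIV"
  proof (rule summable_on_slices[of m])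
    fix j assume j: "j \<le> m"
    obtain C where C: "\<And>n. mult_z (e_vec m lam j n) - e_vec m lam j (Suc n) \<in> carr A"
      "\<And>n. hnorm A (mult_z (e_vec m lam j n) - e_vec m lam j (Suc n)) \<le> C / (2 * L j + real n)"
      using e_vec_shift_bound[OF j] by blast
    \<comment> \<open>The second factor replaces the denominator 2\<alpha> + n, where \<alpha> is
      \<open>L j\<close>, by n + 1 uniformly in n.\<close>
    define K where "K = (mu j * C)\<^sup>2 * (1 + 1 / (2 * L j))\<^sup>2"
    have le: "(hnorm A (?S (?e (j, n))))\<^sup>2 \<le> K * (1 / (real (Suc n))\<^sup>2)" for n
    proof -
      let ?d = "mult_z (e_vec m lam j n) - e_vec m lam j (Suc n)"
      have pos: "2 * L j + real n > 0" using L_pos[of j] by (simp add: add_pos_nonneg)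
      have "?S (?e (j, n)) = complex_of_real (mu j) *\<^sub>C ?d"
        unfolding U_plus_\<Psi>_unit[OF j] unfolding \<Psi>_unit[OF j]
        by (rule component_eqI)
           (simp only: component_diff component_mult_z component_scaleC zmul_scaleC complex_vector.scale_right_diff_distrib)
      hence "hnorm A (?S (?e (j, n))) = mu j * hnorm A ?d"
        using mu_pos[OF j] by (simp only: A.hnorm_scaleC[OF C(1)]) simp
      moreover have "mu j * hnorm A ?d \<le> mu j * (C / (2 * L j + real n))"
        using mu_pos[OF j] by (intro mult_left_mono C(2)) auto
      moreover have "0 \<le> mu j * hnorm A ?d"
        using mu_pos[OF j] C(1) by (intro mult_nonneg_nonneg) auto
      ultimately have "(hnorm A (?S (?e (j, n))))\<^sup>2 \<le> (mu j * (C / (2 * L j + real n)))\<^sup>2"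
        by (simp only: power_mono)
      also have "\<dots> = (mu j * C)\<^sup>2 * (1 / (2 * L j + real n))\<^sup>2"
        by (simp add: power_mult_distrib power_divide)
      also have "\<dots> \<le> (mu j * C)\<^sup>2 * ((1 + 1 / (2 * L j)) * (1 / real (Suc n)))\<^sup>2"
      proof (intro mult_left_mono power_mono)
        have "real (Suc n) \<le> (1 + 1 / (2 * L j)) * (2 * L j + real n)"
          using L_pos[of j] by (simp add: field_simps)
        thus "1 / (2 * L j + real n) \<le> (1 + 1 / (2 * L j)) * (1 / real (Suc n))"
          using pos by (simp add: divide_le_eq le_divide_eq mult_ac)
      qed (use pos in auto)
      also have "\<dots> = K * (1 / (real (Suc n))\<^sup>2)"
        by (simp only: K_def power_mult_distrib power_divide power_one mult.assoc)
      finally show ?thesis .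
    qed
    have "summable (\<lambda>n. 1 / (real (Suc n))\<^sup>2)"
      using inverse_power_summable[of 2, where 'a = real] by (subst summable_Suc_iff) (simp add: inverse_eq_divide)
    hence "summable (\<lambda>n. K * (1 / (real (Suc n))\<^sup>2))"
      by (rule summable_mult)
    hence "summable (\<lambda>n. (hnorm A (?S (?e (j, n))))\<^sup>2)"
      by (rule summable_comparison_test'[where N = 0]) (use le in simp)
    hence "(\<lambda>n. (hnorm A (?S (?e (j, n))))\<^sup>2) summable_on UNIV"
      by (subst summable_on_UNIV_nonneg_real_iff) auto
    thus "(\<lambda>n. ?g (j, n)) summable_on UNIV"
      using j by (simp add: I_def)
  qed (auto simp: I_def)
  also have "?g summable_on UNIV \<longleftrightarrow> (\<lambda>p. (hnorm A (?S (?e p)))\<^sup>2) summable_on I"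
    by (rule summable_on_cong_neutral) auto
  finally have "((\<lambda>F. (hnorm A (?S F))\<^sup>2) \<circ> ?e) summable_on I"
    by (simp add: o_def)
  hence "(\<lambda>F. (hnorm A (?S F))\<^sup>2) summable_on (?e ` I)"
    by (subst summable_on_reindex[OF inj])
  thus "(\<lambda>F. (hnorm A (?S F))\<^sup>2) summable_on \<Psi> ` ell2_unit ` I"
    by (simp only: image_image)
qed

end

theorem theorem4p2:
  fixes m :: nat and lam :: real and mu :: "nat \<Rightarrow> real"
  assumes "m \<ge> 1" and "lam > real m / 2"
    and "mu 0 = 1" and "\<forall>j\<in>{1..m}. mu j > 0"
  shows "(\<exists>U S. is_U_plus m lam mu U \<and> hilbert_schmidt (A_space m lam mu) S \<and>
            (\<forall>F \<in> carr (A_space m lam mu). mult_z F = U F + S F))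
       \<and> bounded_operator (A_space m lam mu) mult_z
       \<and> (\<exists>T. is_adjoint (A_space m lam mu) mult_z T \<and> cowen_douglas (A_space m lam mu) T)"
proof -
  interpret A_setting m lam mu
  proof
    show "mu j > 0" if "j \<le> m" for j
      using assms(3,4) that by (cases "j = 0") auto
  qed (rule assms(2))
  \<comment> \<open>The Hilbert--Schmidt summand is taken to be the difference itself.\<close>
  have "\<forall>F\<in>carr A. mult_z F = U_plus F + (mult_z F - U_plus F)"
    by simp
  thus ?thesis
    using is_U_plus_U_plus hilbert_schmidt_diff bounded_mult_z adjoint_cowen_douglas by blast
qed

end
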